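(* Let $n,d\ge 1$ be integers and $1<p<\infty$. Let $W$ be a $(d\times d)$ matrix $A_p$ weight on $\mathbb{R}^n$ and let $\{f_k\}_{k=1}^\infty$ be a sequence of locally integrable functions $f_k:\mathbb{R}^n\to\mathbb{C}^d$. Then, for each $1<q<\infty$, $$\left\|\left(\sum_{k=1}^\infty |M_W f_k|^q\right)^{1/q}\right\|_{L^p(\mathbb{R}^n)}\le C(n,d,p,q)\,[W]_{A_p}^{\max\left\{\frac1{q-1},\frac1{p-1}\right\}}\left\|\left(\sum_{k=1}^\infty |W^{1/p} f_k|^q\right)^{1/q}\right\|_{L^p(\mathbb{R}^n)},$$ where $C(n,d,p,q)$ is a finite constant depending only on $n,d,p,q$, and $M_W$ is the Christ--Goldberg maximal operator corresponding to the weight $W$ and the exponent $p$.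
   Context: $|v|$ is the Euclidean norm of $v\in\mathbb{C}^d$ and $|A|$ the operator norm of a matrix $A\in \mathrm{M}_d(\mathbb{C})$ (its largest singular value). A $(d\times d)$ matrix weight on $\mathbb{R}^n$ is a locally integrable function $W:\mathbb{R}^n\to \mathrm{M}_d(\mathbb{C})$ such that $W(x)$ is a (Hermitian) positive-definite matrix for a.e. $x$. For $1<p<\infty$ and $p'=p/(p-1)$, $$[W]_{A_p}:=\sup_{Q}\frac1{|Q|}\int_Q\left(\frac1{|Q|}\int_Q|W(x)^{1/p}W(y)^{-1/p}|^{p'}\,dy\right)^{p/p'}dx,$$ the supremum being over all bounded cubes $Q\subset\mathbb{R}^n$ with sides parallel to the axes; $W$ is a matrix $A_p$ weight if $[W]_{A_p}<\infty$. The Christ--Goldberg maximal operator (for $W$ and $p$) acts on a locally integrable $f:\mathbb{R}^n\to\mathbb{C}^d$ by $$M_Wf(x):=\sup_Q \frac{1}{|Q|}\int_Q|W(x)^{1/p}f(y)|\,dy\;\mathbf 1_Q(x),$$ the supremum being over all cubes $Q$ with sides parallel to the coordinate axes. The inequality is trivially true when the right-hand side is infinite. *)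

theory Defs
  imports "HOL-Analysis.Analysis"
begin

subsection \<open>Matrices\<close>

definition adj :: "complex^'d^'d \<Rightarrow> complex^'d^'d" where
  "adj A = map_matrix cnj (transpose A)"

definition hermitian :: "complex^'d^'d \<Rightarrow> bool" where
  "hermitian A \<longleftrightarrow> adj A = A"

text \<open>On \<open>complex^'d\<close> the library's inner product is the real part of the standard sesquilinear
  form. For Hermitian \<open>A\<close> the quadratic form is real, so nothing is lost below.\<close>

definition positive_definite :: "complex^'d^'d \<Rightarrow> bool" where
  "positive_definite A \<longleftrightarrow> hermitian A \<and> (\<forall>v. v \<noteq> 0 \<longrightarrow> 0 < v \<bullet> (A *v v))"

definition unitary :: "complex^'d^'d \<Rightarrow> bool" where
  "unitary U \<longleftrightarrow> adj U ** U = mat 1 \<and> U ** adj U = mat 1"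

definition diag :: "('d \<Rightarrow> real) \<Rightarrow> complex^'d^'d" where
  "diag l = (\<chi> i j. if i = j then complex_of_real (l i) else 0)"

text \<open>Real powers by spectral calculus: \<open>A = U \<Lambda> U\<^sup>*\<close> gives \<open>A\<^sup>s = U \<Lambda>\<^sup>s U\<^sup>*\<close>. The result does not depend on
  the diagonalization (\<open>mat_powr_eqI\<close>); it is unspecified if \<open>A\<close> is not positive definite.\<close>

definition mat_powr :: "complex^'d^'d \<Rightarrow> real \<Rightarrow> complex^'d^'d" where
  "mat_powr A s = (THE B. \<exists>U l. unitary U \<and> (\<forall>i. 0 < l i) \<and>
     A = U ** diag l ** adj U \<and> B = U ** diag (\<lambda>i. l i powr s) ** adj U)"

lemma unitary_diag_unique:
  fixes U V :: "complex^'d^'d"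
  assumes U: "unitary U" and V: "unitary V"
    and eq: "U ** diag l ** adj U = V ** diag m ** adj V"
  shows "U ** diag (\<lambda>i. g (l i)) ** adj U = V ** diag (\<lambda>i. g (m i)) ** adj V"
proof -
  define X where "X = adj V ** U"
  have XD: "(X ** diag h) $ i $ j = X $ i $ j * of_real (h j)" for h i j
    by (simp add: matrix_matrix_mult_def diag_def if_distrib cong: if_cong)
  have DX: "(diag h ** X) $ i $ j = of_real (h i) * X $ i $ j" for h i j
    by (simp add: matrix_matrix_mult_def diag_def if_distrib if_distribR cong: if_cong)
  have "X ** diag l = adj V ** (U ** diag l ** adj U) ** U"
    using U by (simp add: X_def unitary_def matrix_mul_assoc [symmetric])
  also have "\<dots> = (adj V ** V) ** diag m ** X"
    unfolding eq by (simp add: X_def matrix_mul_assoc)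
  also have "\<dots> = diag m ** X"
    using V by (simp add: unitary_def)
  finally have *: "X ** diag l = diag m ** X" .
  have "X $ i $ j * of_real (l j) = of_real (m i) * X $ i $ j" for i j
    using * XD DX by metis
  then have "X $ i $ j = 0 \<or> l j = m i" for i j
    by (metis mult.commute mult_cancel_left of_real_eq_iff)
  then have "X $ i $ j * of_real (g (l j)) = of_real (g (m i)) * X $ i $ j" for i j
    by (metis mult.commute mult_zero_left)
  then have **: "X ** diag (\<lambda>i. g (l i)) = diag (\<lambda>i. g (m i)) ** X"
    by (simp add: vec_eq_iff XD DX)
  have "U ** diag (\<lambda>i. g (l i)) ** adj U = (V ** adj V) ** U ** diag (\<lambda>i. g (l i)) ** adj U"
    using V by (simp add: unitary_def)
  also have "\<dots> = V ** (X ** diag (\<lambda>i. g (l i))) ** adj U"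
    by (simp add: X_def matrix_mul_assoc)
  also have "\<dots> = V ** diag (\<lambda>i. g (m i)) ** adj V ** (U ** adj U)"
    unfolding ** by (simp add: X_def matrix_mul_assoc)
  also have "\<dots> = V ** diag (\<lambda>i. g (m i)) ** adj V"
    using U by (simp add: unitary_def)
  finally show ?thesis .
qed

lemma mat_powr_eqI:
  assumes "unitary U" "\<And>i. 0 < l i" "A = U ** diag l ** adj U"
  shows "mat_powr A s = U ** diag (\<lambda>i. l i powr s) ** adj U"
  unfolding mat_powr_def
proof (rule the_equality)
  fix B assume "\<exists>U l. unitary U \<and> (\<forall>i. 0 < l i) \<and>
     A = U ** diag l ** adj U \<and> B = U ** diag (\<lambda>i. l i powr s) ** adj U"
  then show "B = U ** diag (\<lambda>i. l i powr s) ** adj U"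
    using unitary_diag_unique[where g = "\<lambda>t. t powr s"] assms by metis
qed (use assms in blast)

definition op_norm :: "complex^'d^'d \<Rightarrow> real" where
  "op_norm A = onorm ((*v) A)"

subsection \<open>Powers, averages and norms in the extended nonnegative reals\<close>

text \<open>Only used with exponents \<open>a > 0\<close>.\<close>

definition enn_powr :: "ennreal \<Rightarrow> real \<Rightarrow> ennreal" where
  "enn_powr x a = (if x = top then top else ennreal (enn2real x powr a))"

definition cubes :: "(real^'n) set set" where
  "cubes = {cbox a (\<chi> i. a $ i + r) | a r. 0 < r}"

definition average :: "(real^'n) set \<Rightarrow> (real^'n \<Rightarrow> ennreal) \<Rightarrow> ennreal" where
  "average Q g = (\<integral>\<^sup>+y\<in>Q. g y \<partial>lebesgue) / emeasure lebesgue Q"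

definition Lp_norm :: "real \<Rightarrow> (real^'n \<Rightarrow> ennreal) \<Rightarrow> ennreal" where
  "Lp_norm p g = enn_powr (\<integral>\<^sup>+x. enn_powr (g x) p \<partial>lebesgue) (1 / p)"

definition lq_norm :: "real \<Rightarrow> (nat \<Rightarrow> ennreal) \<Rightarrow> ennreal" where
  "lq_norm q a = enn_powr (\<Sum>k. enn_powr (a k) q) (1 / q)"

subsection \<open>Matrix weights and the Christ--Goldberg maximal operator\<close>

definition locally_integrable :: "(real^'n \<Rightarrow> 'b::euclidean_space) \<Rightarrow> bool" where
  "locally_integrable f \<longleftrightarrow> (\<forall>K. compact K \<longrightarrow> f absolutely_integrable_on K)"

definition matrix_weight :: "(real^'n \<Rightarrow> complex^'d^'d) \<Rightarrow> bool" where
  "matrix_weight W \<longleftrightarrow> locally_integrable W \<and> (AE x in lebesgue. positive_definite (W x))"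

definition Ap_const :: "real \<Rightarrow> (real^'n \<Rightarrow> complex^'d^'d) \<Rightarrow> ennreal" where
  "Ap_const p W = (let p' = p / (p - 1) in
     SUP Q\<in>cubes. average Q (\<lambda>x. enn_powr
       (average Q (\<lambda>y. ennreal (op_norm (mat_powr (W x) (1 / p) ** mat_powr (W y) (- 1 / p)) powr p')))
       (p / p')))"

definition matrix_Ap :: "real \<Rightarrow> (real^'n \<Rightarrow> complex^'d^'d) \<Rightarrow> bool" where
  "matrix_Ap p W \<longleftrightarrow> matrix_weight W \<and> Ap_const p W < top"

definition CG_maximal ::
    "real \<Rightarrow> (real^'n \<Rightarrow> complex^'d^'d) \<Rightarrow> (real^'n \<Rightarrow> complex^'d) \<Rightarrow> real^'n \<Rightarrow> ennreal" where
  "CG_maximal p W f x =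
     (SUP Q\<in>cubes. average Q (\<lambda>y. ennreal (norm (mat_powr (W x) (1 / p) *v f y))) * indicator Q x)"

end

theory Submission
  imports Defs
begin

text \<open>
  Put \<open>A = W\<^sup>1\<^sup>/\<^sup>p\<close> and \<open>F\<^sub>k = \<bar>A f\<^sub>k\<bar>\<close>. Since \<open>\<bar>A(x) f\<^sub>k(y)\<bar> \<le> \<bar>A(x) A(y)\<^sup>-\<^sup>1\<bar> F\<^sub>k(y)\<close>, it suffices to bound the positive
  scalar maximal operators \<open>T F(x) = sup \<langle>\<bar>A(x) A\<^sup>-\<^sup>1\<bar> F\<rangle>\<^sub>Q\<close> over the cells \<open>Q\<close> containing \<open>x\<close> of finitely many
  shifted dyadic grids.

  For one function, let \<open>P\<close> be the reducing matrix of \<open>A\<close> on \<open>Q\<close>, so that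
  \<open>\<bar>A(x) A(y)\<^sup>-\<^sup>1\<bar> \<le> \<bar>A(x) P\<^sup>-\<^sup>1\<bar> \<bar>P A(y)\<^sup>-\<^sup>1\<bar>\<close>. Stopping where the average of \<open>\<bar>P A\<^sup>-\<^sup>1\<bar> F\<close> doubles, and using the sharp
  reverse Hoelder inequality for the scalar \<open>A\<^sub>p\<^sub>'\<close> weight \<open>\<bar>P A\<^sup>-\<^sup>1\<bar>\<^sup>p\<^sup>'\<close>, one dominates \<open>T F\<close> in \<open>L\<^sup>p\<close> by an ordinary
  maximal function of \<open>F\<^sup>s\<close> with \<open>s < p\<close>; this gives the power \<open>1/(p-1)\<close> of the characteristic \<open>[W]\<close>.

  If \<open>q \<ge> p\<close>, Hoelder's inequality for the positive operator \<open>T\<close> interpolates between \<open>\<ell>\<^sup>p\<close>, where the scalar bound can be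
  summed, and \<open>\<ell>\<^sup>\<infinity>\<close>, where \<open>sup T F\<^sub>k \<le> T (sup F\<^sub>k)\<close>. If \<open>q < p\<close>, one extrapolates: a Rubio de Francia iteration of the
  maximal operator of the transposed kernel, which is bounded on \<open>L\<^sup>p\<^sup>'\<close> with norm \<open>O([W])\<close>, turns the dualizing
  function into a scalar \<open>g\<close> for which \<open>g W\<^sup>q\<^sup>/\<^sup>p\<close> is an \<open>A\<^sub>q\<close> weight with characteristic \<open>O([W])\<close>, and the scalar bound with
  exponent \<open>q\<close> gives the power \<open>1/(q-1)\<close>.
\<close>

subsection \<open>Powers of extended nonnegative reals\<close>

text \<open>Two properties of the kernel \<open>norm (A x ** B y)\<close> carry the argument. It is
  submultiplicative through any intermediate invertible matrix, which is what turns a matrix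
  condition into scalar ones. And it is invariant under transposition, so the adjoint operator has
  the same form, with the exponent p' and, for a weight of characteristic N, a characteristic of
  order N^(1/(p-1)). The second property explains the linear growth in the extrapolation: the scalar
  bound on L^p' has the power 1/(p'-1) = p-1, and (N^(1/(p-1)))^(p-1) = N. The extrapolated
  characteristic is of order c^\<theta> N^(1-\<theta>), where c is the norm of the adjoint, so it is
  again of order N and nothing is lost on the way from p to q. The obstacle in the stopping
  arguments is that there is neither a largest nor a smallest cell. Hence each supremum over
  generations is first cut to finitely many of them, induction runs over their number, and the
  bounds do not depend on the cut.\<close>

notation enn_powr (infixr "\<up>" 80)

lemma enn_powr_ennreal: "0 \<le> r \<Longrightarrow> ennreal r \<up> a = ennreal (r powr a)"
  by (simp add: enn_powr_def)

lemma enn_powr_top [simp]: "top \<up> a = top"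
  by (simp add: enn_powr_def)

lemma enn_powr_0 [simp]: "0 \<up> a = 0"
  by (simp add: enn_powr_def)

lemma enn_powr_1 [simp]: "1 \<up> a = 1"
  using enn_powr_ennreal[of 1 a] by simp

lemma enn_powr_one_right [simp]: "x \<up> 1 = x"
  by (cases x) (auto simp: enn_powr_def)

lemma enn_powr_eq_0_iff [simp]: "x \<up> a = 0 \<longleftrightarrow> x = 0"
  by (cases x) (auto simp: enn_powr_def)

lemma enn_powr_eq_top_iff [simp]: "x \<up> a = top \<longleftrightarrow> x = top"
  by (cases x) (auto simp: enn_powr_def)

lemma enn_powr_less_top_iff [simp]: "x \<up> a < top \<longleftrightarrow> x < top"
  by (simp flip: less_top)

lemma enn_powr_mult: "0 < a \<Longrightarrow> (x * y) \<up> a = x \<up> a * y \<up> a"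
  by (cases x; cases y)
     (auto simp: enn_powr_def ennreal_mult_eq_top_iff ennreal_top_mult ennreal_mult_top
        enn2real_mult powr_mult ennreal_mult)

lemma enn_powr_powr: "0 < a \<Longrightarrow> 0 < b \<Longrightarrow> (x \<up> a) \<up> b = x \<up> (a * b)"
  by (cases x) (auto simp: enn_powr_def powr_powr)

text \<open>Valid for all real exponents, since \<open>0 \<up> a = 0\<close> and
  \<open>top \<up> a = top\<close> hold for every \<open>a\<close>, zero and negative ones
  included.\<close>

lemma enn_powr_add: "x \<up> (a + b) = x \<up> a * x \<up> b"
  by (cases x) (auto simp: enn_powr_def powr_add ennreal_mult)

lemma enn_powr_mono: "0 \<le> a \<Longrightarrow> x \<le> y \<Longrightarrow> x \<up> a \<le> y \<up> a"
  by (cases x; cases y) (auto simp: enn_powr_def powr_mono2 top_unique intro!: ennreal_leI)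

lemma enn_powr_le_iff: "0 < a \<Longrightarrow> x \<up> a \<le> y \<up> a \<longleftrightarrow> x \<le> y"
  using enn_powr_mono[of a x y] enn_powr_mono[of "1/a" "x \<up> a" "y \<up> a"]
  by (auto simp: enn_powr_powr)

lemma enn_powr_le_swap: "0 < a \<Longrightarrow> x \<up> a \<le> y \<longleftrightarrow> x \<le> y \<up> (1 / a)"
  using enn_powr_le_iff[of a x "y \<up> (1/a)"] by (simp add: enn_powr_powr)

lemma borel_measurable_enn_powr [measurable (raw)]:
  assumes [measurable]: "f \<in> borel_measurable M"
  shows "(\<lambda>x. f x \<up> a) \<in> borel_measurable M"
  unfolding enn_powr_def by measurable

text \<open>A positive power is an order isomorphism with inverse the power \<open>1 / a\<close>, so
  it commutes with arbitrary suprema.\<close>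

lemma enn_powr_SUP:
  assumes "0 < a"
  shows "(SUP i\<in>I. f i) \<up> a = (SUP i\<in>I. f i \<up> a)"
proof (rule antisym)
  have "f i \<le> (SUP i\<in>I. f i \<up> a) \<up> (1 / a)" if "i \<in> I" for i
    using assms that by (subst enn_powr_le_swap[symmetric]) (auto intro: SUP_upper)
  then show "(SUP i\<in>I. f i) \<up> a \<le> (SUP i\<in>I. f i \<up> a)"
    using assms by (subst enn_powr_le_swap) (auto intro: SUP_least)
  show "(SUP i\<in>I. f i \<up> a) \<le> (SUP i\<in>I. f i) \<up> a"
    using assms by (intro SUP_least enn_powr_mono SUP_upper) auto
qed

lemma enn_powr_sup: "0 < a \<Longrightarrow> (sup x y) \<up> a = sup (x \<up> a) (y \<up> a)"
  using enn_powr_SUP[of a id "{x, y}"] by simp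

text \<open>Comparing every term with the largest one treats exponents below and above 1 alike, at
  the price of a constant that is not sharp. Both ranges occur, for instance for
  \<open>p / q\<close>.\<close>

lemma sum_enn_powr_le:
  assumes "finite I" "0 < a"
  shows "(\<Sum>i\<in>I. f i) \<up> a \<le> ennreal (real (card I) powr a) * (\<Sum>i\<in>I. f i \<up> a)"
proof (cases "I = {}")
  case False
  define m where "m = Max (f ` I)"
  have m: "m \<in> f ` I" "\<And>i. i \<in> I \<Longrightarrow> f i \<le> m"
    using False assms unfolding m_def by (auto intro!: Max_in)
  have "(\<Sum>i\<in>I. f i) \<le> ennreal (real (card I)) * m"
    using sum_bounded_above[of I f m] m by (simp add: ennreal_of_nat_eq_real_of_nat)
  then have "(\<Sum>i\<in>I. f i) \<up> a \<le> (ennreal (real (card I)) * m) \<up> a"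
    using assms by (intro enn_powr_mono) auto
  also have "\<dots> = ennreal (real (card I) powr a) * m \<up> a"
    using assms by (simp add: enn_powr_mult enn_powr_ennreal)
  also have "m \<up> a \<le> (\<Sum>i\<in>I. f i \<up> a)"
  proof -
    obtain i where "i \<in> I" "m = f i" using m by auto
    then show ?thesis using assms member_le_sum[of i I "\<lambda>i. f i \<up> a"] by auto
  qed
  finally show ?thesis by (simp add: mult_left_mono)
qed (use assms in auto)

section \<open>Young, Hoelder and Jensen inequalities\<close>

lemma enn_powr_young:
  assumes "0 < a" "0 < b" "a + b = 1"
  shows "x \<up> a * y \<up> b \<le> ennreal a * x + ennreal b * y"
proof -
  consider "x = top" | "y = top" | "x = 0" | "y = 0" | r s where "x = ennreal r" "y = ennreal s" "r > 0" "s > 0"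
    by (cases x; cases y) (auto simp: ennreal_zero_less_top less_le)
  then show ?thesis
  proof cases
    case 5
    then show ?thesis using assms Youngs_inequality_0[of a b r s]
      by (simp add: enn_powr_ennreal flip: ennreal_mult ennreal_plus)
  qed (use assms in \<open>auto simp: ennreal_mult_top ennreal_top_mult\<close>)
qed

text \<open>Both integrals are normalised to 1 and Young's inequality is integrated. The powers
  stand inside the integrand with \<open>a + b = 1\<close>, so that exponents such as
  \<open>q / p\<close> or \<open>1 - \<theta>\<close> can be inserted without naming conjugate
  pairs.\<close>

lemma nn_integral_Hoelder:
  assumes [measurable]: "f \<in> borel_measurable M" "g \<in> borel_measurable M"
    and ab: "0 < a" "0 < b" "a + b = 1"
  shows "(\<integral>\<^sup>+x. f x \<up> a * g x \<up> b \<partial>M) \<le> (\<integral>\<^sup>+x. f x \<partial>M) \<up> a * (\<integral>\<^sup>+x. g x \<partial>M) \<up> b"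
proof -
  let ?F = "\<integral>\<^sup>+x. f x \<partial>M" and ?G = "\<integral>\<^sup>+x. g x \<partial>M"
  consider (zero) "?F = 0 \<or> ?G = 0" | (top) "?F \<noteq> 0" "?G \<noteq> 0" "?F = top \<or> ?G = top"
    | (fin) "0 < ?F" "?F < top" "0 < ?G" "?G < top"
    by (metis not_gr_zero top.not_eq_extremum)
  then show ?thesis
  proof cases
    case zero
    then have "AE x in M. f x \<up> a * g x \<up> b = 0"
      by (auto simp: nn_integral_0_iff_AE)
    then have "(\<integral>\<^sup>+x. f x \<up> a * g x \<up> b \<partial>M) = 0"
      by (simp add: nn_integral_0_iff_AE)
    then show ?thesis by simp
  next
    case top
    then show ?thesis by (auto simp: ennreal_mult_top ennreal_top_mult)
  next
    case fin
    have "f x \<up> a * g x \<up> b = ?F \<up> a * ?G \<up> b * ((f x / ?F) \<up> a * (g x / ?G) \<up> b)" for x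
    proof -
      have "f x = ?F * (f x / ?F)" "g x = ?G * (g x / ?G)"
        using fin by (auto simp: ennreal_times_divide ennreal_mult_divide_eq mult.commute)
      then have "f x \<up> a * g x \<up> b = (?F * (f x / ?F)) \<up> a * (?G * (g x / ?G)) \<up> b"
        by simp
      also have "\<dots> = ?F \<up> a * ?G \<up> b * ((f x / ?F) \<up> a * (g x / ?G) \<up> b)"
        using ab by (simp only: enn_powr_mult mult_ac)
      finally show ?thesis .
    qed
    then have "(\<integral>\<^sup>+x. f x \<up> a * g x \<up> b \<partial>M) = ?F \<up> a * ?G \<up> b * (\<integral>\<^sup>+x. (f x / ?F) \<up> a * (g x / ?G) \<up> b \<partial>M)"
      by (simp add: nn_integral_cmult)
    also have "(\<integral>\<^sup>+x. (f x / ?F) \<up> a * (g x / ?G) \<up> b \<partial>M) \<le> (\<integral>\<^sup>+x. ennreal a * (f x / ?F) + ennreal b * (g x / ?G) \<partial>M)"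
      using ab by (intro nn_integral_mono enn_powr_young)
    also have "\<dots> = ennreal a * (?F / ?F) + ennreal b * (?G / ?G)"
      by (simp add: nn_integral_add nn_integral_cmult nn_integral_divide)
    also have "\<dots> = 1"
      using fin ab by (simp flip: ennreal_plus)
    finally show ?thesis by (simp add: mult_left_mono)
  qed
qed

lemma nn_integral_Hoelder_conj:
  assumes [measurable]: "f \<in> borel_measurable M" "g \<in> borel_measurable M"
    and rs: "1 < r" "1 < s" "1 / r + 1 / s = 1"
  shows "(\<integral>\<^sup>+x. f x * g x \<partial>M) \<le> (\<integral>\<^sup>+x. f x \<up> r \<partial>M) \<up> (1 / r) * (\<integral>\<^sup>+x. g x \<up> s \<partial>M) \<up> (1 / s)"
  using nn_integral_Hoelder[of "\<lambda>x. f x \<up> r" M "\<lambda>x. g x \<up> s" "1/r" "1/s"] rs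
  by (simp add: enn_powr_powr)

text \<open>Hoelder's inequality against the constant 1.\<close>

lemma nn_integral_Jensen_powr:
  assumes [measurable]: "f \<in> borel_measurable M" and r: "1 \<le> r"
    and 1: "emeasure M (space M) = 1"
  shows "(\<integral>\<^sup>+x. f x \<partial>M) \<up> r \<le> (\<integral>\<^sup>+x. f x \<up> r \<partial>M)"
proof (cases "r = 1")
  case False
  then have r: "r > 1" using r by simp
  let ?s = "r / (r - 1)"
  have "(\<integral>\<^sup>+x. f x * 1 \<partial>M) \<le> (\<integral>\<^sup>+x. f x \<up> r \<partial>M) \<up> (1 / r) * (\<integral>\<^sup>+x. 1 \<up> ?s \<partial>M) \<up> (1 / ?s)"
    using r by (intro nn_integral_Hoelder_conj) (auto simp: field_simps)
  then have "(\<integral>\<^sup>+x. f x \<partial>M) \<up> r \<le> ((\<integral>\<^sup>+x. f x \<up> r \<partial>M) \<up> (1 / r)) \<up> r"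
    using r 1 by (intro enn_powr_mono) auto
  also have "\<dots> = (\<integral>\<^sup>+x. f x \<up> r \<partial>M)"
    using r by (simp add: enn_powr_powr)
  finally show ?thesis .
qed simp

subsection \<open>Matrix norms\<close>

lemma norm_matrix_vector_le:
  fixes A :: "complex^'d^'d"
  shows "norm (A *v v) \<le> norm A * norm v"
proof -
  have "norm ((A *v v) $ i) \<le> norm (A $ i) * norm v" for i
  proof -
    have "norm ((A *v v) $ i) \<le> (\<Sum>j\<in>UNIV. \<bar>norm (A $ i $ j)\<bar> * \<bar>norm (v $ j)\<bar>)"
      unfolding matrix_vector_mult_def by (auto intro!: order.trans[OF norm_sum] simp: norm_mult)
    also have "\<dots> \<le> L2_set (\<lambda>j. norm (A $ i $ j)) UNIV * L2_set (\<lambda>j. norm (v $ j)) UNIV"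
      by (rule L2_set_mult_ineq)
    finally show ?thesis by (simp add: norm_vec_def)
  qed
  then have "L2_set (\<lambda>i. norm ((A *v v) $ i)) UNIV \<le> L2_set (\<lambda>i. norm (A $ i) * norm v) UNIV"
    by (intro L2_set_mono) auto
  also have "\<dots> = norm A * norm v"
    by (simp add: norm_vec_def L2_set_left_distrib)
  finally show ?thesis by (simp add: norm_vec_def)
qed

lemma norm_transpose [simp]: "norm (transpose (A :: complex^'d^'d)) = norm A"
proof -
  have "(\<Sum>i\<in>UNIV. \<Sum>j\<in>UNIV. (norm (A $ j $ i))\<^sup>2) = (\<Sum>i\<in>UNIV. \<Sum>j\<in>UNIV. (norm (A $ i $ j))\<^sup>2)"
    by (rule sum.swap)
  then show ?thesis
    by (simp add: norm_vec_def L2_set_def transpose_def sum_nonneg)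
qed

lemma matrix_mult_nth_row: "((A :: complex^'d^'d) ** B) $ i = transpose B *v (A $ i)"
  by (simp add: vec_eq_iff matrix_matrix_mult_def matrix_vector_mult_def transpose_def mult.commute)

text \<open>\<open>norm\<close> on nested vectors is the Frobenius norm. A row of a product is the
  transposed right factor applied to a row of the left one, so submultiplicativity follows row by
  row from the bound for vectors.\<close>

lemma norm_matrix_mult_le:
  fixes A B :: "complex^'d^'d"
  shows "norm (A ** B) \<le> norm A * norm B"
proof -
  have "L2_set (\<lambda>i. norm ((A ** B) $ i)) UNIV \<le> L2_set (\<lambda>i. norm (A $ i) * norm B) UNIV"
  proof (intro L2_set_mono)
    show "norm ((A ** B) $ i) \<le> norm (A $ i) * norm B" for i
      unfolding matrix_mult_nth_row mult.commute[of "norm (A $ i)"]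
      using norm_matrix_vector_le[of "transpose B" "A $ i"] by simp
  qed auto
  also have "\<dots> = norm A * norm B"
    by (simp add: norm_vec_def L2_set_left_distrib)
  finally show ?thesis by (simp add: norm_vec_def)
qed

lemma matrix_mult_axis: "(M :: complex^'d^'d) *v axis i 1 = column i M"
  by (simp add: vec_eq_iff matrix_vector_mult_def axis_def column_def if_distrib cong: if_cong)

text \<open>Reduces matrix estimates to the basis vectors; in this way a norm on vectors will
  control matrix factors.\<close>

lemma norm_matrix_le_sum_columns:
  fixes M :: "complex^'d^'d"
  shows "norm M \<le> (\<Sum>i\<in>UNIV. norm (M *v axis i 1))"
proof -
  have "norm M = L2_set (\<lambda>i. norm (column i M)) UNIV"
    using norm_transpose[of M] by (simp add: norm_vec_def transpose_def column_def)
  also have "\<dots> \<le> (\<Sum>i\<in>UNIV. norm (column i M))"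
    by (rule L2_set_le_sum) simp
  finally show ?thesis by (simp only: matrix_mult_axis)
qed

lemma norm_vec_le_sum: "norm (v :: complex^'d) \<le> (\<Sum>i\<in>UNIV. norm (v $ i))"
  unfolding norm_vec_def by (rule L2_set_le_sum) simp

lemma norm_axis_complex: "norm (axis i 1 :: complex^'d) = 1"
proof -
  have "(norm (axis i 1 $ j :: complex))\<^sup>2 = (if j = i then 1 else 0)" for j
    by (simp add: axis_def)
  then show ?thesis by (simp add: norm_vec_def L2_set_def)
qed

lemma norm_column_le: "norm ((M :: complex^'d^'d) *v axis i 1) \<le> norm M"
  using norm_matrix_vector_le[of M "axis i 1"] by (simp add: norm_axis_complex)

lemma continuous_on_det_complex: "continuous_on S (det :: complex^'d^'d \<Rightarrow> complex)"
  unfolding det_def by (intro continuous_intros)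

text \<open>The columns of \<open>P'\<close> form an Auerbach basis of the norm \<open>\<rho>\<close>: they maximise the determinant over
  the unit ball.\<close>

lemma auerbach:
  fixes \<rho> :: "complex^'d \<Rightarrow> real"
  assumes tri: "\<And>u v. \<rho> (u + v) \<le> \<rho> u + \<rho> v"
    and hom: "\<And>c v. \<rho> (c *s v) = norm c * \<rho> v"
    and pos: "\<And>v. v \<noteq> 0 \<Longrightarrow> 0 < \<rho> v"
  obtains P P' :: "complex^'d^'d" where "P ** P' = mat 1" "P' ** P = mat 1"
    "\<And>v. norm (P *v v) \<le> real CARD('d) * \<rho> v" "\<And>v. \<rho> v \<le> real CARD('d) * norm (P *v v)"
proof -
  have \<rho>0: "\<rho> 0 = 0" using hom[of 0 0] by simp
  have nonneg: "\<rho> v \<ge> 0" for v using pos[of v] \<rho>0 by (cases "v = 0") auto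
  have neg: "\<rho> (- v) = \<rho> v" for v
    using hom[of "-1" v] by (simp add: vector_sneg_minus1[symmetric])
  have sum: "\<rho> (\<Sum>i\<in>I. f i) \<le> (\<Sum>i\<in>I. \<rho> (f i))" if "finite I" for I :: "'d set" and f
    using that by (induction I) (auto simp: \<rho>0 intro: order.trans[OF tri])
  define c where "c = (\<Sum>i\<in>UNIV. \<rho> (axis i 1 :: complex^'d))"
  have upper: "\<rho> v \<le> c * norm v" for v
  proof -
    have "\<rho> v = \<rho> (\<Sum>i\<in>UNIV. v $ i *s axis i 1)"
      by (simp add: basis_expansion)
    also have "\<dots> \<le> (\<Sum>i\<in>UNIV. norm (v $ i) * \<rho> (axis i 1))"
      using sum[of UNIV "\<lambda>i. v $ i *s axis i 1"] by (simp add: hom)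
    also have "\<dots> \<le> (\<Sum>i\<in>UNIV. norm v * \<rho> (axis i 1))"
      by (intro sum_mono mult_right_mono nonneg) (simp add: component_le_norm_cart Finite_Cartesian_Product.norm_nth_le)
    finally show ?thesis by (simp add: c_def sum_distrib_left mult.commute sum_distrib_right)
  qed
  \<comment> \<open>\<open>upper\<close> makes \<open>\<rho>\<close> Lipschitz with constant
    \<open>c\<close>; the radius uses \<open>c + 1\<close> to keep the denominator positive.\<close>
  have cont: "continuous_on S \<rho>" for S
  proof (rule continuous_on_subset[OF _ subset_UNIV], rule continuous_onI)
    fix x and e :: real assume e: "e > 0"
    have c: "c \<ge> 0" unfolding c_def by (intro sum_nonneg nonneg)
    have "\<bar>\<rho> y - \<rho> x\<bar> \<le> c * norm (y - x)" for y
      using tri[of "y - x" x] tri[of "x - y" y] upper[of "y - x"] upper[of "x - y"] by (simp add: norm_minus_commute)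
    moreover have "c * norm (y - x) \<le> e" if "dist y x < e / (c + 1)" for y
    proof -
      have "c * norm (y - x) \<le> (c + 1) * (e / (c + 1))"
        using that c e by (intro mult_mono) (auto simp: dist_norm)
      then show ?thesis using c by simp
    qed
    ultimately have "\<forall>y\<in>UNIV. dist y x < e / (c + 1) \<longrightarrow> dist (\<rho> y) (\<rho> x) \<le> e"
      by (metis dist_real_def order.trans)
    then show "\<exists>d>0. \<forall>y\<in>UNIV. dist y x < d \<longrightarrow> dist (\<rho> y) (\<rho> x) \<le> e"
      using c e by (intro exI[of _ "e / (c + 1)"]) auto
  qed
  obtain k where k: "k > 0" "\<And>v. norm v \<le> k * \<rho> v"
  proof -
    have "\<exists>x\<in>sphere 0 1. \<forall>y\<in>sphere 0 (1::real). \<rho> x \<le> \<rho> (y :: complex^'d)"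
      by (rule continuous_attains_inf) (auto simp: cont)
    then obtain x :: "complex^'d" where x: "norm x = 1" "\<And>y. norm y = 1 \<Longrightarrow> \<rho> x \<le> \<rho> y" by auto
    then have px: "\<rho> x > 0" by (intro pos) auto
    have "norm v \<le> (1 / \<rho> x) * \<rho> v" for v
    proof (cases "v = 0")
      case False
      let ?a = "complex_of_real (1 / norm v)"
      have "norm (?a *s v) = 1"
      proof -
        have "?a *s v = (1 / norm v) *\<^sub>R v" by (simp only: vec_eq_iff vector_scaleR_component vector_smult_component) (simp add: scaleR_conv_of_real)
        then show ?thesis using False by simp
      qed
      then have "\<rho> x \<le> norm ?a * \<rho> v" using x hom by metis
      then show ?thesis using px False by (simp add: norm_divide field_simps)
    qed (use px \<rho>0 in simp)
    with px show ?thesis by (intro that[of "1 / \<rho> x"]) auto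
  qed
  \<comment> \<open>Matrices with columns in the closed unit ball of \<open>\<rho>\<close>. The set
    is bounded by the estimate with \<open>k\<close> and closed by continuity, so the modulus of the
    determinant has a maximum on it.\<close>
  define S where "S = {M :: complex^'d^'d. \<forall>j. \<rho> (column j M) \<le> 1}"
  have "bounded S"
    unfolding bounded_iff
  proof (intro exI ballI)
    fix M assume "M \<in> S"
    have "norm M \<le> (\<Sum>i\<in>UNIV. norm (column i M))"
      using norm_matrix_le_sum_columns[of M] by (simp add: matrix_mult_axis)
    also have "\<dots> \<le> (\<Sum>i\<in>(UNIV :: 'd set). k * 1)"
      using \<open>M \<in> S\<close> k by (intro sum_mono order.trans[OF k(2)] mult_left_mono) (auto simp: S_def)
    finally show "norm M \<le> (\<Sum>i\<in>(UNIV :: 'd set). k * 1)" .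
  qed
  moreover have "closed S"
  proof -
    have "continuous_on UNIV (\<lambda>M :: complex^'d^'d. \<rho> (column j M))" for j
      by (rule continuous_on_compose2[OF cont[of UNIV]]) (auto simp: column_def intro!: continuous_intros)
    then show ?thesis
      unfolding S_def by (intro closed_Collect_all closed_Collect_le) auto
  qed
  ultimately have "compact S" by (simp add: compact_eq_bounded_closed)
  moreover have "S \<noteq> {}"
  proof -
    have "column j (0 :: complex^'d^'d) = 0" for j by (simp add: column_def vec_eq_iff)
    then have "0 \<in> S" by (simp add: S_def \<rho>0)
    then show ?thesis by blast
  qed
  ultimately have "\<exists>M\<in>S. \<forall>L\<in>S. norm (det L) \<le> norm (det M)"
    by (intro continuous_attains_sup continuous_intros continuous_on_det_complex)
  then obtain M where M: "M \<in> S" "\<And>L. L \<in> S \<Longrightarrow> norm (det L) \<le> norm (det M)" by blast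
  have "det M \<noteq> 0"
  proof -
    \<comment> \<open>A small multiple of the identity lies in \<open>S\<close>, because
      \<open>\<rho>\<close> of a basis vector is at most \<open>c\<close>; so the maximal
      determinant cannot vanish.\<close>
    let ?t = "complex_of_real (1 / (c + 1))"
    have c: "c \<ge> 0" unfolding c_def by (intro sum_nonneg nonneg)
    have "mat ?t \<in> S"
    proof -
      have "column j (mat ?t :: complex^'d^'d) = ?t *s axis j 1" for j
        by (simp add: column_def mat_def vec_eq_iff axis_def)
      then have "\<rho> (column j (mat ?t)) \<le> 1" for j :: 'd
        using upper[of "axis j 1"] c by (simp add: hom norm_axis_complex norm_divide)
      then show ?thesis by (simp add: S_def)
    qed
    moreover have "det (mat ?t :: complex^'d^'d) \<noteq> 0"
    proof -
      have "?t \<noteq> 0" using c by (simp only: of_real_eq_0_iff divide_eq_0_iff) linarith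
      then show ?thesis by (subst det_diagonal) (simp_all add: mat_def del: of_real_divide)
    qed
    ultimately show ?thesis using M(2)[of "mat ?t"] by auto
  qed
  then have "invertible M" by (simp add: invertible_det_nz)
  then obtain P where P: "M ** P = mat 1" "P ** M = mat 1" by (auto simp: invertible_def)
  \<comment> \<open>By Cramer's rule, replacing column \<open>k\<close> of \<open>M\<close> by the
    \<open>\<rho>\<close>-normalised vector \<open>M *v x\<close> multiplies the determinant by
    \<open>x $ k / \<rho> (M *v x)\<close>. The new matrix is still in \<open>S\<close>, so by
    maximality this factor has modulus at most 1.\<close>
  have coord: "norm (x $ k) \<le> \<rho> (M *v x)" for x k
  proof (cases "x = 0")
    case False
    let ?v = "M *v x"
    have v0: "?v \<noteq> 0"
      using False P by (metis matrix_vector_mul_assoc matrix_vector_mul_lid matrix_vector_mult_0_right)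
    let ?a = "complex_of_real (1 / \<rho> ?v)"
    let ?L = "(\<chi> i j. if j = k then (M *v (?a *s x)) $ i else M $ i $ j) :: complex^'d^'d"
    have "column k ?L = ?a *s ?v"
      by (simp add: column_def vec_eq_iff vector_scalar_commute)
    moreover have "column j ?L = column j M" if "j \<noteq> k" for j
      using that by (simp add: column_def vec_eq_iff)
    ultimately have "\<rho> (column j ?L) \<le> 1" for j
      using M(1) pos[OF v0] by (cases "j = k") (auto simp: S_def hom norm_divide)
    then have "norm (det ?L) \<le> norm (det M)" by (intro M) (simp add: S_def)
    also have "det ?L = (?a *s x) $ k * det M" by (rule cramer_lemma)
    finally have "norm (x $ k) / \<rho> ?v \<le> 1"
      using \<open>det M \<noteq> 0\<close> pos[OF v0] by (simp add: norm_mult norm_divide field_simps)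
    then show ?thesis using pos[OF v0] by simp
  qed (simp add: \<rho>0)
  have PM: "M *v (P *v v) = v" for v by (simp add: matrix_vector_mul_assoc P)
  show ?thesis
  proof (rule that[OF P(2,1)])
    fix v
    have "norm (P *v v) \<le> (\<Sum>i\<in>UNIV. norm ((P *v v) $ i))" by (rule norm_vec_le_sum)
    also have "\<dots> \<le> (\<Sum>i\<in>(UNIV :: 'd set). \<rho> v)"
      using coord[of "P *v v"] by (intro sum_mono) (simp add: PM)
    finally show "norm (P *v v) \<le> real CARD('d) * \<rho> v" by simp
    have "\<rho> v = \<rho> (\<Sum>i\<in>UNIV. (P *v v) $ i *s column i M)"
      by (metis PM matrix_mult_sum)
    also have "\<dots> \<le> (\<Sum>i\<in>UNIV. norm ((P *v v) $ i) * \<rho> (column i M))"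
      using sum[of UNIV "\<lambda>i. (P *v v) $ i *s column i M"] by (simp add: hom)
    also have "\<dots> \<le> (\<Sum>i\<in>(UNIV :: 'd set). norm (P *v v) * 1)"
      using M(1) by (intro sum_mono mult_mono) (auto simp: S_def nonneg Finite_Cartesian_Product.norm_nth_le)
    finally show "\<rho> v \<le> real CARD('d) * norm (P *v v)" by simp
  qed
qed

subsection \<open>Reducing matrices\<close>

lemma borel_measurable_matrix_mult [measurable (raw)]:
  fixes f g :: "'a \<Rightarrow> complex^'d^'d"
  assumes "f \<in> borel_measurable M" "g \<in> borel_measurable M"
  shows "(\<lambda>x. f x ** g x) \<in> borel_measurable M"
  by (rule borel_measurable_continuous_Pair[OF assms])
     (unfold matrix_matrix_mult_def, intro continuous_intros)

lemma borel_measurable_matrix_vector_mult [measurable (raw)]: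
  fixes f :: "'a \<Rightarrow> complex^'d^'d"
  assumes "f \<in> borel_measurable M" "g \<in> borel_measurable M"
  shows "(\<lambda>x. f x *v g x) \<in> borel_measurable M"
  by (rule borel_measurable_continuous_Pair[OF assms])
     (unfold matrix_vector_mult_def, intro continuous_intros)

lemma borel_measurable_matrix_transpose [measurable (raw)]:
  fixes f :: "'a \<Rightarrow> complex^'d^'d"
  assumes "f \<in> borel_measurable M"
  shows "(\<lambda>x. transpose (f x)) \<in> borel_measurable M"
  by (rule measurable_compose[OF assms], rule borel_measurable_continuous_onI)
     (unfold transpose_def, intro continuous_intros)

lemma nn_integral_Minkowski:
  assumes [measurable]: "f \<in> borel_measurable M" "g \<in> borel_measurable M"
    and r: "1 \<le> r"
  shows "(\<integral>\<^sup>+x. (f x + g x) \<up> r \<partial>M) \<up> (1 / r)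
    \<le> (\<integral>\<^sup>+x. f x \<up> r \<partial>M) \<up> (1 / r) + (\<integral>\<^sup>+x. g x \<up> r \<partial>M) \<up> (1 / r)"
proof (cases "r = 1")
  case True
  then show ?thesis by (simp add: nn_integral_add)
next
  case False
  then have r: "r > 1" using r by simp
  let ?h = "\<lambda>x. f x + g x"
  let ?F = "\<integral>\<^sup>+x. f x \<up> r \<partial>M" and ?G = "\<integral>\<^sup>+x. g x \<up> r \<partial>M" and ?X = "\<integral>\<^sup>+x. ?h x \<up> r \<partial>M"
  consider "?F = top \<or> ?G = top" | "?X = 0" | "?F < top" "?G < top" "?X \<noteq> 0"
    by (metis top.not_eq_extremum)
  then show ?thesis
  proof cases
    case 3
    \<comment> \<open>A crude bound that serves only the finiteness of \<open>?X\<close>: the proof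
      ends by dividing by \<open>?X \<up> ?b\<close>.\<close>
    have "?X \<le> (\<integral>\<^sup>+x. ennreal (2 powr r) * (f x \<up> r + g x \<up> r) \<partial>M)"
    proof (rule nn_integral_mono)
      fix x
      have "(\<Sum>i\<in>{False, True}. if i then f x else g x) \<up> r
        \<le> ennreal (real (card {False, True}) powr r) * (\<Sum>i\<in>{False, True}. (if i then f x else g x) \<up> r)"
        by (rule sum_enn_powr_le) (use r in auto)
      then show "?h x \<up> r \<le> ennreal (2 powr r) * (f x \<up> r + g x \<up> r)"
        by (simp add: add.commute)
    qed
    also have "\<dots> = ennreal (2 powr r) * (?F + ?G)"
      by (simp add: nn_integral_cmult nn_integral_add)
    also have "\<dots> < top" using 3 by (simp add: ennreal_mult_less_top)
    finally have X: "?X < top" .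
    let ?b = "1 - 1 / r"
    have split: "?h x \<up> r = f x \<up> 1 * (?h x \<up> r) \<up> ?b + g x \<up> 1 * (?h x \<up> r) \<up> ?b" for x
    proof -
      have "?h x \<up> r = ?h x \<up> (1 + (r - 1))" by simp
      also have "\<dots> = ?h x * ?h x \<up> (r - 1)" by (subst enn_powr_add) simp
      also have "?h x \<up> (r - 1) = (?h x \<up> r) \<up> ?b"
      proof -
        have "r * ?b = r - 1" "0 < ?b" using r by (auto simp: right_diff_distrib)
        then show ?thesis using r by (simp add: enn_powr_powr)
      qed
      finally show ?thesis by (simp add: distrib_right)
    qed
    have part: "(\<integral>\<^sup>+x. u x \<up> 1 * (?h x \<up> r) \<up> ?b \<partial>M) \<le> (\<integral>\<^sup>+x. u x \<up> r \<partial>M) \<up> (1 / r) * ?X \<up> ?b"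
      if [measurable]: "u \<in> borel_measurable M" for u
    proof -
      have "(\<integral>\<^sup>+x. (u x \<up> r) \<up> (1 / r) * (?h x \<up> r) \<up> ?b \<partial>M) \<le> (\<integral>\<^sup>+x. u x \<up> r \<partial>M) \<up> (1 / r) * ?X \<up> ?b"
        by (rule nn_integral_Hoelder) (use r in auto)
      moreover have "(u x \<up> r) \<up> (1 / r) = u x \<up> 1" for x
        using r by (simp add: enn_powr_powr)
      ultimately show ?thesis by simp
    qed
    have "?X = (\<integral>\<^sup>+x. f x \<up> 1 * (?h x \<up> r) \<up> ?b \<partial>M) + (\<integral>\<^sup>+x. g x \<up> 1 * (?h x \<up> r) \<up> ?b \<partial>M)"
    proof -
      have "?X = (\<integral>\<^sup>+x. f x \<up> 1 * (?h x \<up> r) \<up> ?b + g x \<up> 1 * (?h x \<up> r) \<up> ?b \<partial>M)"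
        by (intro nn_integral_cong) (rule split)
      then show ?thesis by (subst (asm) nn_integral_add) auto
    qed
    also have "\<dots> \<le> ?F \<up> (1 / r) * ?X \<up> ?b + ?G \<up> (1 / r) * ?X \<up> ?b"
      by (intro add_mono part) auto
    finally have "?X \<up> (1 / r + ?b) \<le> (?F \<up> (1 / r) + ?G \<up> (1 / r)) * ?X \<up> ?b"
      by (simp add: distrib_right)
    then have "?X \<up> (1 / r) * ?X \<up> ?b \<le> (?F \<up> (1 / r) + ?G \<up> (1 / r)) * ?X \<up> ?b"
      by (simp only: enn_powr_add)
    moreover have "?X \<up> ?b \<noteq> 0" "?X \<up> ?b < top" using X 3 by auto
    ultimately show ?thesis
      by (subst (asm) (1 2) mult.commute) (simp add: ennreal_mult_le_mult_iff)
  qed auto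
qed

lemma norm_matrix_enn_powr_le:
  fixes M :: "complex^'d^'d"
  assumes "1 \<le> r"
  shows "ennreal (norm M) \<up> r \<le> ennreal (real CARD('d) powr r) * (\<Sum>i\<in>UNIV. ennreal (norm (M *v axis i 1)) \<up> r)"
proof -
  have "ennreal (norm M) \<up> r \<le> (\<Sum>i\<in>UNIV. ennreal (norm (M *v axis i 1))) \<up> r"
    using norm_matrix_le_sum_columns[of M] assms by (intro enn_powr_mono) (auto intro: ennreal_leI)
  also have "\<dots> \<le> ennreal (real CARD('d) powr r) * (\<Sum>i\<in>UNIV. ennreal (norm (M *v axis i 1)) \<up> r)"
    using assms by (intro sum_enn_powr_le) auto
  finally show ?thesis .
qed

text \<open>The r-mean of \<open>norm (A x *v v)\<close> is a norm in \<open>v\<close>, definite by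
  \<open>pos\<close> and finite by \<open>fin\<close>, so an Auerbach basis makes it comparable to
  \<open>norm (P *v v)\<close>. Applied to the columns of \<open>L\<close> this gives the bounds for
  right factors. With d the dimension, the constant consists of d^r from the Auerbach basis and
  d^(r+1) from passing between a matrix and its columns.\<close>

lemma reducing_matrix:
  fixes A :: "'a \<Rightarrow> complex^'d^'d"
  assumes [measurable]: "A \<in> borel_measurable M" and r: "1 \<le> r"
    and fin: "(\<integral>\<^sup>+x. ennreal (norm (A x)) \<up> r \<partial>M) < top"
    and pos: "\<And>v. v \<noteq> 0 \<Longrightarrow> (\<integral>\<^sup>+x. ennreal (norm (A x *v v)) \<up> r \<partial>M) \<noteq> 0"
  obtains P P' :: "complex^'d^'d" where "P ** P' = mat 1" "P' ** P = mat 1"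
    "\<And>L :: complex^'d^'d. ennreal (norm (P ** L)) \<up> r \<le> ennreal (real CARD('d) powr (2 * r + 1)) * (\<integral>\<^sup>+x. ennreal (norm (A x ** L)) \<up> r \<partial>M)"
    "\<And>L :: complex^'d^'d. (\<integral>\<^sup>+x. ennreal (norm (A x ** L)) \<up> r \<partial>M) \<le> ennreal (real CARD('d) powr (2 * r + 1)) * ennreal (norm (P ** L)) \<up> r"
proof -
  define I where "I v = (\<integral>\<^sup>+x. ennreal (norm (A x *v v)) \<up> r \<partial>M)" for v
  define \<rho> where "\<rho> v = enn2real (I v \<up> (1 / r))" for v
  have Ifin: "I v < top" for v
  proof -
    have "I v \<le> (\<integral>\<^sup>+x. ennreal (norm v powr r) * ennreal (norm (A x)) \<up> r \<partial>M)"
      unfolding I_def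
    proof (rule nn_integral_mono)
      fix x
      have "ennreal (norm (A x *v v)) \<up> r \<le> (ennreal (norm v) * ennreal (norm (A x))) \<up> r"
        using r norm_matrix_vector_le[of "A x" v] by (intro enn_powr_mono) (auto simp: mult.commute simp flip: ennreal_mult intro: ennreal_leI)
      then show "ennreal (norm (A x *v v)) \<up> r \<le> ennreal (norm v powr r) * ennreal (norm (A x)) \<up> r"
        using r by (simp add: enn_powr_mult enn_powr_ennreal)
    qed
    also have "\<dots> < top"
      using fin by (simp add: nn_integral_cmult ennreal_mult_less_top)
    finally show ?thesis .
  qed
  have e\<rho>: "ennreal (\<rho> v) = I v \<up> (1 / r)" for v
    unfolding \<rho>_def using Ifin[of v] by (simp add: less_top)
  have \<rho>0: "\<rho> v \<ge> 0" for v by (simp add: \<rho>_def)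
  have \<rho>r: "ennreal (\<rho> v) \<up> r = I v" for v
    using r by (simp add: e\<rho> enn_powr_powr)
  have tri: "\<rho> (u + v) \<le> \<rho> u + \<rho> v" for u v
  proof -
    have "I (u + v) \<up> (1 / r) \<le> (\<integral>\<^sup>+x. (ennreal (norm (A x *v u)) + ennreal (norm (A x *v v))) \<up> r \<partial>M) \<up> (1 / r)"
      unfolding I_def using r
      by (intro enn_powr_mono nn_integral_mono)
         (auto simp: matrix_vector_right_distrib norm_triangle_ineq simp flip: ennreal_plus intro!: ennreal_leI)
    also have "\<dots> \<le> I u \<up> (1 / r) + I v \<up> (1 / r)"
      unfolding I_def using r by (intro nn_integral_Minkowski) auto
    finally have "ennreal (\<rho> (u + v)) \<le> ennreal (\<rho> u + \<rho> v)"
      by (simp add: e\<rho> \<rho>0)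
    then show ?thesis by (simp add: \<rho>0 flip: ennreal_plus)
  qed
  have hom: "\<rho> (c *s v) = norm c * \<rho> v" for c v
  proof -
    have "norm (A x *v (c *s v)) = norm c * norm (A x *v v)" for x
    proof -
      have "A x *v (c *s v) = c *s (A x *v v)" by (simp add: vector_scalar_commute)
      moreover have "norm (c *s w) = norm c * norm w" for w :: "complex^'d"
        by (simp add: norm_vec_def norm_mult L2_set_right_distrib)
      ultimately show ?thesis by simp
    qed
    then have "I (c *s v) = ennreal (norm c) \<up> r * I v"
      unfolding I_def using r by (simp add: ennreal_mult enn_powr_mult nn_integral_cmult)
    then have "ennreal (\<rho> (c *s v)) = ennreal (norm c * \<rho> v)"
      using r \<rho>0 by (simp add: e\<rho> enn_powr_mult enn_powr_powr ennreal_mult)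
    then show ?thesis using \<rho>0 by (simp add: ennreal_inj)
  qed
  have "\<rho> v > 0" if "v \<noteq> 0" for v
  proof -
    have "ennreal (\<rho> v) \<noteq> 0" using pos[OF that] by (simp add: e\<rho> I_def)
    then show ?thesis using \<rho>0[of v] by (metis ennreal_0 less_eq_real_def)
  qed
  from auerbach[OF tri hom this] obtain P P' :: "complex^'d^'d" where P: "P ** P' = mat 1" "P' ** P = mat 1"
    and 1: "\<And>v. norm (P *v v) \<le> real CARD('d) * \<rho> v" and 2: "\<And>v. \<rho> v \<le> real CARD('d) * norm (P *v v)"
    by blast
  let ?d = "ennreal (real CARD('d) powr r)" and ?k = "ennreal (real CARD('d) powr (2 * r + 1))"
  have k: "?k = ?d * ?d * of_nat CARD('d)"
  proof -
    have "real CARD('d) powr (2 * r + 1) = real CARD('d) powr r * real CARD('d) powr r * real CARD('d)"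
      by (simp only: mult_2 powr_add powr_one[OF of_nat_0_le_iff])
    then show ?thesis by (simp add: ennreal_mult ennreal_of_nat_eq_real_of_nat)
  qed
  have 1: "ennreal (norm (P *v v)) \<up> r \<le> ?d * I v" for v
  proof -
    have "ennreal (norm (P *v v)) \<up> r \<le> (ennreal (real CARD('d)) * ennreal (\<rho> v)) \<up> r"
      using r 1[of v] \<rho>0 by (intro enn_powr_mono) (auto simp flip: ennreal_mult intro: ennreal_leI)
    also have "\<dots> = ?d * I v"
      using r by (simp add: enn_powr_mult \<rho>r) (simp add: enn_powr_ennreal)
    finally show ?thesis .
  qed
  have 2: "I v \<le> ?d * ennreal (norm (P *v v)) \<up> r" for v
  proof -
    have "ennreal (\<rho> v) \<up> r \<le> (ennreal (real CARD('d)) * ennreal (norm (P *v v))) \<up> r"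
      using r 2[of v] \<rho>0 by (intro enn_powr_mono) (auto simp flip: ennreal_mult intro: ennreal_leI)
    also have "\<dots> = ?d * ennreal (norm (P *v v)) \<up> r"
      using r by (simp add: enn_powr_mult) (simp add: enn_powr_ennreal)
    finally show ?thesis by (simp add: \<rho>r)
  qed
  have col: "ennreal (norm (L *v axis i 1)) \<up> r \<le> ennreal (norm L) \<up> r" for L :: "complex^'d^'d" and i
    using r norm_column_le[of L i] by (intro enn_powr_mono) (auto intro: ennreal_leI)
  show ?thesis
  proof (rule that[OF P])
    fix L :: "complex^'d^'d"
    let ?J = "\<integral>\<^sup>+x. ennreal (norm (A x ** L)) \<up> r \<partial>M"
    have "I (L *v axis i 1) \<le> ?J" for i
      unfolding I_def matrix_vector_mul_assoc by (intro nn_integral_mono col)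
    then have "(\<Sum>i\<in>UNIV. ?d * I (L *v axis i 1)) \<le> (\<Sum>i\<in>(UNIV::'d set). ?d * ?J)"
      by (intro sum_mono mult_left_mono) auto
    moreover have "ennreal (norm (P ** L)) \<up> r \<le> ?d * (\<Sum>i\<in>UNIV. ennreal (norm (P *v (L *v axis i 1))) \<up> r)"
      using norm_matrix_enn_powr_le[OF r, of "P ** L"] by (simp add: matrix_vector_mul_assoc)
    moreover have "(\<Sum>i\<in>UNIV. ennreal (norm (P *v (L *v axis i 1))) \<up> r) \<le> (\<Sum>i\<in>UNIV. ?d * I (L *v axis i 1))"
      by (intro sum_mono 1)
    ultimately have "ennreal (norm (P ** L)) \<up> r \<le> ?d * (\<Sum>i\<in>(UNIV::'d set). ?d * ?J)"
      by (meson mult_left_mono order.trans zero_le)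
    then show "ennreal (norm (P ** L)) \<up> r \<le> ?k * ?J"
      unfolding k by (simp add: mult_ac)
    have "?J \<le> (\<integral>\<^sup>+x. ?d * (\<Sum>i\<in>UNIV. ennreal (norm (A x *v (L *v axis i 1))) \<up> r) \<partial>M)"
      unfolding matrix_vector_mul_assoc by (intro nn_integral_mono norm_matrix_enn_powr_le r)
    also have "\<dots> = ?d * (\<Sum>i\<in>UNIV. I (L *v axis i 1))"
      unfolding I_def by (simp add: nn_integral_cmult nn_integral_sum)
    also have "\<dots> \<le> ?d * (\<Sum>i\<in>(UNIV::'d set). ?d * ennreal (norm (P ** L)) \<up> r)"
    proof -
      have "I (L *v axis i 1) \<le> ?d * ennreal (norm (P ** L)) \<up> r" for i
      proof -
        have "I (L *v axis i 1) \<le> ?d * ennreal (norm ((P ** L) *v axis i 1)) \<up> r"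
          using 2[of "L *v axis i 1"] by (simp only: matrix_vector_mul_assoc)
        also have "\<dots> \<le> ?d * ennreal (norm (P ** L)) \<up> r"
          by (intro mult_left_mono col) auto
        finally show ?thesis .
      qed
      then show ?thesis by (intro mult_left_mono sum_mono) auto
    qed
    finally show "?J \<le> ?k * ennreal (norm (P ** L)) \<up> r"
      unfolding k by (simp add: mult_ac)
  qed
qed

section \<open>The two-variable kernel on a probability space: integrability and duality\<close>

lemma matrix_pair_nonzero:
  fixes P P' :: "complex^'d^'d"
  assumes "P' ** P = mat 1"
  shows "norm P > 0" "v \<noteq> 0 \<Longrightarrow> P *v v \<noteq> 0"
proof -
  have *: "P *v v \<noteq> 0" if "v \<noteq> 0" for v
    using that assms by (metis matrix_vector_mul_assoc matrix_vector_mul_lid matrix_vector_mult_0_right)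
  then show "v \<noteq> 0 \<Longrightarrow> P *v v \<noteq> 0" .
  have "axis undefined 1 \<noteq> (0 :: complex^'d)"
    using norm_axis_complex[of undefined] by (metis norm_zero zero_neq_one)
  from *[OF this] show "norm P > 0" by auto
qed

lemma not_AE_False:
  assumes "emeasure M (space M) \<noteq> 0"
  shows "\<not> (AE x in M. False)"
proof
  assume "AE x in M. False"
  then have "AE x in M. x \<notin> space M" by (rule AE_mp) auto
  then have "space M \<in> null_sets M" by (subst AE_iff_null_sets) auto
  then show False using assms by (simp add: null_sets_def)
qed

text \<open>Insert \<open>B y ** A y\<close> after \<open>A x\<close> and move
  \<open>norm (A y)\<close> to the other side. On the left is the scalar Muckenhoupt quantity of the
  weight |A|^p, so the matrix condition forces a scalar one.\<close>

lemma kernel_lower_bound: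
  fixes A B :: "'a \<Rightarrow> complex^'d^'d"
  assumes [measurable]: "A \<in> borel_measurable M" "B \<in> borel_measurable M"
    and inv: "\<And>x. A x ** B x = mat 1" "\<And>x. B x ** A x = mat 1"
    and p: "1 < p" and M: "emeasure M (space M) = 1" "sigma_finite_measure M"
  shows "(\<integral>\<^sup>+x. ennreal (norm (A x)) \<up> p \<partial>M) * (\<integral>\<^sup>+y. ennreal (norm (A y) powr - (p / (p - 1))) \<partial>M) \<up> (p - 1)
    \<le> (\<integral>\<^sup>+x. (\<integral>\<^sup>+y. ennreal (norm (A x ** B y)) \<up> (p / (p - 1)) \<partial>M) \<up> (p - 1) \<partial>M)"
proof -
  interpret sigma_finite_measure M by fact
  let ?p' = "p / (p - 1)"
  let ?J = "\<integral>\<^sup>+y. ennreal (norm (A y) powr - ?p') \<partial>M"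
  have A: "norm (A x) > 0" for x by (rule matrix_pair_nonzero[OF inv(2)])
  have 1: "ennreal (norm (A x)) \<up> p * ?J \<up> (p - 1) \<le> (\<integral>\<^sup>+y. ennreal (norm (A x ** B y)) \<up> ?p' \<partial>M) \<up> (p - 1)" for x
  proof -
    have "ennreal (norm (A x)) \<up> ?p' * ennreal (norm (A y) powr - ?p') \<le> ennreal (norm (A x ** B y)) \<up> ?p'" for y
    proof -
      have "A x = (A x ** B y) ** A y" by (simp add: inv flip: matrix_mul_assoc)
      then have "norm (A x) \<le> norm (A x ** B y) * norm (A y)"
        using norm_matrix_mult_le[of "A x ** B y" "A y"] by simp
      then have "norm (A x) powr ?p' \<le> (norm (A x ** B y) * norm (A y)) powr ?p'"
        using p by (intro powr_mono2) auto
      then have "norm (A x) powr ?p' * norm (A y) powr - ?p' \<le> norm (A x ** B y) powr ?p'"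
        using A[of y] by (simp add: powr_mult powr_minus field_simps)
      then show ?thesis
        by (simp add: enn_powr_ennreal ennreal_leI flip: ennreal_mult)
    qed
    then have "(\<integral>\<^sup>+y. ennreal (norm (A x)) \<up> ?p' * ennreal (norm (A y) powr - ?p') \<partial>M) \<le> (\<integral>\<^sup>+y. ennreal (norm (A x ** B y)) \<up> ?p' \<partial>M)"
      by (intro nn_integral_mono)
    then have "(ennreal (norm (A x)) \<up> ?p' * ?J) \<up> (p - 1) \<le> (\<integral>\<^sup>+y. ennreal (norm (A x ** B y)) \<up> ?p' \<partial>M) \<up> (p - 1)"
      using p by (intro enn_powr_mono) (auto simp: nn_integral_cmult)
    then show ?thesis using p by (simp add: enn_powr_mult enn_powr_powr)
  qed
  have "(\<integral>\<^sup>+x. ennreal (norm (A x)) \<up> p \<partial>M) * ?J \<up> (p - 1) = (\<integral>\<^sup>+x. ennreal (norm (A x)) \<up> p * ?J \<up> (p - 1) \<partial>M)"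
    by (simp add: nn_integral_multc)
  also have "\<dots> \<le> (\<integral>\<^sup>+x. (\<integral>\<^sup>+y. ennreal (norm (A x ** B y)) \<up> (p / (p - 1)) \<partial>M) \<up> (p - 1) \<partial>M)"
    by (intro nn_integral_mono 1)
  finally show ?thesis .
qed

text \<open>In the lower bound the second factor is nonzero because \<open>norm (A y)\<close> is a
  positive real, so finiteness of the product passes to the first factor.\<close>

lemma kernel_integrable_fst:
  fixes A B :: "'a \<Rightarrow> complex^'d^'d"
  assumes [measurable]: "A \<in> borel_measurable M" "B \<in> borel_measurable M"
    and inv: "\<And>x. A x ** B x = mat 1" "\<And>x. B x ** A x = mat 1"
    and p: "1 < p" and M: "emeasure M (space M) = 1" "sigma_finite_measure M"
    and fin: "(\<integral>\<^sup>+x. (\<integral>\<^sup>+y. ennreal (norm (A x ** B y)) \<up> (p / (p - 1)) \<partial>M) \<up> (p - 1) \<partial>M) < top"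
  shows "(\<integral>\<^sup>+x. ennreal (norm (A x)) \<up> p \<partial>M) < top"
proof -
  interpret sigma_finite_measure M by fact
  let ?p' = "p / (p - 1)"
  let ?J = "\<integral>\<^sup>+y. ennreal (norm (A y) powr - ?p') \<partial>M"
  have A: "norm (A x) > 0" for x by (rule matrix_pair_nonzero[OF inv(2)])
  have J: "?J \<noteq> 0"
  proof
    assume "?J = 0"
    then have "AE y in M. norm (A y) powr - ?p' \<le> 0"
      by (subst (asm) nn_integral_0_iff_AE) (auto simp: ennreal_eq_0_iff)
    then have "AE y in M. False" using A by (auto simp: powr_def)
    then show False using M not_AE_False[of M] by simp
  qed
  have "(\<integral>\<^sup>+x. ennreal (norm (A x)) \<up> p \<partial>M) * ?J \<up> (p - 1) < top"
    using kernel_lower_bound[OF assms(1-7)] fin by (rule le_less_trans)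
  then show ?thesis using J by (auto simp: ennreal_mult_less_top)
qed

text \<open>Hoelder's inequality for 1 = |A| |A|^(-1) bounds the scalar quantity of
  \<open>kernel_lower_bound\<close> below by 1. Later this shows that the characteristic, up to a
  dimensional factor, is at least 1.\<close>

lemma kernel_ge_1:
  fixes A B :: "'a \<Rightarrow> complex^'d^'d"
  assumes [measurable]: "A \<in> borel_measurable M" "B \<in> borel_measurable M"
    and inv: "\<And>x. A x ** B x = mat 1" "\<And>x. B x ** A x = mat 1"
    and p: "1 < p" and M: "emeasure M (space M) = 1" "sigma_finite_measure M"
  shows "1 \<le> (\<integral>\<^sup>+x. (\<integral>\<^sup>+y. ennreal (norm (A x ** B y)) \<up> (p / (p - 1)) \<partial>M) \<up> (p - 1) \<partial>M)"
proof -
  interpret sigma_finite_measure M by fact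
  let ?p' = "p / (p - 1)"
  let ?J = "\<integral>\<^sup>+y. ennreal (norm (A y) powr - ?p') \<partial>M"
  have A: "norm (A x) > 0" for x by (rule matrix_pair_nonzero[OF inv(2)])
  have "(\<integral>\<^sup>+x. (ennreal (norm (A x)) \<up> p) \<up> (1 / p) * ennreal (norm (A x) powr - ?p') \<up> (1 - 1 / p) \<partial>M)
    \<le> (\<integral>\<^sup>+x. ennreal (norm (A x)) \<up> p \<partial>M) \<up> (1 / p) * ?J \<up> (1 - 1 / p)"
    using p by (intro nn_integral_Hoelder) auto
  moreover have "(ennreal (norm (A x)) \<up> p) \<up> (1 / p) * ennreal (norm (A x) powr - ?p') \<up> (1 - 1 / p) = 1" for x
  proof -
    have "- ?p' * (1 - 1 / p) = - 1" using p by (simp add: field_simps)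
    then have "(norm (A x) powr - ?p') powr (1 - 1 / p) = norm (A x) powr - 1" by (simp only: powr_powr)
    then show ?thesis using p A[of x]
      by (simp add: enn_powr_powr) (simp add: enn_powr_ennreal powr_minus flip: ennreal_mult)
  qed
  ultimately have "1 \<le> (\<integral>\<^sup>+x. ennreal (norm (A x)) \<up> p \<partial>M) \<up> (1 / p) * ?J \<up> (1 - 1 / p)"
    using M(1) by simp
  then have "1 \<up> p \<le> ((\<integral>\<^sup>+x. ennreal (norm (A x)) \<up> p \<partial>M) \<up> (1 / p) * ?J \<up> (1 - 1 / p)) \<up> p"
    using p by (intro enn_powr_mono) auto
  also have "\<dots> = (\<integral>\<^sup>+x. ennreal (norm (A x)) \<up> p \<partial>M) * ?J \<up> (p - 1)"
    using p by (simp add: enn_powr_mult enn_powr_powr left_diff_distrib)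
  also have "\<dots> \<le> (\<integral>\<^sup>+x. (\<integral>\<^sup>+y. ennreal (norm (A x ** B y)) \<up> (p / (p - 1)) \<partial>M) \<up> (p - 1) \<partial>M)"
    by (rule kernel_lower_bound[OF assms])
  finally show ?thesis by simp
qed

text \<open>Finiteness of the outer integral gives one point \<open>x\<close> with finite inner
  integral; multiplying by \<open>B x\<close> then removes \<open>A x\<close> from the
  kernel.\<close>

lemma kernel_integrable_snd:
  fixes A B :: "'a \<Rightarrow> complex^'d^'d"
  assumes [measurable]: "A \<in> borel_measurable M" "B \<in> borel_measurable M"
    and inv: "\<And>x. A x ** B x = mat 1" "\<And>x. B x ** A x = mat 1"
    and p: "1 < p" and M: "emeasure M (space M) = 1" "sigma_finite_measure M"
    and fin: "(\<integral>\<^sup>+x. (\<integral>\<^sup>+y. ennreal (norm (A x ** B y)) \<up> (p / (p - 1)) \<partial>M) \<up> (p - 1) \<partial>M) < top"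
  shows "(\<integral>\<^sup>+x. ennreal (norm (B x)) \<up> (p / (p - 1)) \<partial>M) < top"
proof -
  interpret sigma_finite_measure M by fact
  let ?p' = "p / (p - 1)"
  have "AE x in M. (\<integral>\<^sup>+y. ennreal (norm (A x ** B y)) \<up> ?p' \<partial>M) \<up> (p - 1) \<noteq> top"
    unfolding infinity_ennreal_def[symmetric] using fin
    by (intro nn_integral_PInf_AE) (auto simp flip: less_top)
  then obtain x where x: "(\<integral>\<^sup>+y. ennreal (norm (A x ** B y)) \<up> ?p' \<partial>M) \<noteq> top"
  proof (cases "\<exists>x. (\<integral>\<^sup>+y. ennreal (norm (A x ** B y)) \<up> ?p' \<partial>M) \<noteq> top")
    case False
    then show ?thesis using M(1) not_AE_False[of M] \<open>AE x in M. _ x \<noteq> top\<close> by simp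
  qed blast
  have "(\<integral>\<^sup>+y. ennreal (norm (B y)) \<up> ?p' \<partial>M) \<le> (\<integral>\<^sup>+y. ennreal (norm (B x)) \<up> ?p' * ennreal (norm (A x ** B y)) \<up> ?p' \<partial>M)"
  proof (rule nn_integral_mono)
    fix y
    have "B y = B x ** (A x ** B y)" by (simp add: inv matrix_mul_assoc)
    then have "norm (B y) \<le> norm (B x) * norm (A x ** B y)"
      using norm_matrix_mult_le[of "B x" "A x ** B y"] by simp
    then have "ennreal (norm (B y)) \<up> ?p' \<le> (ennreal (norm (B x)) * ennreal (norm (A x ** B y))) \<up> ?p'"
      using p by (intro enn_powr_mono) (auto simp flip: ennreal_mult intro: ennreal_leI)
    then show "ennreal (norm (B y)) \<up> ?p' \<le> ennreal (norm (B x)) \<up> ?p' * ennreal (norm (A x ** B y)) \<up> ?p'"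
      using p by (simp add: enn_powr_mult)
  qed
  also have "\<dots> < top"
    using x by (simp add: nn_integral_cmult ennreal_mult_less_top less_top)
  finally show ?thesis .
qed

text \<open>Let \<open>P\<close> reduce \<open>A\<close> in L^p and \<open>R\<close> reduce the
  transpose of \<open>B\<close> in L^p'. The given iterated integral bounds |P R^T| from above, and
  |P R^T| bounds the integral in the exchanged order, which is why the latter comes with the power
  1/(p-1). Transposes occur because \<open>reducing_matrix\<close> governs right factors, while
  \<open>B y\<close> is itself the right factor of the kernel. The first two estimates serve to
  factorise the kernel as |A P'| |P B|.\<close>

lemma kernel_swap:
  fixes A B :: "'a \<Rightarrow> complex^'d^'d"
  assumes [measurable]: "A \<in> borel_measurable M" "B \<in> borel_measurable M"
    and inv: "\<And>x. A x ** B x = mat 1" "\<And>x. B x ** A x = mat 1"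
    and p: "1 < p" and M: "emeasure M (space M) = 1" "sigma_finite_measure M"
    and fin: "(\<integral>\<^sup>+x. (\<integral>\<^sup>+y. ennreal (norm (A x ** B y)) \<up> (p / (p - 1)) \<partial>M) \<up> (p - 1) \<partial>M) < top"
  obtains P P' :: "complex^'d^'d" where "P ** P' = mat 1" "P' ** P = mat 1"
    "(\<integral>\<^sup>+x. ennreal (norm (A x ** P')) \<up> p \<partial>M) \<le> ennreal (real CARD('d) powr (2 * p + 1)) * ennreal (norm (mat 1 :: complex^'d^'d)) \<up> p"
    "(\<integral>\<^sup>+y. ennreal (norm (P ** B y)) \<up> (p / (p - 1)) \<partial>M) \<le>
       ennreal (real CARD('d) powr (4 * (p / (p - 1)) + 2 + (2 * p + 1) / (p - 1)))
       * (\<integral>\<^sup>+x. (\<integral>\<^sup>+y. ennreal (norm (A x ** B y)) \<up> (p / (p - 1)) \<partial>M) \<up> (p - 1) \<partial>M) \<up> (1 / (p - 1))"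
    "(\<integral>\<^sup>+y. (\<integral>\<^sup>+x. ennreal (norm (A x ** B y)) \<up> p \<partial>M) \<up> (1 / (p - 1)) \<partial>M) \<le>
       ennreal (real CARD('d) powr (4 * (p / (p - 1)) + 2 + 2 * ((2 * p + 1) / (p - 1))))
       * (\<integral>\<^sup>+x. (\<integral>\<^sup>+y. ennreal (norm (A x ** B y)) \<up> (p / (p - 1)) \<partial>M) \<up> (p - 1) \<partial>M) \<up> (1 / (p - 1))"
proof -
  interpret sigma_finite_measure M by fact
  let ?p' = "p / (p - 1)"
  let ?X = "\<integral>\<^sup>+x. (\<integral>\<^sup>+y. ennreal (norm (A x ** B y)) \<up> ?p' \<partial>M) \<up> (p - 1) \<partial>M"
  define c where "c = real CARD('d) powr (2 * p + 1)"
  define c' where "c' = real CARD('d) powr (2 * ?p' + 1)"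
  have c0: "0 \<le> c" "0 \<le> c'" by (auto simp: c_def c'_def)
  have p': "1 < ?p'" using p by (simp add: field_simps)
  have not0: "(\<integral>\<^sup>+x. ennreal (norm (F x *v v)) \<up> r \<partial>M) \<noteq> 0"
    if [measurable]: "F \<in> borel_measurable M" and F: "\<And>x. F x *v v \<noteq> 0" for r v and F :: "'a \<Rightarrow> complex^'d^'d"
  proof
    assume "(\<integral>\<^sup>+x. ennreal (norm (F x *v v)) \<up> r \<partial>M) = 0"
    then have "AE x in M. ennreal (norm (F x *v v)) \<up> r = 0"
      by (subst (asm) nn_integral_0_iff_AE) auto
    then have "AE y in M. False" using F by (auto simp: ennreal_eq_0_iff)
    then show False using M not_AE_False[of M] by simp
  qed
  have invT: "transpose (A x) ** transpose (B x) = mat 1" for x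
    using inv(2)[of x] by (metis matrix_transpose_mul transpose_mat)
  have tr: "norm (X ** transpose Y) = norm (Y ** transpose X)" for X Y :: "complex^'d^'d"
    using norm_transpose[of "X ** transpose Y"] by (simp add: matrix_transpose_mul transpose_transpose)
  obtain P P' :: "complex^'d^'d" where P: "P ** P' = mat 1" "P' ** P = mat 1"
    and P1: "\<And>L :: complex^'d^'d. ennreal (norm (P ** L)) \<up> p \<le> ennreal c * (\<integral>\<^sup>+x. ennreal (norm (A x ** L)) \<up> p \<partial>M)"
    and P2: "\<And>L :: complex^'d^'d. (\<integral>\<^sup>+x. ennreal (norm (A x ** L)) \<up> p \<partial>M) \<le> ennreal c * ennreal (norm (P ** L)) \<up> p"
    by (rule reducing_matrix[OF assms(1) less_imp_le[OF p] kernel_integrable_fst[OF assms]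
         not0[OF assms(1) matrix_pair_nonzero(2)[OF inv(2)]], folded c_def]) ((assumption | rule that)+)
  have Bt: "(\<lambda>x. transpose (B x)) \<in> borel_measurable M" by measurable
  have Bt_fin: "(\<integral>\<^sup>+x. ennreal (norm (transpose (B x))) \<up> ?p' \<partial>M) < top"
    using kernel_integrable_snd[OF assms] by simp
  obtain R R' :: "complex^'d^'d" where R: "R ** R' = mat 1" "R' ** R = mat 1"
    and R1: "\<And>L :: complex^'d^'d. ennreal (norm (R ** L)) \<up> ?p' \<le> ennreal c' * (\<integral>\<^sup>+x. ennreal (norm (transpose (B x) ** L)) \<up> ?p' \<partial>M)"
    and R2: "\<And>L :: complex^'d^'d. (\<integral>\<^sup>+x. ennreal (norm (transpose (B x) ** L)) \<up> ?p' \<partial>M) \<le> ennreal c' * ennreal (norm (R ** L)) \<up> ?p'"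
    by (rule reducing_matrix[OF Bt less_imp_le[OF p'] Bt_fin not0[OF Bt matrix_pair_nonzero(2)[OF invT]], folded c'_def]) ((assumption | rule that)+)
  \<comment> \<open>Both reductions in one chain: \<open>P\<close> is traded for the outer integral,
    then \<open>R\<close> for the inner one. \<open>R1\<close> enters with the power
    \<open>p - 1\<close>, as p'(p-1) = p.\<close>
  have "ennreal (norm (P ** transpose R)) \<up> p \<le> ennreal c * (\<integral>\<^sup>+x. ennreal (norm (A x ** transpose R)) \<up> p \<partial>M)"
    by (rule P1)
  also have "(\<integral>\<^sup>+x. ennreal (norm (A x ** transpose R)) \<up> p \<partial>M)
    = (\<integral>\<^sup>+x. (ennreal (norm (R ** transpose (A x))) \<up> ?p') \<up> (p - 1) \<partial>M)"
    using p by (simp add: enn_powr_powr tr)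
  also have "\<dots> \<le> (\<integral>\<^sup>+x. ennreal c' \<up> (p - 1) * (\<integral>\<^sup>+y. ennreal (norm (A x ** B y)) \<up> ?p' \<partial>M) \<up> (p - 1) \<partial>M)"
  proof (rule nn_integral_mono)
    fix x
    have "norm (transpose (B y) ** transpose (A x)) = norm (A x ** B y)" for y
      using norm_transpose[of "A x ** B y"] by (simp add: matrix_transpose_mul)
    then have "(ennreal (norm (R ** transpose (A x))) \<up> ?p') \<up> (p - 1) \<le> (ennreal c' * (\<integral>\<^sup>+y. ennreal (norm (A x ** B y)) \<up> ?p' \<partial>M)) \<up> (p - 1)"
      using R1[of "transpose (A x)"] p by (intro enn_powr_mono) auto
    then show "(ennreal (norm (R ** transpose (A x))) \<up> ?p') \<up> (p - 1) \<le> ennreal c' \<up> (p - 1) * (\<integral>\<^sup>+y. ennreal (norm (A x ** B y)) \<up> ?p' \<partial>M) \<up> (p - 1)"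
      using p by (simp add: enn_powr_mult)
  qed
  also have "\<dots> = ennreal c' \<up> (p - 1) * ?X"
    by (simp add: nn_integral_cmult)
  finally have "ennreal (norm (P ** transpose R)) \<up> p \<le> ennreal c * (ennreal c' \<up> (p - 1) * ?X)"
    by (simp add: mult_left_mono)
  then have "(ennreal (norm (P ** transpose R)) \<up> p) \<up> (1 / (p - 1)) \<le> (ennreal c * (ennreal c' \<up> (p - 1) * ?X)) \<up> (1 / (p - 1))"
    using p by (intro enn_powr_mono) auto
  then have PR: "ennreal (norm (P ** transpose R)) \<up> ?p' \<le> ennreal (c powr (1 / (p - 1)) * c') * ?X \<up> (1 / (p - 1))"
    using p c0 by (simp add: enn_powr_mult enn_powr_powr mult.assoc ennreal_mult) (simp add: enn_powr_ennreal)
  have "(\<integral>\<^sup>+y. ennreal (norm (P ** B y)) \<up> ?p' \<partial>M) = (\<integral>\<^sup>+y. ennreal (norm (transpose (B y) ** transpose P)) \<up> ?p' \<partial>M)"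
    by (metis matrix_transpose_mul norm_transpose)
  also have "\<dots> \<le> ennreal c' * ennreal (norm (R ** transpose P)) \<up> ?p'" by (rule R2)
  also have "\<dots> \<le> ennreal c' * (ennreal (c powr (1 / (p - 1)) * c') * ?X \<up> (1 / (p - 1)))"
    using PR by (intro mult_left_mono) (auto simp: tr[of P])
  finally have PB: "(\<integral>\<^sup>+y. ennreal (norm (P ** B y)) \<up> ?p' \<partial>M) \<le> ennreal (c' * c' * c powr (1 / (p - 1))) * ?X \<up> (1 / (p - 1))"
    using c0 by (simp add: ennreal_mult mult_ac)
  have "(\<integral>\<^sup>+y. (\<integral>\<^sup>+x. ennreal (norm (A x ** B y)) \<up> p \<partial>M) \<up> (1 / (p - 1)) \<partial>M)
    \<le> (\<integral>\<^sup>+y. ennreal (c powr (1 / (p - 1))) * ennreal (norm (P ** B y)) \<up> ?p' \<partial>M)"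
  proof (rule nn_integral_mono)
    fix y
    have "(\<integral>\<^sup>+x. ennreal (norm (A x ** B y)) \<up> p \<partial>M) \<up> (1 / (p - 1)) \<le> (ennreal c * ennreal (norm (P ** B y)) \<up> p) \<up> (1 / (p - 1))"
      using p by (intro enn_powr_mono P2) auto
    then show "(\<integral>\<^sup>+x. ennreal (norm (A x ** B y)) \<up> p \<partial>M) \<up> (1 / (p - 1)) \<le> ennreal (c powr (1 / (p - 1))) * ennreal (norm (P ** B y)) \<up> ?p'"
      using p c0 by (simp add: enn_powr_mult enn_powr_powr) (simp add: enn_powr_ennreal)
  qed
  also have "\<dots> = ennreal (c powr (1 / (p - 1))) * (\<integral>\<^sup>+y. ennreal (norm (P ** B y)) \<up> ?p' \<partial>M)"
    by (simp add: nn_integral_cmult)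
  also have "\<dots> \<le> ennreal (c powr (1 / (p - 1))) * (ennreal (c' * c' * c powr (1 / (p - 1))) * ?X \<up> (1 / (p - 1)))"
    by (intro mult_left_mono PB) auto
  finally have sw: "(\<integral>\<^sup>+y. (\<integral>\<^sup>+x. ennreal (norm (A x ** B y)) \<up> p \<partial>M) \<up> (1 / (p - 1)) \<partial>M)
    \<le> ennreal (c powr (1 / (p - 1)) * (c' * c' * c powr (1 / (p - 1)))) * ?X \<up> (1 / (p - 1))"
    using c0 by (simp add: ennreal_mult mult_ac)
  have e1: "c' * c' * c powr (1 / (p - 1)) = real CARD('d) powr (4 * ?p' + 2 + (2 * p + 1) / (p - 1))"
    by (simp add: c_def c'_def powr_powr flip: powr_add)
  have e2: "c powr (1 / (p - 1)) * (c' * c' * c powr (1 / (p - 1))) = real CARD('d) powr (4 * ?p' + 2 + 2 * ((2 * p + 1) / (p - 1)))"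
  proof -
    have "c powr (1 / (p - 1)) = real CARD('d) powr ((2 * p + 1) / (p - 1))"
      by (simp add: c_def powr_powr)
    moreover have "x + (y + x) = y + 2 * x" for x y :: real by simp
    ultimately show ?thesis unfolding e1 by (simp only: flip: powr_add)
  qed
  have e3: "(\<integral>\<^sup>+x. ennreal (norm (A x ** P')) \<up> p \<partial>M) \<le> ennreal (real CARD('d) powr (2 * p + 1)) * ennreal (norm (mat 1 :: complex^'d^'d)) \<up> p"
    using P2[of P'] by (simp add: P c_def)
  show ?thesis
    by (rule that[OF P e3 PB[unfolded e1] sw[unfolded e2]])
qed

subsection \<open>Dyadic partitions\<close>

text \<open>\<open>D j x\<close> is the cell of generation \<open>j\<close> that contains \<open>x\<close>.\<close>

locale dyadic_partition = sigma_finite_measure M for M :: "'a measure" +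
  fixes D :: "int \<Rightarrow> 'a \<Rightarrow> 'a set" and vol :: "int \<Rightarrow> real"
  assumes space_M [simp]: "space M = UNIV"
    and mem_D [simp]: "x \<in> D j x"
    and D_eq: "y \<in> D j x \<Longrightarrow> D j y = D j x"
    and D_nested: "i \<le> j \<Longrightarrow> D j x \<subseteq> D i x"
    and sets_D_pair: "{z. snd z \<in> D j (fst z)} \<in> sets (M \<Otimes>\<^sub>M M)"
    and vol_pos [simp]: "0 < vol j"
    and emeasure_D: "emeasure M (D j x) = ennreal (vol j)"
begin

text \<open>The integral against the normalised restriction of \<open>M\<close>, so that
  inequalities on probability spaces apply to averages directly.\<close>

definition av :: "int \<Rightarrow> ('a \<Rightarrow> ennreal) \<Rightarrow> 'a \<Rightarrow> ennreal" where
  "av j f x = (\<integral>\<^sup>+y. f y \<partial>uniform_measure M (D j x))"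

definition dmax :: "('a \<Rightarrow> ennreal) \<Rightarrow> 'a \<Rightarrow> ennreal" where
  "dmax f x = (SUP j. av j f x)"

text \<open>The unions of cells of generation \<open>j\<close>, described without enumerating
  cells.\<close>

definition saturated :: "int \<Rightarrow> 'a set \<Rightarrow> bool" where
  "saturated j E \<longleftrightarrow> (\<forall>x\<in>E. D j x \<subseteq> E)"

lemma D_sym: "y \<in> D j x \<longleftrightarrow> x \<in> D j y"
  using D_eq mem_D by blast

lemma vol_nonneg [simp]: "0 \<le> vol j" using vol_pos[of j] by linarith

lemma vol_ne_0 [simp]: "vol j \<noteq> 0" using vol_pos[of j] by linarith

lemma measurable_D_pred [measurable]: "Measurable.pred (M \<Otimes>\<^sub>M M) (\<lambda>z. snd z \<in> D j (fst z))"
  using sets_D_pair[of j] by (simp add: pred_def space_pair_measure)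

lemma measurable_indicator_D:
  "(\<lambda>z. indicator (D j (fst z)) (snd z) :: ennreal) \<in> borel_measurable (M \<Otimes>\<^sub>M M)"
  unfolding indicator_def by measurable

lemma sets_D [measurable]: "D j x \<in> sets M"
proof -
  have "Pair x -` {z. snd z \<in> D j (fst z)} \<in> sets M"
    by (rule sets_Pair1[OF sets_D_pair])
  then show ?thesis by (simp add: vimage_def)
qed

lemma av_eq: "f \<in> borel_measurable M \<Longrightarrow> av j f x = (\<integral>\<^sup>+y. f y * indicator (D j x) y \<partial>M) / ennreal (vol j)"
  by (simp add: av_def nn_integral_uniform_measure emeasure_D)

lemma nn_integral_D_eq: "f \<in> borel_measurable M \<Longrightarrow> (\<integral>\<^sup>+y. f y * indicator (D j x) y \<partial>M) = ennreal (vol j) * av j f x"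
  using vol_pos[of j] by (simp add: av_eq ennreal_times_divide ennreal_mult_divide_eq ennreal_zero_less_top mult.commute[of "ennreal (vol j)"])

lemma emeasure_unif: "emeasure (uniform_measure M (D j x)) (space (uniform_measure M (D j x))) = 1"
  using vol_pos[of j] sets.top[of M] by (subst emeasure_uniform_measure) (auto simp: emeasure_D ennreal_divide_self)

lemma sigma_finite_unif: "sigma_finite_measure (uniform_measure M (D j x))"
proof -
  interpret finite_measure "uniform_measure M (D j x)"
    by (rule finite_measureI) (simp only: emeasure_unif, simp)
  show ?thesis by unfold_locales
qed

lemma borel_measurable_nn_integral_kernel:
  assumes "(\<lambda>z. k (fst z) (snd z)) \<in> borel_measurable (M \<Otimes>\<^sub>M M)"
  shows "(\<lambda>x. \<integral>\<^sup>+y. k x y \<partial>M) \<in> borel_measurable M"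
  using borel_measurable_nn_integral_fst[OF assms] by simp

text \<open>The point \<open>x\<close> enters through both the kernel and the cell, so measurability
  comes from integrating a jointly measurable function on the product; this is the use of the joint
  measurability of the relation \<open>y \<in> D j x\<close>.\<close>

lemma borel_measurable_av_kernel:
  assumes [measurable]: "(\<lambda>z. k (fst z) (snd z)) \<in> borel_measurable (M \<Otimes>\<^sub>M M)"
  shows "(\<lambda>x. av j (k x) x) \<in> borel_measurable M"
proof -
  have k: "k x \<in> borel_measurable M" for x
    using measurable_compose[OF measurable_Pair1' assms, of x] by simp
  have [measurable]: "(\<lambda>z. k (fst z) (snd z) * indicator (D j (fst z)) (snd z)) \<in> borel_measurable (M \<Otimes>\<^sub>M M)"
    by (intro borel_measurable_times_ennreal assms measurable_indicator_D)
  have "(\<lambda>x. (\<integral>\<^sup>+y. k x y * indicator (D j x) y \<partial>M) / ennreal (vol j)) \<in> borel_measurable M"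
    by (intro borel_measurable_divide_ennreal borel_measurable_const borel_measurable_nn_integral_kernel) measurable
  then show ?thesis by (simp add: av_eq k)
qed

lemma borel_measurable_av [measurable (raw)]:
  assumes [measurable]: "f \<in> borel_measurable M"
  shows "av j f \<in> borel_measurable M"
  using borel_measurable_av_kernel[of "\<lambda>_. f" j] by simp

lemma borel_measurable_dmax [measurable (raw)]:
  assumes [measurable]: "f \<in> borel_measurable M"
  shows "dmax f \<in> borel_measurable M"
  unfolding dmax_def by measurable

lemma av_cong: "y \<in> D j x \<Longrightarrow> av j f y = av j f x"
  by (simp add: av_def D_eq)

lemma av_mono: "(\<And>y. y \<in> D j x \<Longrightarrow> f y \<le> g y) \<Longrightarrow> av j f x \<le> av j g x"
  unfolding av_def by (intro nn_integral_mono_AE AE_uniform_measureI) auto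

lemma av_const [simp]: "av j (\<lambda>_. c) x = c"
  using emeasure_unif[of j x] by (simp add: av_def)

lemma av_cmult: "f \<in> borel_measurable M \<Longrightarrow> av j (\<lambda>y. c * f y) x = c * av j f x"
  unfolding av_def by (simp add: nn_integral_cmult)

lemma av_add: "f \<in> borel_measurable M \<Longrightarrow> g \<in> borel_measurable M \<Longrightarrow> av j (\<lambda>y. f y + g y) x = av j f x + av j g x"
  unfolding av_def by (simp add: nn_integral_add)

lemma av_cong_AE: "f \<in> borel_measurable M \<Longrightarrow> g \<in> borel_measurable M \<Longrightarrow> AE y in M. f y = g y \<Longrightarrow> av j f x = av j g x"
  unfolding av_def by (intro nn_integral_cong_AE AE_uniform_measureI) auto

lemma saturated_indicator:
  "saturated j E \<Longrightarrow> y \<in> D j x \<Longrightarrow> indicator E x = (indicator E y :: ennreal)"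
  using D_sym[of y j x] unfolding saturated_def by (auto simp: indicator_def)

text \<open>Averaging is a conditional expectation. The symmetry \<open>D_sym\<close> lets Fubini's
  theorem exchange the roles of \<open>x\<close> and \<open>y\<close>, which replaces a sum over
  cells.\<close>

lemma nn_integral_av:
  assumes [measurable]: "f \<in> borel_measurable M" "E \<in> sets M" and E: "saturated j E"
  shows "(\<integral>\<^sup>+x. av j f x * indicator E x \<partial>M) = (\<integral>\<^sup>+x. f x * indicator E x \<partial>M)"
proof -
  interpret pair_sigma_finite M M by unfold_locales
  note [measurable] = measurable_indicator_D
  let ?k = "\<lambda>(x :: 'a) (y :: 'a). f y * indicator E y * indicator (D j x) y :: ennreal"
  have k [measurable]: "(\<lambda>z. ?k (fst z) (snd z)) \<in> borel_measurable (M \<Otimes>\<^sub>M M)"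
    by measurable
  have "av j f x * indicator E x = (\<integral>\<^sup>+y. ?k x y \<partial>M) / ennreal (vol j)" for x
  proof -
    have "(\<integral>\<^sup>+y. ?k x y \<partial>M) = (\<integral>\<^sup>+y. indicator E x * (f y * indicator (D j x) y) \<partial>M)"
      by (intro nn_integral_cong) (auto simp: indicator_def[of "D j x"] saturated_indicator[OF E] mult.commute)
    then show ?thesis by (simp add: av_eq nn_integral_cmult ennreal_times_divide mult.commute)
  qed
  then have "(\<integral>\<^sup>+x. av j f x * indicator E x \<partial>M) = (\<integral>\<^sup>+x. (\<integral>\<^sup>+y. ?k x y \<partial>M) \<partial>M) / ennreal (vol j)"
    using borel_measurable_nn_integral_kernel[OF k] by (simp add: nn_integral_divide)
  also have "(\<integral>\<^sup>+x. (\<integral>\<^sup>+y. ?k x y \<partial>M) \<partial>M) = (\<integral>\<^sup>+y. (\<integral>\<^sup>+x. ?k x y \<partial>M) \<partial>M)"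
    by (rule Fubini'[symmetric]) (use k in \<open>simp add: case_prod_beta'\<close>)
  also have "\<dots> = (\<integral>\<^sup>+y. ennreal (vol j) * (f y * indicator E y) \<partial>M)"
  proof (rule nn_integral_cong)
    fix y
    have "(\<integral>\<^sup>+x. ?k x y \<partial>M) = (\<integral>\<^sup>+x. (f y * indicator E y) * indicator (D j y) x \<partial>M)"
      by (intro nn_integral_cong) (auto simp: indicator_def D_sym)
    also have "\<dots> = (f y * indicator E y) * emeasure M (D j y)"
      by (rule nn_integral_cmult_indicator) measurable
    finally show "(\<integral>\<^sup>+x. ?k x y \<partial>M) = ennreal (vol j) * (f y * indicator E y)"
      by (simp add: emeasure_D mult.commute)
  qed
  also have "\<dots> = ennreal (vol j) * (\<integral>\<^sup>+x. f x * indicator E x \<partial>M)"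
    by (simp add: nn_integral_cmult)
  also have "\<dots> / ennreal (vol j) = (\<integral>\<^sup>+x. f x * indicator E x \<partial>M)"
    by (simp add: ennreal_times_divide[symmetric] ennreal_mult_divide_eq mult.commute[of "ennreal (vol j)"])
  finally show ?thesis .
qed

text \<open>Localisation: the integral over a saturated set is the integral of the cell averages, so
  it suffices to compare on each cell.\<close>

lemma nn_integral_saturated_mono:
  assumes [measurable]: "f \<in> borel_measurable M" "g \<in> borel_measurable M" "E \<in> sets M" and E: "saturated j E"
    and le: "\<And>x. x \<in> E \<Longrightarrow> (\<integral>\<^sup>+y. f y * indicator (D j x) y \<partial>M) \<le> (\<integral>\<^sup>+y. g y * indicator (D j x) y \<partial>M)"
  shows "(\<integral>\<^sup>+x. f x * indicator E x \<partial>M) \<le> (\<integral>\<^sup>+x. g x * indicator E x \<partial>M)"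
proof -
  have "(\<integral>\<^sup>+x. av j f x * indicator E x \<partial>M) \<le> (\<integral>\<^sup>+x. av j g x * indicator E x \<partial>M)"
    using le by (intro nn_integral_mono) (auto simp: av_eq indicator_def intro: divide_right_mono_ennreal)
  then show ?thesis by (simp add: nn_integral_av[OF _ _ E])
qed

lemma saturated_UNIV: "saturated j UNIV" by (simp add: saturated_def)

end

section \<open>Filtrations of cells and stopping generations\<close>

locale dyadic_filtration = dyadic_partition +
  fixes \<kappa> :: real
  assumes doubling: "vol j \<le> \<kappa> * vol (j + 1)"
    and differentiation: "f \<in> borel_measurable M \<Longrightarrow> AE x in M. f x \<le> (SUP i\<in>{j..}. av i f x)"
begin

text \<open>A cell has at least the fraction \<open>1 / \<kappa>\<close> of the volume of its
  parent. This bounds the average on a stopping cell, whose parent did not stop.\<close>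

lemma av_step: "f \<in> borel_measurable M \<Longrightarrow> av (j + 1) f x \<le> ennreal \<kappa> * av j f x"
proof -
  assume [measurable]: "f \<in> borel_measurable M"
  have "ennreal (vol (j + 1)) * av (j + 1) f x \<le> ennreal (vol j) * av j f x"
    unfolding nn_integral_D_eq[OF \<open>f \<in> _\<close>, symmetric]
    using D_nested[of j "j + 1" x] by (intro nn_integral_mono mult_left_mono) (auto simp: indicator_def)
  also have "\<dots> \<le> ennreal (\<kappa> * vol (j + 1)) * av j f x"
    using doubling[of j] by (intro mult_right_mono ennreal_leI) auto
  also have "\<dots> = ennreal (vol (j + 1)) * (ennreal \<kappa> * av j f x)"
    by (simp add: ennreal_mult'' mult_ac)
  finally show ?thesis
    by (subst (asm) ennreal_mult_le_mult_iff) auto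
qed

text \<open>The union of those maximal cells with average of \<open>g\<close> above \<open>a\<close>
  that belong to generation \<open>i\<close>. Seen pointwise, \<open>i\<close> is the first
  generation from \<open>j\<close> on that crosses the level, so no maximal cells have to be
  selected.\<close>

definition stop :: "('a \<Rightarrow> ennreal) \<Rightarrow> ennreal \<Rightarrow> int \<Rightarrow> 'a \<Rightarrow> int \<Rightarrow> 'a set" where
  "stop g a j x i = {y \<in> D j x. a < av i g y \<and> (\<forall>l\<in>{j..<i}. av l g y \<le> a)}"

lemma sets_stop [measurable]:
  assumes [measurable]: "g \<in> borel_measurable M"
  shows "stop g a j x i \<in> sets M"
proof -
  have "{y \<in> space M. y \<in> D j x \<and> a < av i g y \<and> (\<forall>l\<in>{j..<i}. av l g y \<le> a)} \<in> sets M"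
    by measurable
  then show ?thesis by (simp add: stop_def)
qed

lemma saturated_stop: "j \<le> i \<Longrightarrow> saturated i (stop g a j x i)"
  unfolding saturated_def stop_def
proof (safe, goal_cases)
  case (1 z y) then show ?case using D_nested D_eq by blast
next
  case (2 z y) then show ?case by (simp add: av_cong)
next
  case (3 z y l)
  then have "y \<in> D l z" using D_nested[of l i z] by auto
  then show ?case using 3 by (simp add: av_cong)
qed

lemma stop_partition:
  fixes n :: nat
  shows "indicator (D j x) y = indicator (D j x - (\<Union>i\<in>{j..j+n}. stop g a j x i)) y
    + (\<Sum>i\<in>{j..j+n}. indicator (stop g a j x i) y :: ennreal)"
proof (cases "\<exists>i\<in>{j..j+n}. y \<in> stop g a j x i")
  case True
  then obtain i where i: "i \<in> {j..j+n}" "y \<in> stop g a j x i" by blast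
  have uniq: "l = i" if "l \<in> {j..j+n}" "y \<in> stop g a j x l" for l
    using i that unfolding stop_def by (cases l i rule: linorder_cases) (force simp: not_less)+
  have "indicator (stop g a j x l) y = (if l = i then 1 else 0 :: ennreal)" if "l \<in> {j..j+n}" for l
    using i uniq[OF that] by (cases "y \<in> stop g a j x l") auto
  then have "(\<Sum>l\<in>{j..j+n}. indicator (stop g a j x l) y :: ennreal) = (\<Sum>l\<in>{j..j+n}. if l = i then 1 else 0)"
    by (rule sum.cong[OF refl])
  then show ?thesis using i by (auto simp: indicator_def stop_def)
next
  case False
  then show ?thesis by (auto simp: indicator_def)
qed

lemma nn_integral_stop_split:
  fixes n :: nat
  assumes [measurable]: "f \<in> borel_measurable M" "g \<in> borel_measurable M"
  shows "(\<integral>\<^sup>+y. f y * indicator (D j x) y \<partial>M)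
    = (\<integral>\<^sup>+y. f y * indicator (D j x - (\<Union>i\<in>{j..j+n}. stop g a j x i)) y \<partial>M)
      + (\<Sum>i\<in>{j..j+n}. \<integral>\<^sup>+y. f y * indicator (stop g a j x i) y \<partial>M)"
proof -
  let ?R = "D j x - (\<Union>i\<in>{j..j+n}. stop g a j x i)"
  have "(\<integral>\<^sup>+y. f y * indicator (D j x) y \<partial>M)
    = (\<integral>\<^sup>+y. f y * indicator ?R y + (\<Sum>i\<in>{j..j+n}. f y * indicator (stop g a j x i) y) \<partial>M)"
    unfolding stop_partition[where x = x and n = n and g = g and a = a] distrib_left sum_distrib_left ..
  also have "\<dots> = (\<integral>\<^sup>+y. f y * indicator ?R y \<partial>M) + (\<integral>\<^sup>+y. (\<Sum>i\<in>{j..j+n}. f y * indicator (stop g a j x i) y) \<partial>M)"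
    by (rule nn_integral_add) measurable
  also have "(\<integral>\<^sup>+y. (\<Sum>i\<in>{j..j+n}. f y * indicator (stop g a j x i) y) \<partial>M)
    = (\<Sum>i\<in>{j..j+n}. \<integral>\<^sup>+y. f y * indicator (stop g a j x i) y \<partial>M)"
    by (rule nn_integral_sum) measurable
  finally show ?thesis .
qed

lemma stop_rest:
  fixes n :: nat
  assumes "y \<in> D j x - (\<Union>i\<in>{j..j+n}. stop g a j x i)" "i \<in> {j..j+n}"
  shows "av i g y \<le> a"
proof (rule ccontr)
  assume "\<not> av i g y \<le> a"
  define P where "P m \<longleftrightarrow> a < av (j + int m) g y" for m
  have "P (nat (i - j))" using \<open>\<not> av i g y \<le> a\<close> assms(2) by (simp add: P_def not_le)
  then have 1: "P (LEAST m. P m)" and 2: "(LEAST m. P m) \<le> nat (i - j)" by (auto intro: LeastI Least_le)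
  let ?l = "j + int (LEAST m. P m)"
  have "av l g y \<le> a" if "l \<in> {j..<?l}" for l
  proof -
    have "\<not> P (nat (l - j))" using that by (intro not_less_Least) auto
    then show ?thesis using that by (simp add: P_def not_less)
  qed
  then have "y \<in> stop g a j x ?l" using 1 assms by (simp add: stop_def P_def)
  moreover have "?l \<in> {j..j+n}" using 2 assms(2) by auto
  ultimately show False using assms(1) by blast
qed

text \<open>Chebyshev's inequality on each stopping set, where averaging in generation
  \<open>i\<close> preserves the integral of \<open>g\<close>; the sets are disjoint parts of
  \<open>D j x\<close>.\<close>

lemma stop_mass:
  fixes n :: nat
  assumes [measurable]: "g \<in> borel_measurable M"
  shows "a * (\<Sum>i\<in>{j..j+n}. emeasure M (stop g a j x i)) \<le> ennreal (vol j) * av j g x"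
proof -
  let ?S = "\<lambda>i. stop g a j x i"
  have "a * (\<Sum>i\<in>{j..j+n}. emeasure M (?S i)) = (\<Sum>i\<in>{j..j+n}. a * emeasure M (?S i))"
    by (simp add: sum_distrib_left)
  also have "\<dots> \<le> (\<Sum>i\<in>{j..j+n}. \<integral>\<^sup>+y. g y * indicator (?S i) y \<partial>M)"
  proof (intro sum_mono)
    fix i assume i: "i \<in> {j..j+n}"
    have "a * emeasure M (?S i) = (\<integral>\<^sup>+y. a * indicator (?S i) y \<partial>M)"
      by (simp add: nn_integral_cmult_indicator)
    also have "\<dots> \<le> (\<integral>\<^sup>+y. av i g y * indicator (?S i) y \<partial>M)"
      by (intro nn_integral_mono) (auto simp: indicator_def stop_def intro: less_imp_le)
    also have "\<dots> = (\<integral>\<^sup>+y. g y * indicator (?S i) y \<partial>M)"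
      using i by (intro nn_integral_av saturated_stop) auto
    finally show "a * emeasure M (?S i) \<le> (\<integral>\<^sup>+y. g y * indicator (?S i) y \<partial>M)" .
  qed
  also have "\<dots> \<le> (\<integral>\<^sup>+y. g y * indicator (D j x) y \<partial>M)"
    by (subst nn_integral_stop_split[where n = n and g = g and a = a]) (auto intro: add_increasing)
  also have "\<dots> = ennreal (vol j) * av j g x" by (simp add: nn_integral_D_eq)
  finally show ?thesis .
qed

text \<open>At twice the average, the stopping cells fill at most half of the cell. The average has
  to be cancelled, so the values 0 and \<open>top\<close> are excluded.\<close>

lemma emeasure_rest:
  fixes n :: nat
  assumes [measurable]: "g \<in> borel_measurable M" and a: "av j g x \<noteq> 0" "av j g x \<noteq> top"
  defines "R \<equiv> D j x - (\<Union>i\<in>{j..j+n}. stop g (2 * av j g x) j x i)"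
  shows "ennreal (vol j) \<le> 2 * emeasure M R"
proof -
  let ?a = "av j g x"
  let ?S = "\<lambda>i. stop g (2 * ?a) j x i"
  have [measurable]: "R \<in> sets M" unfolding R_def by measurable
  have "2 * ?a * (\<Sum>i\<in>{j..j+n}. emeasure M (?S i)) \<le> ennreal (vol j) * ?a"
    by (rule stop_mass) simp
  then have "?a * (2 * (\<Sum>i\<in>{j..j+n}. emeasure M (?S i))) \<le> ?a * ennreal (vol j)"
    by (simp add: mult_ac)
  then have half: "2 * (\<Sum>i\<in>{j..j+n}. emeasure M (?S i)) \<le> ennreal (vol j)"
    using a by (subst (asm) ennreal_mult_le_mult_iff) auto
  have "ennreal (vol j) = (\<integral>\<^sup>+y. indicator (D j x) y \<partial>M)" by (simp add: emeasure_D)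
  also have "\<dots> = emeasure M R + (\<Sum>i\<in>{j..j+n}. emeasure M (?S i))"
    unfolding stop_partition[where x = x and n = n and g = g and a = "2 * ?a"] R_def[symmetric]
    by (subst nn_integral_add) (auto simp: nn_integral_sum intro!: borel_measurable_sum)
  finally have eq: "ennreal (vol j) = emeasure M R + (\<Sum>i\<in>{j..j+n}. emeasure M (?S i))" .
  then have "2 * ennreal (vol j) \<le> 2 * emeasure M R + ennreal (vol j)"
    using half by (metis add_left_mono distrib_left)
  then have "ennreal (vol j) + ennreal (vol j) \<le> ennreal (vol j) + 2 * emeasure M R"
    by (simp add: mult_2 add.commute)
  then show ?thesis by (subst (asm) ennreal_add_left_cancel_le) auto
qed

text \<open>By \<open>one\<close>, \<open>\<rho>\<close> is \<open>\<sigma>\<close> to the power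
  \<open>- (p - 1)\<close>. Hoelder's inequality on \<open>R\<close>, multiplied by a power of the
  \<open>\<sigma>\<close>-average and combined with the Muckenhoupt bound, shows that half of the
  volume carries a fixed share of the \<open>\<sigma>\<close>-mass. The share N^(-1/(p-1)) is the
  origin of the factor N^(1/(p-1)) in the maximal bound.\<close>

lemma weight_not_concentrated:
  assumes [measurable]: "\<sigma> \<in> borel_measurable M" "\<rho> \<in> borel_measurable M" "R \<in> sets M"
    and p: "1 < p" and N: "0 < N"
    and one: "\<And>y. \<sigma> y \<up> (1 - 1 / p) * \<rho> y \<up> (1 / p) = 1"
    and Ap: "av j \<sigma> x \<up> (p - 1) * av j \<rho> x \<le> ennreal N"
    and R: "R \<subseteq> D j x" "ennreal (vol j) \<le> 2 * emeasure M R"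
  shows "ennreal ((1/2) powr (p / (p - 1)) * N powr (- 1 / (p - 1))) * av j \<sigma> x \<le> av j (\<lambda>y. \<sigma> y * indicator R y) x"
proof -
  let ?S = "av j (\<lambda>y. \<sigma> y * indicator R y) x"
  have "ennreal (1/2) \<le> av j (indicator R) x"
  proof -
    have "(\<integral>\<^sup>+y. indicator R y * indicator (D j x) y \<partial>M) = (\<integral>\<^sup>+y. indicator R y \<partial>M)"
      using R by (intro nn_integral_cong) (auto simp: indicator_def)
    then have "av j (indicator R) x = emeasure M R / ennreal (vol j)"
      by (simp add: av_eq)
    moreover have "ennreal (vol j) / 2 \<le> emeasure M R"
      using R(2) by (simp add: divide_le_posI_ennreal mult.commute)
    then have "ennreal (vol j) / 2 / ennreal (vol j) \<le> emeasure M R / ennreal (vol j)"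
      by (rule divide_right_mono_ennreal)
    moreover have "ennreal (vol j) / 2 / ennreal (vol j) = ennreal (1/2)"
      using divide_ennreal[of "vol j" 2] divide_ennreal[of "vol j / 2" "vol j"] by simp
    ultimately show ?thesis by simp
  qed
  also have "av j (indicator R) x \<le> (\<integral>\<^sup>+y. (\<sigma> y * indicator R y) \<up> (1 - 1 / p) * \<rho> y \<up> (1 / p) \<partial>uniform_measure M (D j x))"
    unfolding av_def using one by (intro nn_integral_mono) (auto simp: indicator_def)
  also have "\<dots> \<le> ?S \<up> (1 - 1 / p) * av j \<rho> x \<up> (1 / p)"
    unfolding av_def using p by (intro nn_integral_Hoelder) auto
  finally have "ennreal (1/2) \<up> p \<le> (?S \<up> (1 - 1 / p) * av j \<rho> x \<up> (1 / p)) \<up> p"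
    using p by (intro enn_powr_mono) auto
  also have "\<dots> = ?S \<up> (p - 1) * av j \<rho> x"
    using p by (simp add: enn_powr_mult enn_powr_powr left_diff_distrib)
  finally have "ennreal ((1/2) powr p) \<le> ?S \<up> (p - 1) * av j \<rho> x"
    by (subst (asm) enn_powr_ennreal) auto
  then have "ennreal ((1/2) powr p) * av j \<sigma> x \<up> (p - 1) \<le> ?S \<up> (p - 1) * av j \<rho> x * av j \<sigma> x \<up> (p - 1)"
    by (rule mult_right_mono) simp
  also have "\<dots> \<le> ?S \<up> (p - 1) * ennreal N"
    using mult_left_mono[OF Ap, of "?S \<up> (p - 1)"] by (simp add: mult_ac)
  finally have "(ennreal ((1/2) powr p) * av j \<sigma> x \<up> (p - 1)) \<up> (1 / (p - 1)) \<le> (?S \<up> (p - 1) * ennreal N) \<up> (1 / (p - 1))"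
    using p by (intro enn_powr_mono) auto
  then have 1: "ennreal ((1/2) powr (p / (p - 1))) * av j \<sigma> x \<le> ?S * ennreal (N powr (1 / (p - 1)))"
    using p N by (simp add: enn_powr_mult enn_powr_powr) (simp add: enn_powr_ennreal powr_powr)
  have "ennreal (N powr (- 1 / (p - 1))) * (ennreal ((1/2) powr (p / (p - 1))) * av j \<sigma> x)
    \<le> ennreal (N powr (- 1 / (p - 1))) * (?S * ennreal (N powr (1 / (p - 1))))"
    by (intro mult_left_mono 1) simp
  also have "\<dots> = ennreal (N powr (- 1 / (p - 1)) * N powr (1 / (p - 1))) * ?S"
    by (simp add: ennreal_mult mult_ac)
  also have "N powr (- 1 / (p - 1)) * N powr (1 / (p - 1)) = 1"
    using N by (simp flip: powr_add)
  finally show ?thesis by (simp add: ennreal_mult mult_ac)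
qed

text \<open>The truncation to \<open>n\<close> generations makes an induction possible: off the stopping cells the maximal function is at most
  twice the average, and the stopping cells carry at most the fraction \<open>1 - \<eta>\<close> of the mass, which absorbs the factor \<open>2\<close>.\<close>

lemma reverse_Hoelder_truncated:
  fixes n :: nat
  assumes [measurable]: "\<sigma> \<in> borel_measurable M"
    and \<eta>: "0 < \<eta>" "\<eta> \<le> 1" and \<delta>: "0 < \<delta>" "(2 * \<kappa>) powr \<delta> \<le> 1 + \<eta> / 2" and \<kappa>: "1 \<le> \<kappa>"
    and spread: "\<And>j x R. R \<in> sets M \<Longrightarrow> R \<subseteq> D j x \<Longrightarrow> ennreal (vol j) \<le> 2 * emeasure M R \<Longrightarrow>
       ennreal \<eta> * av j \<sigma> x \<le> av j (\<lambda>y. \<sigma> y * indicator R y) x"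
  shows "av j (\<lambda>y. \<sigma> y * (SUP i\<in>{j..j+n}. av i \<sigma> y) \<up> \<delta>) x \<le> 2 * av j \<sigma> x \<up> (1 + \<delta>)"
proof (induction n arbitrary: j x rule: less_induct)
  case (less n)
  \<comment> \<open>The last generation \<open>j + n\<close> stays fixed while the first one moves,
    so that the maximal function on a stopping cell is the one of the induction hypothesis.\<close>
  let ?m = "\<lambda>i y. SUP l\<in>{i..j+n}. av l \<sigma> y"
  let ?a = "av j \<sigma> x"
  have m [measurable]: "?m i \<in> borel_measurable M" for i by measurable
  consider "?a = 0" | "?a = top" | "?a \<noteq> 0" "?a \<noteq> top" by blast
  then show ?case
  proof cases
    case 1
    then have "AE y in uniform_measure M (D j x). \<sigma> y = 0"
      unfolding av_def[of j _ x] by (subst (asm) nn_integral_0_iff_AE) auto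
    then have "av j (\<lambda>y. \<sigma> y * ?m j y \<up> \<delta>) x = 0"
      unfolding av_def[of j _ x] by (subst nn_integral_0_iff_AE) auto
    then show ?thesis by simp
  next
    case 2
    then show ?thesis by simp
  next
    case 3
    define S where "S i = stop \<sigma> (2 * ?a) j x i" for i
    define R where "R = D j x - (\<Union>i\<in>{j..j+n}. S i)"
    have S [measurable]: "S i \<in> sets M" for i unfolding S_def by measurable
    have R [measurable]: "R \<in> sets M" unfolding R_def by measurable
    have split: "(\<integral>\<^sup>+y. f y * indicator (D j x) y \<partial>M)
      = (\<integral>\<^sup>+y. f y * indicator R y \<partial>M) + (\<Sum>i\<in>{j..j+n}. \<integral>\<^sup>+y. f y * indicator (S i) y \<partial>M)"
      if [measurable]: "f \<in> borel_measurable M" for f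
      unfolding R_def S_def by (rule nn_integral_stop_split) measurable
    \<comment> \<open>Off the stopping cells the averages are at most \<open>2 * ?a\<close>; on a
      stopping cell its own average is at most \<open>\<kappa>\<close> times that. The hypothesis on
      \<open>\<delta>\<close> bounds the resulting constant by
      \<open>1 + \<eta> / 2\<close>.\<close>
    let ?b = "ennreal (1 + \<eta> / 2) * ?a \<up> \<delta>"
    have \<kappa>b: "(ennreal \<kappa> * (2 * ?a)) \<up> \<delta> \<le> ?b"
    proof -
      have "ennreal \<kappa> * (2 * ?a) = ennreal (2 * \<kappa>) * ?a"
        using \<kappa> by (simp add: ennreal_mult mult_ac)
      then have "(ennreal \<kappa> * (2 * ?a)) \<up> \<delta> = ennreal ((2 * \<kappa>) powr \<delta>) * ?a \<up> \<delta>"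
        using \<delta> \<kappa> by (simp only: enn_powr_mult enn_powr_ennreal)
      then show ?thesis using \<delta> by (auto intro!: mult_right_mono ennreal_leI)
    qed
    have onR: "(\<integral>\<^sup>+y. (\<sigma> y * ?m j y \<up> \<delta>) * indicator R y \<partial>M) \<le> ?b * (\<integral>\<^sup>+y. \<sigma> y * indicator R y \<partial>M)"
    proof -
      have "?m j y \<up> \<delta> \<le> ?b" if "y \<in> R" for y
      proof -
        have "?m j y \<le> 2 * ?a"
          using that stop_rest[where y = y and j = j and x = x and n = n and g = \<sigma> and a = "2 * ?a"] unfolding R_def S_def by (intro SUP_least) auto
        also have "\<dots> \<le> ennreal \<kappa> * (2 * ?a)"
          using mult_right_mono[of 1 "ennreal \<kappa>" "2 * ?a"] \<kappa> by simp
        finally show ?thesis using \<kappa>b \<delta> by (meson enn_powr_mono less_imp_le order.trans)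
      qed
      then have "(\<integral>\<^sup>+y. (\<sigma> y * ?m j y \<up> \<delta>) * indicator R y \<partial>M) \<le> (\<integral>\<^sup>+y. ?b * (\<sigma> y * indicator R y) \<partial>M)"
        by (intro nn_integral_mono) (auto simp: indicator_def mult.commute intro: mult_left_mono)
      then show ?thesis by (simp add: nn_integral_cmult)
    qed
    have onS: "(\<integral>\<^sup>+y. (\<sigma> y * ?m j y \<up> \<delta>) * indicator (S i) y \<partial>M) \<le> 2 * ?b * (\<integral>\<^sup>+y. \<sigma> y * indicator (S i) y \<partial>M)"
      if i: "i \<in> {j..j+n}" for i
    proof (cases "i = j")
      case True
      \<comment> \<open>The top cell does not stop, as its average is not above twice itself. So
        stopping cells have a later generation and fewer generations remain below them.\<close>
      have "S j = {}" unfolding S_def stop_def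
      proof (safe, goal_cases)
        case (1 y)
        then have "2 * ?a < ?a" by (simp add: av_cong)
        moreover have "?a \<le> 2 * ?a" by (simp add: mult_2)
        ultimately show ?case by (simp add: not_less[symmetric])
      qed
      then show ?thesis by (simp add: True)
    next
      case False
      then have ij: "j < i" using i by auto
      define k where "k = nat (j + n - i)"
      have k: "i + int k = j + n" "k < n" using ij i by (auto simp: k_def)
      have "(\<integral>\<^sup>+y. (\<sigma> y * ?m j y \<up> \<delta>) * indicator (S i) y \<partial>M) = (\<integral>\<^sup>+y. (\<sigma> y * ?m i y \<up> \<delta>) * indicator (S i) y \<partial>M)"
      proof (rule nn_integral_cong)
        fix y
        show "(\<sigma> y * ?m j y \<up> \<delta>) * indicator (S i) y = (\<sigma> y * ?m i y \<up> \<delta>) * indicator (S i) y"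
        proof (cases "y \<in> S i")
          case True
          \<comment> \<open>Generations before the stopping generation have averages at most
            \<open>2 * ?a\<close>, hence below the average in generation \<open>i\<close>, and do
            not affect the supremum.\<close>
          have "av l \<sigma> y \<le> ?m i y" if "l \<in> {j..j+n}" for l
          proof (cases "l < i")
            case True
            then have "av l \<sigma> y \<le> av i \<sigma> y"
              using \<open>y \<in> S i\<close> that unfolding S_def stop_def
              by (auto intro!: order.trans[of "av l \<sigma> y" "2 * ?a" "av i \<sigma> y"])
            also have "\<dots> \<le> ?m i y" using i by (intro SUP_upper) auto
            finally show ?thesis .
          qed (use that in \<open>auto intro: SUP_upper\<close>)
          then have "?m j y \<le> ?m i y" by (rule SUP_least)
          moreover have "?m i y \<le> ?m j y" using ij by (intro SUP_subset_mono) auto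
          ultimately have "?m j y = ?m i y" by (rule antisym)
          then show ?thesis by simp
        qed simp
      qed
      also have "\<dots> \<le> (\<integral>\<^sup>+y. (2 * ?b * \<sigma> y) * indicator (S i) y \<partial>M)"
      proof (rule nn_integral_saturated_mono[where j = i])
        show "saturated i (S i)" unfolding S_def using ij by (intro saturated_stop) auto
        fix z assume z: "z \<in> S i"
        have "av i \<sigma> z \<le> ennreal \<kappa> * av (i - 1) \<sigma> z"
          using av_step[of \<sigma> "i - 1" z] by simp
        also have "\<dots> \<le> ennreal \<kappa> * (2 * ?a)"
          using z ij unfolding S_def stop_def by (intro mult_left_mono) auto
        finally have "av i \<sigma> z \<up> \<delta> \<le> ?b"
          using \<kappa>b \<delta> by (meson enn_powr_mono less_imp_le order.trans)
        from mult_right_mono[OF this, of "2 * av i \<sigma> z"]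
        have "2 * av i \<sigma> z \<up> (1 + \<delta>) \<le> 2 * ?b * av i \<sigma> z"
          by (simp add: enn_powr_add mult_ac)
        then have "av i (\<lambda>y. \<sigma> y * ?m i y \<up> \<delta>) z \<le> av i (\<lambda>y. 2 * ?b * \<sigma> y) z"
          using less.IH[OF k(2), of i z] unfolding k(1) by (subst av_cmult) auto
        then show "(\<integral>\<^sup>+y. (\<sigma> y * ?m i y \<up> \<delta>) * indicator (D i z) y \<partial>M) \<le> (\<integral>\<^sup>+y. (2 * ?b * \<sigma> y) * indicator (D i z) y \<partial>M)"
          by (simp add: nn_integral_D_eq mult_left_mono)
      qed auto
      finally show ?thesis by (simp add: nn_integral_cmult mult.assoc)
    qed
    let ?Q = "\<integral>\<^sup>+y. \<sigma> y * indicator (D j x) y \<partial>M" and ?R = "\<integral>\<^sup>+y. \<sigma> y * indicator R y \<partial>M"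
    let ?T = "\<Sum>i\<in>{j..j+n}. \<integral>\<^sup>+y. \<sigma> y * indicator (S i) y \<partial>M"
    have Q: "?Q = ennreal (vol j) * ?a" by (simp add: nn_integral_D_eq)
    have QRT: "?Q = ?R + ?T" by (rule split) simp
    have "ennreal \<eta> * ?a \<le> av j (\<lambda>y. \<sigma> y * indicator R y) x"
      unfolding R_def S_def using 3 by (intro spread emeasure_rest) auto
    then have "ennreal (vol j) * (ennreal \<eta> * ?a) \<le> (\<integral>\<^sup>+y. (\<sigma> y * indicator R y) * indicator (D j x) y \<partial>M)"
      by (subst nn_integral_D_eq) (auto intro: mult_left_mono)
    also have "\<dots> = ?R"
      by (intro nn_integral_cong) (auto simp: indicator_def R_def)
    finally have \<eta>R: "ennreal \<eta> * ?Q \<le> ?R" by (simp add: Q mult_ac)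
    have "(\<integral>\<^sup>+y. (\<sigma> y * ?m j y \<up> \<delta>) * indicator (D j x) y \<partial>M) \<le> ?b * ?R + (\<Sum>i\<in>{j..j+n}. 2 * ?b * (\<integral>\<^sup>+y. \<sigma> y * indicator (S i) y \<partial>M))"
      by (subst split) (auto intro!: add_mono sum_mono onR onS)
    also have "\<dots> = ?b * (?R + 2 * ?T)"
      by (simp add: sum_distrib_left distrib_left mult_ac)
    also have "\<dots> \<le> 2 * ?a \<up> \<delta> * ?Q"
    proof -
      have Qfin: "?Q < top" using 3 by (simp add: Q ennreal_mult_less_top less_top)
      then have "?R < top" "?T < top" unfolding QRT by auto
      then have fin: "?R \<noteq> top" "?T \<noteq> top" by auto
      define r where "r = enn2real ?R"
      define t where "t = enn2real ?T"
      have r: "?R = ennreal r" "0 \<le> r" using fin by (auto simp: r_def less_top)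
      have t: "?T = ennreal t" "0 \<le> t" using fin by (auto simp: t_def less_top simp del: ennreal_enn2real_if)
      have q: "?Q = ennreal (r + t)" unfolding QRT using r t by simp
      have "ennreal (\<eta> * (r + t)) \<le> ennreal r"
        using \<eta>R r t \<eta> unfolding q r(1) by (simp add: ennreal_mult del: ennreal_plus)
      then have "\<eta> * (r + t) \<le> r" using r by simp
      \<comment> \<open>From \<open>\<eta> * (r + t) \<le> r\<close> follows
        \<open>r + 2 * t \<le> (2 - \<eta>) * (r + t)\<close>, and
        \<open>(1 + \<eta> / 2) * (2 - \<eta>)\<close> is still at most 2. Thus the factor 2
        reproduces itself in the induction.\<close>
      then have "(1 + \<eta> / 2) * (r + 2 * t) \<le> (1 + \<eta> / 2) * ((2 - \<eta>) * (r + t))"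
        using \<eta> by (intro mult_left_mono) (auto simp: algebra_simps)
      also have "\<dots> = (2 - \<eta> * \<eta> / 2) * (r + t)" by (simp add: algebra_simps)
      also have "\<dots> \<le> 2 * (r + t)" using r t by (intro mult_right_mono) auto
      finally have "ennreal ((1 + \<eta> / 2) * (r + 2 * t)) \<le> ennreal (2 * (r + t))" by (rule ennreal_leI)
      then have "ennreal (1 + \<eta> / 2) * (?R + 2 * ?T) \<le> 2 * ?Q"
        unfolding q r t using r t \<eta> by (simp add: ennreal_mult)
      then show ?thesis
        using mult_left_mono[of "ennreal (1 + \<eta> / 2) * (?R + 2 * ?T)" "2 * ?Q" "?a \<up> \<delta>"] by (simp add: mult_ac)
    qed
    also have "\<dots> = ennreal (vol j) * (2 * ?a \<up> (1 + \<delta>))"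
      unfolding Q enn_powr_add by (simp add: mult_ac)
    finally show ?thesis
      by (subst (asm) nn_integral_D_eq) (auto simp: ennreal_mult_le_mult_iff)
  qed
qed

text \<open>The truncated bound is uniform in \<open>n\<close>, so monotone convergence removes the
  truncation. Almost everywhere \<open>\<sigma>\<close> is at most its maximal function over later
  generations, so one may pass from the power \<open>\<delta>\<close> of the latter to that of
  \<open>\<sigma>\<close>.\<close>

lemma reverse_Hoelder:
  assumes [measurable]: "\<sigma> \<in> borel_measurable M"
    and \<eta>: "0 < \<eta>" "\<eta> \<le> 1" and \<delta>: "0 < \<delta>" "(2 * \<kappa>) powr \<delta> \<le> 1 + \<eta> / 2" and \<kappa>: "1 \<le> \<kappa>"
    and spread: "\<And>j x R. R \<in> sets M \<Longrightarrow> R \<subseteq> D j x \<Longrightarrow> ennreal (vol j) \<le> 2 * emeasure M R \<Longrightarrow>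
       ennreal \<eta> * av j \<sigma> x \<le> av j (\<lambda>y. \<sigma> y * indicator R y) x"
  shows "av j (\<lambda>y. \<sigma> y \<up> (1 + \<delta>)) x \<le> 2 * av j \<sigma> x \<up> (1 + \<delta>)"
proof -
  let ?m = "\<lambda>n y. SUP i\<in>{j..j+int n}. av i \<sigma> y"
  have sup: "(SUP i\<in>{j..}. av i \<sigma> y) = (SUP n. ?m n y)" for y
  proof (rule antisym)
    show "(SUP i\<in>{j..}. av i \<sigma> y) \<le> (SUP n. ?m n y)"
    proof (rule SUP_least)
      fix i assume "i \<in> {j..}"
      then have "av i \<sigma> y \<le> ?m (nat (i - j)) y" by (intro SUP_upper) auto
      then show "av i \<sigma> y \<le> (SUP n. ?m n y)" by (rule SUP_upper2[OF UNIV_I])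
    qed
    show "(SUP n. ?m n y) \<le> (SUP i\<in>{j..}. av i \<sigma> y)"
      by (intro SUP_least) (auto intro: SUP_upper)
  qed
  have "AE y in M. \<sigma> y \<le> (SUP i\<in>{j..}. av i \<sigma> y)"
    by (rule differentiation) simp
  then have "AE y in M. \<sigma> y \<up> (1 + \<delta>) \<le> (SUP n. \<sigma> y * ?m n y \<up> \<delta>)"
  proof eventually_elim
    case (elim y)
    then have "\<sigma> y \<up> \<delta> \<le> (SUP n. ?m n y \<up> \<delta>)"
      using \<delta> enn_powr_mono[of \<delta> "\<sigma> y"] by (simp add: sup enn_powr_SUP[symmetric])
    then have "\<sigma> y * \<sigma> y \<up> \<delta> \<le> \<sigma> y * (SUP n. ?m n y \<up> \<delta>)"
      by (rule mult_left_mono) simp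
    then show ?case by (simp add: enn_powr_add SUP_mult_left_ennreal)
  qed
  then have "av j (\<lambda>y. \<sigma> y \<up> (1 + \<delta>)) x \<le> (\<integral>\<^sup>+y. (SUP n. \<sigma> y * ?m n y \<up> \<delta>) \<partial>uniform_measure M (D j x))"
    unfolding av_def by (intro nn_integral_mono_AE AE_uniform_measureI) auto
  also have "\<dots> = (SUP n. \<integral>\<^sup>+y. \<sigma> y * ?m n y \<up> \<delta> \<partial>uniform_measure M (D j x))"
  proof (rule nn_integral_monotone_convergence_SUP)
    show "incseq (\<lambda>n y. \<sigma> y * ?m n y \<up> \<delta>)"
      using \<delta> by (auto simp: mono_def le_fun_def intro!: mult_left_mono enn_powr_mono SUP_subset_mono)
  qed measurable
  also have "\<dots> \<le> 2 * av j \<sigma> x \<up> (1 + \<delta>)"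
    using reverse_Hoelder_truncated[OF assms, of j _ x] by (intro SUP_least) (simp add: av_def)
  finally show ?thesis .
qed

end

subsection \<open>Maximal functions\<close>

text \<open>Layer cake integral of a power. For \<open>u = top\<close> a finite value
  \<open>i\<close> is impossible, since some finite level already gives
  \<open>i + 1\<close>.\<close>

lemma nn_integral_powr_layer:
  assumes a: "0 < a"
  shows "(\<integral>\<^sup>+t. ennreal (t powr (a - 1)) * indicator {t. 0 < t \<and> ennreal t < u} t \<partial>lborel) = ennreal (1 / a) * u \<up> a"
proof -
  let ?I = "\<lambda>u. \<integral>\<^sup>+t. ennreal (t powr (a - 1)) * indicator {t. 0 < t \<and> ennreal t < u} t \<partial>lborel"
  have fin: "?I (ennreal c) = ennreal (1 / a) * ennreal c \<up> a" if "0 \<le> c" for c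
  proof -
    have "?I (ennreal c) = (\<integral>\<^sup>+t. ennreal (t powr (a - 1)) * indicator {0..c} t \<partial>lborel)"
    proof (rule nn_integral_cong_AE)
      have "AE t in lborel. t \<noteq> c" "AE t in lborel. t \<noteq> 0" by (rule AE_lborel_singleton)+
      then show "AE t in lborel. ennreal (t powr (a - 1)) * indicator {t. 0 < t \<and> ennreal t < ennreal c} t
          = ennreal (t powr (a - 1)) * indicator {0..c} t"
        by eventually_elim (auto simp: indicator_def ennreal_less_iff)
    qed
    also have "\<dots> = ennreal (c powr (a - 1 + 1) / (a - 1 + 1))"
      using a that by (intro nn_integral_has_integral_lebesgue' has_integral_powr_from_0) auto
    also have "\<dots> = ennreal (1 / a) * ennreal c \<up> a"
      using a that by (simp add: enn_powr_ennreal flip: ennreal_mult)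
    finally show ?thesis .
  qed
  show ?thesis
  proof (cases u)
    case (real c)
    then show ?thesis using fin[of c] by simp
  next
    case top
    have "?I top = top"
    proof (rule ccontr)
      assume "?I top \<noteq> top"
      define i where "i = enn2real (?I top)"
      have i: "?I top = ennreal i" "0 \<le> i" using \<open>?I top \<noteq> top\<close> by (auto simp: i_def less_top)
      let ?c = "(a * (i + 1)) powr (1 / a)"
      have "ennreal (1 / a) * ennreal ?c \<up> a \<le> ?I top"
        unfolding fin[OF powr_ge_zero, symmetric] by (intro nn_integral_mono mult_left_mono) (auto simp: indicator_def)
      also have "ennreal (1 / a) * ennreal ?c \<up> a = ennreal (i + 1)"
        using a i by (simp add: enn_powr_ennreal powr_powr del: ennreal_plus flip: ennreal_mult)
      finally have "i + 1 \<le> i" using i(2) unfolding i(1) by (subst (asm) ennreal_le_iff) auto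
      then show False by simp
    qed
    then show ?thesis using a top by (simp add: ennreal_mult_top)
  qed
qed

context dyadic_filtration
begin

lemma sets_dmax_greater [measurable]:
  assumes [measurable]: "f \<in> borel_measurable M"
  shows "{x. c < dmax f x} \<in> sets M"
proof -
  have "{x \<in> space M. c < dmax f x} \<in> sets M" by measurable
  then show ?thesis by simp
qed

lemma weak_type:
  assumes [measurable]: "f \<in> borel_measurable M" and l: "0 < l"
  shows "ennreal l * emeasure M {x. ennreal l < dmax f x} \<le> (\<integral>\<^sup>+x. f x \<partial>M)"
proof -
  define F where "F m = {y. \<exists>i\<in>{- int m..- int m + int (2 * m)}. ennreal l < av i f y}" for m
  have F [measurable]: "F m \<in> sets M" for m
  proof -
    have "{y \<in> space M. \<exists>i\<in>{- int m..- int m + int (2 * m)}. ennreal l < av i f y} \<in> sets M" by measurable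
    then show ?thesis by (simp add: F_def)
  qed
  have le: "ennreal l * emeasure M (F m) \<le> (\<integral>\<^sup>+x. f x \<partial>M)" for m
  proof -
    let ?j = "- int m"
    have "(\<integral>\<^sup>+y. (ennreal l * indicator (F m) y) * indicator UNIV y \<partial>M) \<le> (\<integral>\<^sup>+y. f y * indicator UNIV y \<partial>M)"
    proof (rule nn_integral_saturated_mono[where j = ?j])
      fix x
      let ?S = "\<lambda>i. stop f (ennreal l) ?j x i"
      have "(\<integral>\<^sup>+y. (ennreal l * indicator (F m) y) * indicator (D ?j x) y \<partial>M)
        \<le> (\<integral>\<^sup>+y. ennreal l * (\<Sum>i\<in>{?j..?j + int (2 * m)}. indicator (?S i) y) \<partial>M)"
      proof (rule nn_integral_mono)
        fix y
        show "(ennreal l * indicator (F m) y) * indicator (D ?j x) y \<le> ennreal l * (\<Sum>i\<in>{?j..?j + int (2 * m)}. indicator (?S i) y)"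
        proof (cases "y \<in> F m \<and> y \<in> D ?j x")
          case True
          then obtain i where i: "i \<in> {?j..?j + int (2 * m)}" "y \<in> ?S i"
            using stop_rest[where y = y and j = ?j and x = x and n = "2 * m" and g = f and a = "ennreal l"]
            unfolding F_def by (force simp: not_le[symmetric])
          have "1 \<le> (\<Sum>i\<in>{?j..?j + int (2 * m)}. indicator (?S i) y :: ennreal)"
            using member_le_sum[of i "{?j..?j + int (2 * m)}" "\<lambda>i. indicator (?S i) y :: ennreal"] i
            by (simp del: sum_mult_indicator)
          then show ?thesis using True mult_left_mono[of 1 _ "ennreal l"] by simp
        qed auto
      qed
      also have "\<dots> = ennreal l * (\<integral>\<^sup>+y. (\<Sum>i\<in>{?j..?j + int (2 * m)}. indicator (?S i) y) \<partial>M)"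
        by (rule nn_integral_cmult) measurable
      also have "(\<integral>\<^sup>+y. (\<Sum>i\<in>{?j..?j + int (2 * m)}. indicator (?S i) y) \<partial>M) = (\<Sum>i\<in>{?j..?j + int (2 * m)}. emeasure M (?S i))"
        by (subst nn_integral_sum) auto
      also have "ennreal l * \<dots> \<le> ennreal (vol ?j) * av ?j f x"
        by (rule stop_mass) simp
      finally show "(\<integral>\<^sup>+y. (ennreal l * indicator (F m) y) * indicator (D ?j x) y \<partial>M) \<le> (\<integral>\<^sup>+y. f y * indicator (D ?j x) y \<partial>M)"
        by (simp add: nn_integral_D_eq)
    qed (auto simp: saturated_UNIV sets.top[of M, simplified])
    then show ?thesis by (simp add: nn_integral_cmult_indicator)
  qed
  have "{x. ennreal l < dmax f x} = (\<Union>m. F m)"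
  proof safe
    fix x assume "ennreal l < dmax f x"
    then obtain i where "ennreal l < av i f x" by (auto simp: dmax_def less_SUP_iff)
    moreover have "i \<in> {- int (nat \<bar>i\<bar>)..- int (nat \<bar>i\<bar>) + int (2 * nat \<bar>i\<bar>)}" by auto
    ultimately show "x \<in> (\<Union>m. F m)" unfolding F_def by blast
  next
    fix x m assume "x \<in> F m"
    then show "ennreal l < dmax f x" by (auto simp: F_def dmax_def less_SUP_iff)
  qed
  moreover have "incseq F"
    unfolding incseq_def F_def
  proof safe
    fix m n :: nat and x i assume "m \<le> n" and i: "i \<in> {- int m..- int m + int (2 * m)}" "ennreal l < av i f x"
    then have "i \<in> {- int n..- int n + int (2 * n)}" by auto
    with i(2) show "\<exists>i\<in>{- int n..- int n + int (2 * n)}. ennreal l < av i f x" by blast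
  qed
  ultimately have "emeasure M {x. ennreal l < dmax f x} = (SUP m. emeasure M (F m))"
    using SUP_emeasure_incseq[of F M] F by (auto simp: image_subset_iff)
  then have "ennreal l * emeasure M {x. ennreal l < dmax f x} = (SUP m. ennreal l * emeasure M (F m))"
    by (simp add: SUP_mult_left_ennreal)
  also have "\<dots> \<le> (\<integral>\<^sup>+x. f x \<partial>M)" by (intro SUP_least le)
  finally show ?thesis .
qed

text \<open>Marcinkiewicz's argument: at level t only the part of \<open>f\<close> above t/2 matters
  for the weak bound. Essential for later is that the constant grows no faster than 1/(r-1) as
  \<open>r\<close> tends to 1.\<close>

lemma maximal_inequality:
  assumes [measurable]: "f \<in> borel_measurable M" and r: "1 < r"
  shows "(\<integral>\<^sup>+x. dmax f x \<up> r \<partial>M) \<le> ennreal (2 powr r * r / (r - 1)) * (\<integral>\<^sup>+x. f x \<up> r \<partial>M)"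
proof -
  interpret L: pair_sigma_finite M lborel by unfold_locales
  note [measurable] = borel_measurable_dmax[OF assms(1)]
  let ?A = "\<lambda>u. {t::real. 0 < t \<and> ennreal t < u}"
  let ?w = "\<lambda>t a. ennreal (t powr (a - 1))"
  have weak: "emeasure M {x. ennreal t < dmax f x} \<le> ennreal (2 / t) * (\<integral>\<^sup>+x. f x * indicator (?A (2 * f x)) t \<partial>M)"
    if t: "0 < t" for t
  proof -
    let ?g = "\<lambda>x. f x * indicator (?A (2 * f x)) t"
    have [measurable]: "?g \<in> borel_measurable M"
      unfolding indicator_def by measurable
    have "f x \<le> ?g x + ennreal (t / 2)" for x
    proof (cases "ennreal t < 2 * f x")
      case False
      then have "2 * f x \<le> 2 * ennreal (t / 2)" using t by (simp add: not_less flip: ennreal_numeral ennreal_mult)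
      then have "f x \<le> ennreal (t / 2)" by (subst (asm) ennreal_mult_le_mult_iff) auto
      then show ?thesis by (simp add: add_increasing)
    qed (use t in simp)
    then have "av i f x \<le> av i ?g x + ennreal (t / 2)" for i x
      using av_mono[of i x f "\<lambda>x. ?g x + ennreal (t / 2)"] by (simp add: av_add)
    then have dle: "dmax f x \<le> dmax ?g x + ennreal (t / 2)" for x
      unfolding dmax_def by (intro SUP_least) (meson SUP_upper UNIV_I add_right_mono order.trans)
    have "{x. ennreal t < dmax f x} \<subseteq> {x. ennreal (t / 2) < dmax ?g x}"
    proof (safe, rule ccontr)
      fix x assume *: "ennreal t < dmax f x" "\<not> ennreal (t / 2) < dmax ?g x"
      then have "dmax f x \<le> ennreal (t / 2) + ennreal (t / 2)"
        using dle[of x] by (meson add_right_mono not_less order.trans)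
      also have "\<dots> = ennreal t" using t by (simp flip: ennreal_plus)
      finally show False using * by simp
    qed
    then have "emeasure M {x. ennreal t < dmax f x} \<le> emeasure M {x. ennreal (t / 2) < dmax ?g x}"
      by (intro emeasure_mono) measurable
    then have "ennreal (2 / t) * (ennreal (t / 2) * emeasure M {x. ennreal t < dmax f x}) \<le> ennreal (2 / t) * (\<integral>\<^sup>+x. ?g x \<partial>M)"
      using weak_type[of ?g "t / 2"] t by (intro mult_left_mono) (auto intro: order.trans[OF mult_left_mono])
    moreover have "ennreal (2 / t) * ennreal (t / 2) = 1" using t by (simp flip: ennreal_mult)
    ultimately show ?thesis by (simp flip: mult.assoc)
  qed
  have m1 [measurable]: "(\<lambda>z. ?w (snd z) r * indicator (?A (dmax f (fst z))) (snd z)) \<in> borel_measurable (M \<Otimes>\<^sub>M lborel)"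
    unfolding indicator_def by measurable
  have m2 [measurable]: "(\<lambda>z. f (fst z) * (?w (snd z) (r - 1) * indicator (?A (2 * f (fst z))) (snd z))) \<in> borel_measurable (M \<Otimes>\<^sub>M lborel)"
    unfolding indicator_def by measurable
  have "ennreal (1 / r) * (\<integral>\<^sup>+x. dmax f x \<up> r \<partial>M) = (\<integral>\<^sup>+x. \<integral>\<^sup>+t. ?w t r * indicator (?A (dmax f x)) t \<partial>lborel \<partial>M)"
    using r by (simp add: nn_integral_powr_layer nn_integral_cmult)
  also have "\<dots> = (\<integral>\<^sup>+t. \<integral>\<^sup>+x. ?w t r * indicator (?A (dmax f x)) t \<partial>M \<partial>lborel)"
    using m1 by (intro L.Fubini'[symmetric]) (simp add: case_prod_beta')
  also have "\<dots> \<le> (\<integral>\<^sup>+t. \<integral>\<^sup>+x. 2 * (f x * (?w t (r - 1) * indicator (?A (2 * f x)) t)) \<partial>M \<partial>lborel)"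
  proof (rule nn_integral_mono)
    fix t
    show "(\<integral>\<^sup>+x. ?w t r * indicator (?A (dmax f x)) t \<partial>M) \<le> (\<integral>\<^sup>+x. 2 * (f x * (?w t (r - 1) * indicator (?A (2 * f x)) t)) \<partial>M)"
    proof (cases "0 < t")
      case True
      have [measurable]: "(\<lambda>x. f x * indicator (?A (2 * f x)) t) \<in> borel_measurable M"
        unfolding indicator_def by measurable
      have "(\<integral>\<^sup>+x. ?w t r * indicator (?A (dmax f x)) t \<partial>M) = (\<integral>\<^sup>+x. ?w t r * indicator {x. ennreal t < dmax f x} x \<partial>M)"
        using True by (intro nn_integral_cong) (auto simp: indicator_def)
      also have "\<dots> = ?w t r * emeasure M {x. ennreal t < dmax f x}"
        by (rule nn_integral_cmult_indicator) measurable
      also have "\<dots> \<le> ?w t r * (ennreal (2 / t) * (\<integral>\<^sup>+x. f x * indicator (?A (2 * f x)) t \<partial>M))"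
        by (intro mult_left_mono weak True) auto
      also have "\<dots> = ennreal (t powr (r - 1) * (2 / t)) * (\<integral>\<^sup>+x. f x * indicator (?A (2 * f x)) t \<partial>M)"
        using True by (subst ennreal_mult) (auto simp: mult.assoc)
      also have "t powr (r - 1) * (2 / t) = 2 * t powr (r - 1 - 1)"
        using True by (simp add: powr_diff power2_eq_square)
      also have "ennreal (2 * t powr (r - 1 - 1)) * (\<integral>\<^sup>+x. f x * indicator (?A (2 * f x)) t \<partial>M)
        = (\<integral>\<^sup>+x. ennreal (2 * t powr (r - 1 - 1)) * (f x * indicator (?A (2 * f x)) t) \<partial>M)"
        by (rule nn_integral_cmult[symmetric]) measurable
      also have "\<dots> = (\<integral>\<^sup>+x. 2 * (f x * (?w t (r - 1) * indicator (?A (2 * f x)) t)) \<partial>M)"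
        by (intro nn_integral_cong) (simp add: ennreal_mult mult_ac)
      finally show ?thesis by simp
    qed simp
  qed
  also have "\<dots> = (\<integral>\<^sup>+x. \<integral>\<^sup>+t. 2 * (f x * (?w t (r - 1) * indicator (?A (2 * f x)) t)) \<partial>lborel \<partial>M)"
    using m2 by (intro L.Fubini') (auto simp: case_prod_beta')
  also have "\<dots> = (\<integral>\<^sup>+x. ennreal (2 powr r / (r - 1)) * f x \<up> r \<partial>M)"
  proof (rule nn_integral_cong)
    fix x
    have [measurable]: "(\<lambda>t. ?w t (r - 1) * indicator (?A (2 * f x)) t) \<in> borel_measurable borel"
      unfolding indicator_def by measurable
    have "(\<integral>\<^sup>+t. 2 * (f x * (?w t (r - 1) * indicator (?A (2 * f x)) t)) \<partial>lborel) = 2 * (f x * (ennreal (1 / (r - 1)) * (2 * f x) \<up> (r - 1)))"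
      using r nn_integral_powr_layer[of "r - 1" "2 * f x"] by (simp add: nn_integral_cmult)
    also have "\<dots> = ennreal 2 \<up> 1 * ennreal 2 \<up> (r - 1) * ennreal (1 / (r - 1)) * (f x \<up> 1 * f x \<up> (r - 1))"
      using r by (simp add: enn_powr_mult mult_ac)
    also have "\<dots> = ennreal 2 \<up> (1 + (r - 1)) * ennreal (1 / (r - 1)) * f x \<up> (1 + (r - 1))"
      by (simp only: enn_powr_add)
    also have "\<dots> = ennreal (2 powr r / (r - 1)) * f x \<up> r"
      using r by (subst enn_powr_ennreal) (auto simp flip: ennreal_mult)
    finally show "(\<integral>\<^sup>+t. 2 * (f x * (?w t (r - 1) * indicator (?A (2 * f x)) t)) \<partial>lborel) = ennreal (2 powr r / (r - 1)) * f x \<up> r" .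
  qed
  also have "\<dots> = ennreal (2 powr r / (r - 1)) * (\<integral>\<^sup>+x. f x \<up> r \<partial>M)"
    by (simp add: nn_integral_cmult)
  finally have "ennreal r * (ennreal (1 / r) * (\<integral>\<^sup>+x. dmax f x \<up> r \<partial>M)) \<le> ennreal r * (ennreal (2 powr r / (r - 1)) * (\<integral>\<^sup>+x. f x \<up> r \<partial>M))"
    by (rule mult_left_mono) simp
  moreover have "ennreal r * ennreal (1 / r) = 1" using r by (simp flip: ennreal_mult)
  moreover have "ennreal r * ennreal (2 powr r / (r - 1)) = ennreal (2 powr r * r / (r - 1))"
    using r by (simp flip: ennreal_mult add: mult.commute)
  ultimately show ?thesis by (simp flip: mult.assoc)
qed

text \<open>Below a cube one
  factorises \<open>k z y \<le> w z * h y\<close> and stops where the average of \<open>h\<close> doubles.\<close>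

lemma kernel_bound_truncated:
  fixes j :: int and n :: nat and c1 c2 :: real
  assumes [measurable]: "(\<lambda>z. k (fst z) (snd z)) \<in> borel_measurable (M \<Otimes>\<^sub>M M)" "g \<in> borel_measurable M"
    and p: "0 < p" "0 < r" and c: "0 < c1" "0 < c2"
    and fact: "\<And>j x. \<exists>w\<in>borel_measurable M. \<exists>h\<in>borel_measurable M. (\<forall>z y. k z y \<le> w z * h y) \<and>
        av j (\<lambda>z. w z \<up> p) x \<le> ennreal c1 \<and> av j h x \<up> p \<le> ennreal c2 * av j g x \<up> r"
  shows "(\<integral>\<^sup>+z. (SUP i\<in>{j..j+n}. av i (k z) z) \<up> p * indicator (D j x) z \<partial>M)
    \<le> ennreal (2 * 2 powr p * c1 * c2) * (\<integral>\<^sup>+z. dmax g z \<up> r * indicator (D j x) z \<partial>M)"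
proof (induction n arbitrary: j x rule: less_induct)
  case (less n)
  let ?C = "ennreal (2 * 2 powr p * c1 * c2)"
  have kz [measurable]: "k z \<in> borel_measurable M" for z
    using measurable_compose[OF measurable_Pair1' assms(1), of z] by simp
  define T where "T i m z = (SUP l\<in>{i..m}. av l (k z) z)" for i m z
  have T [measurable]: "T i m \<in> borel_measurable M" for i m
    unfolding T_def by (intro borel_measurable_SUP borel_measurable_av_kernel) auto
  obtain w h where [measurable]: "w \<in> borel_measurable M" "h \<in> borel_measurable M"
    and wh: "\<And>z y. k z y \<le> w z * h y" "av j (\<lambda>z. w z \<up> p) x \<le> ennreal c1" "av j h x \<up> p \<le> ennreal c2 * av j g x \<up> r"
    using fact[of j x] by blast
  let ?a = "av j h x"
  have Tle: "av i (k z) z \<le> w z * av i h z" for i z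
    using av_mono[of i z "k z" "\<lambda>y. w z * h y"] wh(1) by (simp add: av_cmult)
  have Mg: "av j g x \<le> dmax g z" if "z \<in> D j x" for z
    unfolding dmax_def using av_cong[OF that, of g] by (metis SUP_upper UNIV_I)
  \<comment> \<open>The degenerate averages are settled directly: for 0 the kernel averages below
    the cell vanish, for \<open>top\<close> the right side is infinite.\<close>
  consider "?a = 0" | "?a = top" | "?a \<noteq> 0" "?a \<noteq> top" by blast
  then have "(\<integral>\<^sup>+z. T j (j+n) z \<up> p * indicator (D j x) z \<partial>M) \<le> ?C * (\<integral>\<^sup>+z. dmax g z \<up> r * indicator (D j x) z \<partial>M)"
  proof cases
    case 1
    have "av i h z = 0" if "z \<in> D j x" "j \<le> i" for i z
    proof -
      have "ennreal (vol i) * av i h z \<le> ennreal (vol j) * av j h z"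
        unfolding nn_integral_D_eq[OF \<open>h \<in> _\<close>, symmetric]
        using D_nested[OF that(2), of z] by (intro nn_integral_mono mult_left_mono) (auto simp: indicator_def)
      then show ?thesis using 1 av_cong[OF that(1), of h] by simp
    qed
    then have "T j (j+n) z \<le> 0" if "z \<in> D j x" for z
      unfolding T_def using that Tle[of _ z] by (intro SUP_least) (metis atLeastAtMost_iff mult_zero_right)
    then have "T j (j+n) z \<up> p * indicator (D j x) z = 0" for z
      by (cases "z \<in> D j x") auto
    then have "(\<integral>\<^sup>+z. T j (j+n) z \<up> p * indicator (D j x) z \<partial>M) = 0"
      by (simp only: nn_integral_const mult_zero_left)
    then show ?thesis by simp
  next
    case 2
    then have "av j g x = top" using wh(3) by (auto simp: top_unique ennreal_mult_eq_top_iff)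
    then have "dmax g z \<up> r * indicator (D j x) z = top * indicator (D j x) z" for z
      using Mg[of z] by (auto simp: indicator_def top_unique)
    then have "(\<integral>\<^sup>+z. dmax g z \<up> r * indicator (D j x) z \<partial>M) = top"
      by (simp only: nn_integral_cmult_indicator[OF sets_D] emeasure_D) (simp add: ennreal_top_mult)
    then show ?thesis using c by (simp add: ennreal_mult_top)
  next
    case 3
    define S where "S i = stop h (2 * ?a) j x i" for i
    define R where "R = D j x - (\<Union>i\<in>{j..j+n}. S i)"
    have S [measurable]: "S i \<in> sets M" for i unfolding S_def by measurable
    have R [measurable]: "R \<in> sets M" unfolding R_def by measurable
    have split: "(\<integral>\<^sup>+y. f y * indicator (D j x) y \<partial>M)
      = (\<integral>\<^sup>+y. f y * indicator R y \<partial>M) + (\<Sum>i\<in>{j..j+n}. \<integral>\<^sup>+y. f y * indicator (S i) y \<partial>M)"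
      if [measurable]: "f \<in> borel_measurable M" for f
      unfolding R_def S_def by (rule nn_integral_stop_split) measurable
    have Sj: "S j = {}" unfolding S_def stop_def
    proof (safe, goal_cases)
      case (1 y)
      then have "2 * ?a < ?a" by (simp add: av_cong)
      moreover have "?a \<le> 2 * ?a" by (simp add: mult_2)
      ultimately show ?case by (simp add: not_less[symmetric])
    qed
    let ?W = "\<lambda>z. (w z * (2 * ?a)) \<up> p"
    let ?X = "\<Sum>i\<in>{j..j+n}. \<integral>\<^sup>+z. T i (j+n) z \<up> p * indicator (S i) z \<partial>M"
    have onR: "T j (j+n) z \<up> p * indicator R z \<le> ?W z * indicator R z" for z
    proof (cases "z \<in> R")
      case True
      have "T j (j+n) z \<le> w z * (2 * ?a)" unfolding T_def
      proof (rule SUP_least)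
        fix i assume "i \<in> {j..j+n}"
        then have "av i h z \<le> 2 * ?a"
          using True stop_rest[where y = z and j = j and x = x and n = n and g = h and a = "2 * ?a" and i = i]
          unfolding R_def S_def by auto
        then show "av i (k z) z \<le> w z * (2 * ?a)"
          using Tle[of i z] by (meson mult_left_mono order.trans zero_le)
      qed
      then show ?thesis using p True by (simp add: enn_powr_mono)
    qed simp
    \<comment> \<open>Before generation \<open>i\<close> the average of \<open>h\<close> has not
      doubled, so the factorisation suffices; from \<open>i\<close> on, the operator started at
      \<open>i\<close> takes over. Taking the maximum before the power and the sum after it loses no
      constant, so the induction closes with the same \<open>?C\<close>.\<close>
    have onS: "T j (j+n) z \<up> p * indicator (S i) z \<le> ?W z * indicator (S i) z + T i (j+n) z \<up> p * indicator (S i) z"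
      if i: "i \<in> {j..j+n}" for i z
    proof (cases "z \<in> S i")
      case True
      have "T j (j+n) z \<le> sup (w z * (2 * ?a)) (T i (j+n) z)"
        unfolding T_def[of j]
      proof (rule SUP_least)
        fix l assume l: "l \<in> {j..j+n}"
        show "av l (k z) z \<le> sup (w z * (2 * ?a)) (T i (j+n) z)"
        proof (cases "l < i")
          case True
          then have "av l h z \<le> 2 * ?a" using \<open>z \<in> S i\<close> l by (auto simp: S_def stop_def)
          then show ?thesis
            using Tle[of l z] by (meson mult_left_mono order.trans zero_le sup_ge1)
        next
          case False
          then have "av l (k z) z \<le> T i (j+n) z" unfolding T_def using l by (intro SUP_upper) auto
          then show ?thesis by (rule le_supI2)
        qed
      qed
      then have "T j (j+n) z \<up> p \<le> sup (?W z) (T i (j+n) z \<up> p)"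
        using p by (subst enn_powr_sup[symmetric]) (auto intro: enn_powr_mono)
      also have "\<dots> \<le> ?W z + T i (j+n) z \<up> p" by (auto intro: add_increasing add_increasing2)
      finally show ?thesis using True by simp
    qed simp
    have "(\<integral>\<^sup>+z. T j (j+n) z \<up> p * indicator (D j x) z \<partial>M)
      \<le> (\<integral>\<^sup>+z. ?W z * indicator R z \<partial>M) + (\<Sum>i\<in>{j..j+n}. \<integral>\<^sup>+z. ?W z * indicator (S i) z + T i (j+n) z \<up> p * indicator (S i) z \<partial>M)"
      by (subst split) (auto intro!: add_mono sum_mono nn_integral_mono onR onS)
    also have "\<dots> = (\<integral>\<^sup>+z. ?W z * indicator (D j x) z \<partial>M) + ?X"
      by (subst split) (auto simp: nn_integral_add sum.distrib add.assoc)
    also have "(\<integral>\<^sup>+z. ?W z * indicator (D j x) z \<partial>M) \<le> ?C * (\<integral>\<^sup>+z. dmax g z \<up> r * indicator R z \<partial>M)"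
    proof -
      have "(\<integral>\<^sup>+z. ?W z * indicator (D j x) z \<partial>M) = ennreal (vol j) * av j (\<lambda>z. (2 * ?a) \<up> p * w z \<up> p) x"
        using p by (subst nn_integral_D_eq) (auto simp: enn_powr_mult mult.commute)
      also have "\<dots> = ennreal (vol j) * ((2 * ?a) \<up> p * av j (\<lambda>z. w z \<up> p) x)"
        by (subst av_cmult) auto
      also have "\<dots> \<le> ennreal (vol j) * ((2 * ?a) \<up> p * ennreal c1)"
        by (intro mult_left_mono wh) auto
      also have "(2 * ?a) \<up> p = ennreal (2 powr p) * ?a \<up> p"
        using p enn_powr_ennreal[of 2 p] by (simp add: enn_powr_mult)
      also have "ennreal (vol j) * (ennreal (2 powr p) * ?a \<up> p * ennreal c1) = ennreal (2 powr p) * ennreal c1 * (ennreal (vol j) * ?a \<up> p)"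
        by (simp add: mult_ac)
      \<comment> \<open>The whole cell is paid for by \<open>R\<close>, which has at least half of
        its volume. Since \<open>R\<close> is disjoint from the stopping cells, the contributions of
        successive steps do not overlap.\<close>
      also have "\<dots> \<le> ennreal (2 powr p) * ennreal c1 * ((2 * emeasure M R) * (ennreal c2 * av j g x \<up> r))"
        using 3 unfolding R_def S_def by (intro mult_left_mono mult_mono wh emeasure_rest) auto
      also have "\<dots> = ?C * (av j g x \<up> r * emeasure M R)"
        using c by (simp add: ennreal_mult mult_ac)
      also have "av j g x \<up> r * emeasure M R = (\<integral>\<^sup>+z. av j g x \<up> r * indicator R z \<partial>M)"
        by (simp add: nn_integral_cmult_indicator)
      also have "?C * \<dots> \<le> ?C * (\<integral>\<^sup>+z. dmax g z \<up> r * indicator R z \<partial>M)"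
        using Mg p by (intro mult_left_mono nn_integral_mono) (auto simp: indicator_def R_def intro: enn_powr_mono)
      finally show ?thesis .
    qed
    also have "?X \<le> (\<Sum>i\<in>{j..j+n}. \<integral>\<^sup>+z. (?C * dmax g z \<up> r) * indicator (S i) z \<partial>M)"
    proof (rule sum_mono)
      fix i assume i: "i \<in> {j..j+n}"
      show "(\<integral>\<^sup>+z. T i (j+n) z \<up> p * indicator (S i) z \<partial>M) \<le> (\<integral>\<^sup>+z. (?C * dmax g z \<up> r) * indicator (S i) z \<partial>M)"
      proof (cases "i = j")
        case False
        then have ij: "j < i" using i by auto
        define m where "m = nat (j + n - i)"
        have m: "i + int m = j + n" "m < n" using ij i by (auto simp: m_def)
        show ?thesis
        proof (rule nn_integral_saturated_mono[where j = i])
          show "saturated i (S i)" unfolding S_def using ij by (intro saturated_stop) auto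
          fix z assume "z \<in> S i"
          show "(\<integral>\<^sup>+y. T i (j+n) y \<up> p * indicator (D i z) y \<partial>M) \<le> (\<integral>\<^sup>+y. (?C * dmax g y \<up> r) * indicator (D i z) y \<partial>M)"
            using less.IH[OF m(2), where j = i and x = z] unfolding m(1) T_def by (simp add: mult.assoc nn_integral_cmult)
        qed auto
      qed (simp add: Sj)
    qed
    also have "\<dots> = ?C * (\<Sum>i\<in>{j..j+n}. \<integral>\<^sup>+z. dmax g z \<up> r * indicator (S i) z \<partial>M)"
      by (simp add: mult.assoc nn_integral_cmult sum_distrib_left)
    finally show ?thesis
      by (subst (2) split) (auto simp: distrib_left add_mono)
  qed
  then show ?case by (simp add: T_def)
qed

text \<open>The truncated bounds for generations \<open>- m\<close> to \<open>m\<close> are added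
  over all starting cells by localisation; then \<open>m\<close> tends to infinity.\<close>

lemma kernel_bound:
  fixes c1 c2 :: real
  assumes [measurable]: "(\<lambda>z. k (fst z) (snd z)) \<in> borel_measurable (M \<Otimes>\<^sub>M M)" "g \<in> borel_measurable M"
    and p: "0 < p" "0 < r" and c: "0 < c1" "0 < c2"
    and fact: "\<And>j x. \<exists>w\<in>borel_measurable M. \<exists>h\<in>borel_measurable M. (\<forall>z y. k z y \<le> w z * h y) \<and>
        av j (\<lambda>z. w z \<up> p) x \<le> ennreal c1 \<and> av j h x \<up> p \<le> ennreal c2 * av j g x \<up> r"
  shows "(\<integral>\<^sup>+z. (SUP i. av i (k z) z) \<up> p \<partial>M) \<le> ennreal (2 * 2 powr p * c1 * c2) * (\<integral>\<^sup>+z. dmax g z \<up> r \<partial>M)"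
proof -
  let ?C = "ennreal (2 * 2 powr p * c1 * c2)"
  define T where "T m z = (SUP l\<in>{- int m..- int m + int (2 * m)}. av l (k z) z)" for m z
  have T [measurable]: "T m \<in> borel_measurable M" for m
    unfolding T_def by (intro borel_measurable_SUP borel_measurable_av_kernel) auto
  have le: "(\<integral>\<^sup>+z. T m z \<up> p \<partial>M) \<le> ?C * (\<integral>\<^sup>+z. dmax g z \<up> r \<partial>M)" for m
  proof -
    have "(\<integral>\<^sup>+z. T m z \<up> p * indicator UNIV z \<partial>M) \<le> (\<integral>\<^sup>+z. (?C * dmax g z \<up> r) * indicator UNIV z \<partial>M)"
    proof (rule nn_integral_saturated_mono[where j = "- int m"])
      show "(\<integral>\<^sup>+y. T m y \<up> p * indicator (D (- int m) x) y \<partial>M) \<le> (\<integral>\<^sup>+y. (?C * dmax g y \<up> r) * indicator (D (- int m) x) y \<partial>M)" for x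
        using kernel_bound_truncated[OF assms, where j = "- int m" and n = "2 * m" and x = x] by (simp add: T_def mult.assoc nn_integral_cmult)
    qed (auto simp: saturated_UNIV sets.top[of M, simplified])
    then show ?thesis by (simp add: nn_integral_cmult)
  qed
  have inc: "T m z \<le> T m' z" if "m \<le> m'" for m m' z
    unfolding T_def using that by (intro SUP_subset_mono) auto
  have sup: "(SUP i. av i (k z) z) = (SUP m. T m z)" for z
  proof (rule antisym)
    show "(SUP i. av i (k z) z) \<le> (SUP m. T m z)"
    proof (rule SUP_least)
      fix i
      have "av i (k z) z \<le> T (nat \<bar>i\<bar>) z" unfolding T_def by (intro SUP_upper) auto
      then show "av i (k z) z \<le> (SUP m. T m z)" by (rule SUP_upper2[OF UNIV_I])
    qed
    show "(SUP m. T m z) \<le> (SUP i. av i (k z) z)"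
      unfolding T_def by (intro SUP_least SUP_upper) auto
  qed
  have "(\<integral>\<^sup>+z. (SUP i. av i (k z) z) \<up> p \<partial>M) = (\<integral>\<^sup>+z. (SUP m. T m z \<up> p) \<partial>M)"
    unfolding sup using p by (simp add: enn_powr_SUP)
  also have "\<dots> = (SUP m. \<integral>\<^sup>+z. T m z \<up> p \<partial>M)"
    using p by (intro nn_integral_monotone_convergence_SUP) (auto simp: mono_def le_fun_def intro!: enn_powr_mono inc)
  also have "\<dots> \<le> ?C * (\<integral>\<^sup>+z. dmax g z \<up> r \<partial>M)" by (intro SUP_least le)
  finally show ?thesis .
qed

end

subsection \<open>Matrix weights and their maximal operators\<close>

lemma ennreal_mult_left_assoc: "0 \<le> a \<Longrightarrow> 0 \<le> b \<Longrightarrow> ennreal a * (ennreal b * x) = ennreal (a * b) * x"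
  by (simp add: ennreal_mult mult.assoc)

context dyadic_filtration
begin

text \<open>\<open>A\<close> and \<open>B\<close> stand for \<open>W\<^sup>1\<^sup>/\<^sup>p\<close> and its inverse; \<open>norm\<close> of a matrix is the Frobenius norm, which is comparable to the
  operator norm and invariant under transposition.\<close>

definition dyadic_Ap :: "real \<Rightarrow> real \<Rightarrow> ('a \<Rightarrow> complex^'d^'d) \<Rightarrow> ('a \<Rightarrow> complex^'d^'d) \<Rightarrow> bool" where
  "dyadic_Ap p N A B \<longleftrightarrow> A \<in> borel_measurable M \<and> B \<in> borel_measurable M \<and>
    (\<forall>x. A x ** B x = mat 1 \<and> B x ** A x = mat 1) \<and>
    (\<forall>j x. av j (\<lambda>z. av j (\<lambda>y. ennreal (norm (A z ** B y)) \<up> (p / (p - 1))) x \<up> (p - 1)) x \<le> ennreal N)"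

definition mmax :: "('a \<Rightarrow> complex^'d^'d) \<Rightarrow> ('a \<Rightarrow> complex^'d^'d) \<Rightarrow> ('a \<Rightarrow> ennreal) \<Rightarrow> 'a \<Rightarrow> ennreal" where
  "mmax A B F x = (SUP i. av i (\<lambda>y. ennreal (norm (A x ** B y)) * F y) x)"

lemma dyadic_Ap_measurable:
  assumes "dyadic_Ap p N A B"
  shows "A \<in> borel_measurable M" "B \<in> borel_measurable M"
  using assms by (auto simp: dyadic_Ap_def)

lemma dyadic_Ap_inverse:
  assumes "dyadic_Ap p N A B"
  shows "A x ** B x = mat 1" "B x ** A x = mat 1"
  using assms by (auto simp: dyadic_Ap_def)

lemma borel_measurable_mmax:
  fixes A B :: "'a \<Rightarrow> complex^'d^'d"
  assumes [measurable]: "A \<in> borel_measurable M" "B \<in> borel_measurable M" "F \<in> borel_measurable M"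
  shows "mmax A B F \<in> borel_measurable M"
  unfolding mmax_def by (intro borel_measurable_SUP borel_measurable_av_kernel) auto

lemma kappa_ge_1: "1 \<le> \<kappa>"
proof -
  have "ennreal (vol 1) \<le> ennreal (vol 0)"
    using emeasure_mono[OF D_nested[of 0 1 undefined], of M] by (simp add: emeasure_D)
  then have "vol 1 \<le> vol 0" by simp
  also have "\<dots> \<le> \<kappa> * vol 1" using doubling[of 0] by simp
  finally have "1 * vol 1 \<le> \<kappa> * vol 1" by (simp only: mult_1)
  then show ?thesis by (rule mult_right_le_imp_le) simp
qed

text \<open>Inserting \<open>B z ** A z\<close> gives |P B(y)| <= |P B(z)| |A(z) B(y)|. The matrix
  \<open>P\<close> is not tied to the cell, because the reverse Hoelder inequality fixes the
  \<open>P\<close> of one cell and then needs this bound on all cells.\<close>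

lemma dyadic_Ap_scalar:
  fixes A B :: "'a \<Rightarrow> complex^'d^'d" and P P' :: "complex^'d^'d"
  assumes Ap: "dyadic_Ap p N A B" and p: "1 < p" and P: "P' ** P = mat 1"
  shows "av j (\<lambda>y. ennreal (norm (P ** B y)) \<up> (p / (p - 1))) x \<up> (p - 1)
    * av j (\<lambda>z. ennreal (norm (P ** B z) powr - p)) x \<le> ennreal N"
proof -
  note [measurable] = dyadic_Ap_measurable[OF Ap]
  let ?p' = "p / (p - 1)"
  let ?S = "av j (\<lambda>y. ennreal (norm (P ** B y)) \<up> ?p') x"
  have pos: "0 < norm (P ** B z)" for z
  proof (rule matrix_pair_nonzero(1)[where P' = "A z ** P'"])
    show "(A z ** P') ** (P ** B z) = mat 1"
      using P dyadic_Ap_inverse[OF Ap] by (metis matrix_mul_assoc matrix_mul_lid)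
  qed
  have 1: "?S \<up> (p - 1) * ennreal (norm (P ** B z) powr - p)
    \<le> av j (\<lambda>y. ennreal (norm (A z ** B y)) \<up> ?p') x \<up> (p - 1)" for z
  proof -
    have "?S \<le> av j (\<lambda>y. ennreal (norm (P ** B z)) \<up> ?p' * ennreal (norm (A z ** B y)) \<up> ?p') x"
    proof (rule av_mono)
      fix y
      have "P ** B y = (P ** B z) ** (A z ** B y)"
        using dyadic_Ap_inverse[OF Ap, of z] by (metis matrix_mul_assoc matrix_mul_rid)
      then have "norm (P ** B y) \<le> norm (P ** B z) * norm (A z ** B y)"
        using norm_matrix_mult_le[of "P ** B z" "A z ** B y"] by simp
      then have "ennreal (norm (P ** B y)) \<up> ?p' \<le> (ennreal (norm (P ** B z)) * ennreal (norm (A z ** B y))) \<up> ?p'"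
        using p by (intro enn_powr_mono) (auto simp flip: ennreal_mult intro: ennreal_leI)
      then show "ennreal (norm (P ** B y)) \<up> ?p' \<le> ennreal (norm (P ** B z)) \<up> ?p' * ennreal (norm (A z ** B y)) \<up> ?p'"
        using p by (simp add: enn_powr_mult)
    qed
    then have "?S \<le> ennreal (norm (P ** B z)) \<up> ?p' * av j (\<lambda>y. ennreal (norm (A z ** B y)) \<up> ?p') x"
      by (subst (asm) av_cmult) auto
    then have "?S \<up> (p - 1) \<le> (ennreal (norm (P ** B z)) \<up> ?p' * av j (\<lambda>y. ennreal (norm (A z ** B y)) \<up> ?p') x) \<up> (p - 1)"
      using p by (intro enn_powr_mono) auto
    then have "?S \<up> (p - 1) \<le> ennreal (norm (P ** B z) powr p) * av j (\<lambda>y. ennreal (norm (A z ** B y)) \<up> ?p') x \<up> (p - 1)"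
      using p by (simp add: enn_powr_mult enn_powr_powr) (simp add: enn_powr_ennreal)
    from mult_right_mono[OF this, of "ennreal (norm (P ** B z) powr - p)"]
    have "?S \<up> (p - 1) * ennreal (norm (P ** B z) powr - p)
      \<le> ennreal (norm (P ** B z) powr p * norm (P ** B z) powr - p) * av j (\<lambda>y. ennreal (norm (A z ** B y)) \<up> ?p') x \<up> (p - 1)"
      by (simp add: ennreal_mult mult_ac)
    also have "norm (P ** B z) powr p * norm (P ** B z) powr - p = 1"
      using pos[of z] by (simp flip: powr_add)
    finally show ?thesis by simp
  qed
  have "?S \<up> (p - 1) * av j (\<lambda>z. ennreal (norm (P ** B z) powr - p)) x
    = av j (\<lambda>z. ?S \<up> (p - 1) * ennreal (norm (P ** B z) powr - p)) x"
    by (rule av_cmult[symmetric]) measurable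
  also have "\<dots> \<le> av j (\<lambda>z. av j (\<lambda>y. ennreal (norm (A z ** B y)) \<up> ?p') x \<up> (p - 1)) x"
    by (intro av_mono 1)
  also have "\<dots> \<le> ennreal N" using Ap by (auto simp: dyadic_Ap_def)
  finally show ?thesis .
qed

text \<open>The gain in the exponent can be proportional to \<open>\<eta>\<close>: the left side is
  at most exp(\<eta>/4), and exp u <= 1 + u + u^2 on the unit interval. A gain of smaller order than
  \<open>\<eta>\<close> would spoil the power of the characteristic.\<close>

lemma exists_reverse_Hoelder_exponent:
  obtains c0 where "0 < c0" "c0 \<le> 1" "\<And>\<eta>. 0 < \<eta> \<Longrightarrow> \<eta> \<le> 1 \<Longrightarrow> (2 * \<kappa>) powr (c0 * \<eta>) \<le> 1 + \<eta> / 2"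
proof -
  define L where "L = ln (2 * \<kappa>)"
  have L: "0 < L" unfolding L_def using kappa_ge_1 by simp
  define c0 where "c0 = min 1 (1 / (4 * L))"
  have "(2 * \<kappa>) powr (c0 * \<eta>) \<le> 1 + \<eta> / 2" if \<eta>: "0 < \<eta>" "\<eta> \<le> 1" for \<eta> :: real
  proof -
    have "c0 * L \<le> 1 / (4 * L) * L" unfolding c0_def using L by (intro mult_right_mono) auto
    then have "c0 * L * \<eta> \<le> 1 / 4 * \<eta>" using L \<eta> by (intro mult_right_mono) auto
    then have "(2 * \<kappa>) powr (c0 * \<eta>) \<le> exp (\<eta> / 4)"
      using kappa_ge_1 by (simp add: powr_def L_def mult_ac)
    also have "\<dots> \<le> 1 + \<eta> / 4 + (\<eta> / 4)\<^sup>2" using \<eta> by (intro exp_bound) auto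
    also have "(\<eta> / 4)\<^sup>2 \<le> \<eta> / 4" using \<eta> by (simp add: power2_eq_square)
    finally show ?thesis by simp
  qed
  then show ?thesis using L by (intro that[of c0]) (auto simp: c0_def)
qed

text \<open>The exponent is p/(p-1) = 1 + 1/(p-1): one factor \<open>N\<close> comes from the mean
  of |P B|^p' over a cell, raised to \<open>p - 1\<close>, and N^(1/(p-1)) comes from the constant
  of the maximal inequality through 1/(r-1).\<close>

theorem matrix_maximal_bound:
  fixes p :: real
  assumes p: "1 < p"
  shows "\<exists>C>0. \<forall>(A :: 'a \<Rightarrow> complex^'d^'d) B N F. 1 \<le> N \<longrightarrow> dyadic_Ap p N A B \<longrightarrow> F \<in> borel_measurable M \<longrightarrow>
    (\<integral>\<^sup>+x. mmax A B F x \<up> p \<partial>M) \<le> ennreal (C * N powr (p / (p - 1))) * (\<integral>\<^sup>+x. F x \<up> p \<partial>M)"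
proof -
  define p' where "p' = p / (p - 1)"
  have p': "1 < p'" "p' * (p - 1) = p" using p by (auto simp: p'_def field_simps)
  obtain c0 where c0: "0 < c0" "c0 \<le> 1" "\<And>\<eta>. 0 < \<eta> \<Longrightarrow> \<eta> \<le> 1 \<Longrightarrow> (2 * \<kappa>) powr (c0 * \<eta>) \<le> 1 + \<eta> / 2"
    by (rule exists_reverse_Hoelder_exponent) blast
  define c1 where "c1 = real CARD('d) powr (2 * p + 1) * norm (mat 1 :: complex^'d^'d) powr p"
  define c3 where "c3 = real CARD('d) powr (4 * (p / (p - 1)) + 2 + (2 * p + 1) / (p - 1))"
  have I: "0 < norm (mat 1 :: complex^'d^'d)" by (rule matrix_pair_nonzero(1)[of "mat 1"]) simp
  have c1: "0 < c1" and c3: "0 < c3" unfolding c1_def c3_def using I by auto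
  define C where "C = 2 * 2 powr p * c1 * (2 powr p * c3 powr (p - 1)) * (2 powr p * p * (2 * 2 powr p') / ((p - 1) * c0))"
  have C: "0 < C" unfolding C_def using c1 c3 c0 p by (intro mult_pos_pos divide_pos_pos) auto
  show ?thesis
  proof (intro exI[of _ C] conjI C allI impI)
    fix A B :: "'a \<Rightarrow> complex^'d^'d" and N :: real and F :: "'a \<Rightarrow> ennreal"
    assume N: "1 \<le> N" and Ap: "dyadic_Ap p N A B" and [measurable]: "F \<in> borel_measurable M"
    note [measurable] = dyadic_Ap_measurable[OF Ap]
    define \<eta> where "\<eta> = (1/2) powr p' * N powr (- 1 / (p - 1))"
    have \<eta>: "0 < \<eta>" "\<eta> \<le> 1"
    proof -
      show "0 < \<eta>" unfolding \<eta>_def using N by simp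
      have "(1/2) powr p' \<le> (1::real)" using p' by (intro powr_le1) auto
      moreover have "N powr (- 1 / (p - 1)) \<le> N powr 0" using N p by (intro powr_mono) auto
      ultimately show "\<eta> \<le> 1" unfolding \<eta>_def using N by (intro mult_le_one) auto
    qed
    define \<delta> where "\<delta> = c0 * \<eta>"
    have \<delta>: "0 < \<delta>" "\<delta> \<le> 1" "(2 * \<kappa>) powr \<delta> \<le> 1 + \<eta> / 2"
      using c0 \<eta> by (auto simp: \<delta>_def mult_le_one)
    define b where "b = 1 / (p' * (1 + \<delta>))"
    have b: "0 < b" "b < 1" "(1 + \<delta>) * b = 1 / p'" "p' * ((1 + \<delta>) * b) = 1"
    proof -
      have "1 * 1 < p' * (1 + \<delta>)" using p' \<delta> by (intro mult_strict_mono) auto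
      then show "0 < b" "b < 1" by (auto simp: b_def)
      show "(1 + \<delta>) * b = 1 / p'" "p' * ((1 + \<delta>) * b) = 1" using p' \<delta> by (auto simp: b_def)
    qed
    define s where "s = 1 / (1 - b)"
    define r where "r = p * (1 - b)"
    have s: "0 < s" "s * (1 - b) = 1" "s * r = p" using b by (auto simp: s_def r_def)
    have r1: "r - 1 = (p - 1) * \<delta> / (1 + \<delta>)"
    proof -
      have "p / p' = p - 1" using p by (simp add: p'_def)
      then have "p * b = (p - 1) / (1 + \<delta>)" by (simp add: b_def flip: divide_divide_eq_left)
      then show ?thesis using \<delta> by (simp add: r_def right_diff_distrib field_simps)
    qed
    have r: "(p - 1) * \<delta> / 2 \<le> r - 1" "1 < r" "r \<le> p"
    proof -
      show "(p - 1) * \<delta> / 2 \<le> r - 1" unfolding r1 using p \<delta> by (intro divide_left_mono mult_pos_pos) auto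
      then show "1 < r" using p \<delta> mult_pos_pos[of "p - 1" \<delta>] by linarith
      show "r \<le> p" using p b by (simp add: r_def)
    qed
    define g where "g y = F y \<up> s" for y
    have [measurable]: "g \<in> borel_measurable M" unfolding g_def by measurable
    define c2 where "c2 = 2 powr p * c3 powr (p - 1) * N"
    have c2: "0 < c2" using c3 N by (simp add: c2_def)
    \<comment> \<open>On each cell \<open>w\<close> is |A P'| and \<open>h\<close> is |P B| F, with
      \<open>P\<close> the matrix that \<open>kernel_swap\<close> yields for this cell.\<close>
    have "(\<integral>\<^sup>+z. (SUP i. av i (\<lambda>y. ennreal (norm (A z ** B y)) * F y) z) \<up> p \<partial>M)
      \<le> ennreal (2 * 2 powr p * c1 * c2) * (\<integral>\<^sup>+z. dmax g z \<up> r \<partial>M)"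
    proof (rule kernel_bound)
      fix j x
      let ?U = "uniform_measure M (D j x)"
      let ?X = "\<integral>\<^sup>+z. (\<integral>\<^sup>+y. ennreal (norm (A z ** B y)) \<up> (p / (p - 1)) \<partial>?U) \<up> (p - 1) \<partial>?U"
      have X: "?X \<le> ennreal N" using Ap unfolding dyadic_Ap_def av_def by blast
      have mU: "A \<in> borel_measurable ?U" "B \<in> borel_measurable ?U" by measurable
      obtain P P' :: "complex^'d^'d" where P: "P ** P' = mat 1" "P' ** P = mat 1"
        and w: "(\<integral>\<^sup>+x. ennreal (norm (A x ** P')) \<up> p \<partial>?U) \<le> ennreal (real CARD('d) powr (2 * p + 1)) * ennreal (norm (mat 1 :: complex^'d^'d)) \<up> p"
        and h: "(\<integral>\<^sup>+y. ennreal (norm (P ** B y)) \<up> (p / (p - 1)) \<partial>?U) \<le> ennreal c3 * ?X \<up> (1 / (p - 1))"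
        using X unfolding c3_def
        by (rule_tac kernel_swap[OF mU dyadic_Ap_inverse[OF Ap] p emeasure_unif sigma_finite_unif])
           (auto intro: le_less_trans)
      let ?w = "\<lambda>z. ennreal (norm (A z ** P'))" and ?h = "\<lambda>y. ennreal (norm (P ** B y)) * F y"
      let ?\<sigma> = "\<lambda>y. ennreal (norm (P ** B y)) \<up> p'"
      have fact: "ennreal (norm (A z ** B y)) * F y \<le> ?w z * ?h y" for z y
      proof -
        have "A z ** B y = (A z ** P') ** (P ** B y)"
          using P by (metis matrix_mul_assoc matrix_mul_rid)
        then have "norm (A z ** B y) \<le> norm (A z ** P') * norm (P ** B y)"
          using norm_matrix_mult_le[of "A z ** P'" "P ** B y"] by simp
        then show ?thesis
          by (auto simp: mult.assoc[symmetric] simp flip: ennreal_mult intro!: mult_right_mono ennreal_leI)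
      qed
      have w': "av j (\<lambda>z. ?w z \<up> p) x \<le> ennreal c1"
        using w unfolding av_def c1_def by (simp add: enn_powr_ennreal ennreal_mult)
      have pos: "0 < norm (P ** B z)" for z
      proof (rule matrix_pair_nonzero(1)[where P' = "A z ** P'"])
        show "(A z ** P') ** (P ** B z) = mat 1"
          using P dyadic_Ap_inverse[OF Ap] by (metis matrix_mul_assoc matrix_mul_lid)
      qed
      have RH: "av j (\<lambda>y. ?\<sigma> y \<up> (1 + \<delta>)) x \<le> 2 * av j ?\<sigma> x \<up> (1 + \<delta>)"
      proof (rule reverse_Hoelder[where \<eta> = \<eta>])
        fix i z R assume R: "R \<in> sets M" "R \<subseteq> D i z" "ennreal (vol i) \<le> 2 * emeasure M R"
        show "ennreal \<eta> * av i ?\<sigma> z \<le> av i (\<lambda>y. ?\<sigma> y * indicator R y) z"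
          unfolding \<eta>_def p'_def
        proof (rule weight_not_concentrated[where \<rho> = "\<lambda>y. ennreal (norm (P ** B y) powr - p)"])
          show "av i (\<lambda>y. ennreal (norm (P ** B y)) \<up> (p / (p - 1))) z \<up> (p - 1) * av i (\<lambda>y. ennreal (norm (P ** B y) powr - p)) z \<le> ennreal N"
            by (rule dyadic_Ap_scalar[OF Ap p P(2)])
          show "(ennreal (norm (P ** B y)) \<up> (p / (p - 1))) \<up> (1 - 1 / p) * ennreal (norm (P ** B y) powr - p) \<up> (1 / p) = 1" for y
          proof -
            have "p / (p - 1) * (1 - 1 / p) = 1" using p by (simp add: field_simps)
            then have "(ennreal (norm (P ** B y)) \<up> (p / (p - 1))) \<up> (1 - 1 / p) = ennreal (norm (P ** B y))"
              using p by (subst enn_powr_powr) auto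
            moreover have "(norm (P ** B y) powr - p) powr (1 / p) = norm (P ** B y) powr -1"
              unfolding powr_powr using p by simp
            ultimately show ?thesis using p pos[of y]
              by (simp add: enn_powr_ennreal powr_minus flip: ennreal_mult)
          qed
        qed (use p N R in auto)
      qed (use \<eta> \<delta> kappa_ge_1 in auto)
      have "av j ?h x = (\<integral>\<^sup>+y. (?\<sigma> y \<up> (1 + \<delta>)) \<up> b * g y \<up> (1 - b) \<partial>?U)"
        unfolding av_def using b s p' \<delta> by (simp add: g_def enn_powr_powr mult.assoc)
      also have "\<dots> \<le> av j (\<lambda>y. ?\<sigma> y \<up> (1 + \<delta>)) x \<up> b * av j g x \<up> (1 - b)"
        unfolding av_def using b by (intro nn_integral_Hoelder) auto
      finally have "av j ?h x \<up> p \<le> (av j (\<lambda>y. ?\<sigma> y \<up> (1 + \<delta>)) x \<up> b * av j g x \<up> (1 - b)) \<up> p"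
        using p by (intro enn_powr_mono) auto
      also have "\<dots> = av j (\<lambda>y. ?\<sigma> y \<up> (1 + \<delta>)) x \<up> (b * p) * av j g x \<up> r"
        using p b by (simp add: enn_powr_mult enn_powr_powr r_def mult.commute)
      also have "av j (\<lambda>y. ?\<sigma> y \<up> (1 + \<delta>)) x \<up> (b * p) \<le> (2 * av j ?\<sigma> x \<up> (1 + \<delta>)) \<up> (b * p)"
        using p b RH by (intro enn_powr_mono) auto
      also have "\<dots> = ennreal (2 powr (b * p)) * av j ?\<sigma> x \<up> (p - 1)"
      proof -
        \<comment> \<open>The reverse Hoelder inequality therefore returns the mean of |P B|^p' with
          the power \<open>p - 1\<close>, the one in which it is bounded by a multiple of
          \<open>N\<close>.\<close>
        have "(1 + \<delta>) * (b * p) = p - 1" using b(3) p by (simp add: mult.assoc[symmetric] p'_def)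
        then show ?thesis
          using p b \<delta> enn_powr_ennreal[of 2 "b * p"] by (simp add: enn_powr_mult enn_powr_powr)
      qed
      also have "\<dots> \<le> ennreal (2 powr p) * ennreal (c3 powr (p - 1) * N)"
      proof (intro mult_mono ennreal_leI)
        show "2 powr (b * p) \<le> (2::real) powr p" using b p by (intro powr_mono) (auto simp: mult_le_cancel_right1)
        have "av j ?\<sigma> x \<le> ennreal c3 * ennreal N \<up> (1 / (p - 1))"
          unfolding av_def p'_def using p
          by (intro order.trans[OF h mult_left_mono[OF enn_powr_mono[OF _ X]]]) auto
        then have "av j ?\<sigma> x \<up> (p - 1) \<le> (ennreal c3 * ennreal N \<up> (1 / (p - 1))) \<up> (p - 1)"
          using p by (intro enn_powr_mono) auto
        also have "\<dots> = ennreal (c3 powr (p - 1) * N)"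
          using p c3 N by (simp add: enn_powr_mult enn_powr_powr) (simp add: enn_powr_ennreal ennreal_mult)
        finally show "av j ?\<sigma> x \<up> (p - 1) \<le> ennreal (c3 powr (p - 1) * N)" .
      qed auto
      also have "ennreal (2 powr p) * ennreal (c3 powr (p - 1) * N) = ennreal c2"
        using c3 N by (simp add: c2_def mult.assoc flip: ennreal_mult)
      finally have h': "av j ?h x \<up> p \<le> ennreal c2 * av j g x \<up> r"
        by (simp add: mult_right_mono)
      show "\<exists>w\<in>borel_measurable M. \<exists>h\<in>borel_measurable M. (\<forall>z y. ennreal (norm (A z ** B y)) * F y \<le> w z * h y) \<and>
        av j (\<lambda>z. w z \<up> p) x \<le> ennreal c1 \<and> av j h x \<up> p \<le> ennreal c2 * av j g x \<up> r"
        by (intro bexI[of _ ?w] bexI[of _ ?h] conjI allI fact w' h') measurable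
    qed (use p r c1 c2 in auto)
    then have "(\<integral>\<^sup>+z. mmax A B F z \<up> p \<partial>M) \<le> ennreal (2 * 2 powr p * c1 * c2) * (\<integral>\<^sup>+z. dmax g z \<up> r \<partial>M)"
      by (simp add: mmax_def)
    also have "\<dots> \<le> ennreal (2 * 2 powr p * c1 * c2) * (ennreal (2 powr r * r / (r - 1)) * (\<integral>\<^sup>+z. g z \<up> r \<partial>M))"
      using r by (intro mult_left_mono maximal_inequality) auto
    also have "(\<integral>\<^sup>+z. g z \<up> r \<partial>M) = (\<integral>\<^sup>+z. F z \<up> p \<partial>M)"
      using s r by (simp add: g_def enn_powr_powr)
    also have "ennreal (2 * 2 powr p * c1 * c2) * (ennreal (2 powr r * r / (r - 1)) * (\<integral>\<^sup>+z. F z \<up> p \<partial>M))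
      = ennreal (2 * 2 powr p * c1 * c2 * (2 powr r * r / (r - 1))) * (\<integral>\<^sup>+z. F z \<up> p \<partial>M)"
      using c1 c2 r by (intro ennreal_mult_left_assoc) auto
    also have "\<dots> \<le> ennreal (C * N powr (p / (p - 1))) * (\<integral>\<^sup>+z. F z \<up> p \<partial>M)"
    proof (intro mult_right_mono ennreal_leI)
      \<comment> \<open>Here the small gain is paid for: 1/(r-1) is at most 2/((p-1) \<delta>), and
        \<open>\<delta>\<close> is a fixed multiple of N^(-1/(p-1)).\<close>
      have "2 powr r * r / (r - 1) \<le> 2 powr p * p / ((p - 1) * \<delta> / 2)"
        using r p \<delta> by (intro frac_le mult_mono powr_mono) auto
      also have "\<dots> = 2 powr p * p * 2 / ((p - 1) * c0) * (1 / \<eta>)"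
        using p c0 \<eta> by (simp add: \<delta>_def field_simps)
      also have "1 / \<eta> = 2 powr p' * N powr (1 / (p - 1))"
        using N by (simp add: \<eta>_def powr_divide powr_minus field_simps)
      finally have le: "2 powr r * r / (r - 1) \<le> 2 powr p * p * 2 / ((p - 1) * c0) * (2 powr p' * N powr (1 / (p - 1)))" .
      have "2 * 2 powr p * c1 * c2 * (2 powr r * r / (r - 1)) \<le> 2 * 2 powr p * c1 * c2 * (2 powr p * p * 2 / ((p - 1) * c0) * (2 powr p' * N powr (1 / (p - 1))))"
        using c1 c2 by (intro mult_left_mono le) auto
      also have "\<dots> = C * (N powr 1 * N powr (1 / (p - 1)))"
        using N by (simp add: C_def c2_def)
      also have "N powr 1 * N powr (1 / (p - 1)) = N powr (1 + 1 / (p - 1))"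
        by (rule powr_add[symmetric])
      also have "1 + 1 / (p - 1) = p / (p - 1)" using p by (simp add: field_simps)
      finally show "2 * 2 powr p * c1 * c2 * (2 powr r * r / (r - 1)) \<le> C * N powr (p / (p - 1))" .
    qed simp
    finally show "(\<integral>\<^sup>+x. mmax A B F x \<up> p \<partial>M) \<le> ennreal (C * N powr (p / (p - 1))) * (\<integral>\<^sup>+x. F x \<up> p \<partial>M)" .
  qed
qed

text \<open>The last estimate of \<open>kernel_swap\<close> read with the exponent p': since p' - 1
  = 1/(p-1) and the conjugate of p' is p, the exchanged integral is the characteristic of the
  transposed pair.\<close>

lemma dyadic_Ap_dual:
  fixes A B :: "'a \<Rightarrow> complex^'d^'d"
  assumes Ap: "dyadic_Ap p N A B" and p: "1 < p" and N: "0 \<le> N"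
  shows "dyadic_Ap (p / (p - 1)) (real CARD('d) powr (4 * (p / (p - 1)) + 2 + 2 * ((2 * p + 1) / (p - 1))) * N powr (1 / (p - 1)))
    (\<lambda>x. transpose (B x)) (\<lambda>x. transpose (A x))"
  unfolding dyadic_Ap_def
proof (intro conjI allI)
  note [measurable] = dyadic_Ap_measurable[OF Ap]
  note inv = dyadic_Ap_inverse[OF Ap]
  show "(\<lambda>x. transpose (B x)) \<in> borel_measurable M" "(\<lambda>x. transpose (A x)) \<in> borel_measurable M" by measurable
  show "transpose (B x) ** transpose (A x) = mat 1" "transpose (A x) ** transpose (B x) = mat 1" for x
    using inv[of x] by (metis matrix_transpose_mul transpose_mat)+
  fix j x
  let ?U = "uniform_measure M (D j x)"
  let ?X = "\<integral>\<^sup>+z. (\<integral>\<^sup>+y. ennreal (norm (A z ** B y)) \<up> (p / (p - 1)) \<partial>?U) \<up> (p - 1) \<partial>?U"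
  have X: "?X \<le> ennreal N" using Ap unfolding dyadic_Ap_def av_def by blast
  have mU: "A \<in> borel_measurable ?U" "B \<in> borel_measurable ?U" by measurable
  have e: "p / (p - 1) - 1 = 1 / (p - 1)" "p / (p - 1) / (1 / (p - 1)) = p"
    using p by (auto simp: field_simps)
  have tr: "norm (transpose (B z) ** transpose (A y)) = norm (A y ** B z)" for y z
    by (metis matrix_transpose_mul norm_transpose)
  let ?c = "real CARD('d) powr (4 * (p / (p - 1)) + 2 + 2 * ((2 * p + 1) / (p - 1)))"
  have "(\<integral>\<^sup>+y. (\<integral>\<^sup>+x. ennreal (norm (A x ** B y)) \<up> p \<partial>?U) \<up> (1 / (p - 1)) \<partial>?U) \<le> ennreal ?c * ?X \<up> (1 / (p - 1))"
    using X by (rule_tac kernel_swap[OF mU inv p emeasure_unif sigma_finite_unif]) (auto intro: le_less_trans)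
  also have "\<dots> \<le> ennreal ?c * ennreal N \<up> (1 / (p - 1))"
    using p X by (intro mult_left_mono enn_powr_mono) auto
  also have "\<dots> = ennreal (?c * N powr (1 / (p - 1)))"
    using N by (simp add: enn_powr_ennreal ennreal_mult)
  finally show "av j (\<lambda>z. av j (\<lambda>y. ennreal (norm (transpose (B z) ** transpose (A y))) \<up> (p / (p - 1) / (p / (p - 1) - 1))) x \<up> (p / (p - 1) - 1)) x
    \<le> ennreal (?c * N powr (1 / (p - 1)))"
    unfolding e tr av_def .
qed

end

subsection \<open>Vector-valued inequalities\<close>

lemma ennreal_mult_right_le_cancel: "c \<noteq> 0 \<Longrightarrow> c \<noteq> top \<Longrightarrow> a * c \<le> b * c \<longleftrightarrow> a \<le> (b :: ennreal)"
  using ennreal_mult_le_mult_iff[of c a b] by (simp add: mult.commute)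

context dyadic_filtration
begin

lemma mmax_mono_AE:
  assumes "AE y in M. F y \<le> G y"
  shows "mmax A B F x \<le> mmax A B G x"
  unfolding mmax_def av_def
proof (rule SUP_mono')
  fix i
  have "AE y in M. y \<in> D i x \<longrightarrow> ennreal (norm (A x ** B y)) * F y \<le> ennreal (norm (A x ** B y)) * G y"
    using assms by eventually_elim (auto intro: mult_left_mono)
  then show "(\<integral>\<^sup>+y. ennreal (norm (A x ** B y)) * F y \<partial>uniform_measure M (D i x))
    \<le> (\<integral>\<^sup>+y. ennreal (norm (A x ** B y)) * G y \<partial>uniform_measure M (D i x))"
    by (intro nn_integral_mono_AE AE_uniform_measureI) auto
qed

text \<open>A positive kernel splits as k^a k^(1-a), so Hoelder's inequality holds for each average
  and passes to the supremum. It takes the place of an interpolation theorem.\<close>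

lemma mmax_Hoelder:
  fixes A B :: "'a \<Rightarrow> complex^'d^'d"
  assumes [measurable]: "B \<in> borel_measurable M" "G \<in> borel_measurable M" "H \<in> borel_measurable M"
    and a: "0 < a" "a < 1"
  shows "mmax A B (\<lambda>y. G y \<up> a * H y \<up> (1 - a)) x \<le> mmax A B G x \<up> a * mmax A B H x \<up> (1 - a)"
  unfolding mmax_def[of A B "\<lambda>y. G y \<up> a * H y \<up> (1 - a)"]
proof (rule SUP_least)
  fix i
  let ?k = "\<lambda>y. ennreal (norm (A x ** B y))"
  have "?k y * (G y \<up> a * H y \<up> (1 - a)) = (?k y * G y) \<up> a * (?k y * H y) \<up> (1 - a)" for y
  proof -
    have "?k y = ?k y \<up> (a + (1 - a))" by simp
    then have "?k y = ?k y \<up> a * ?k y \<up> (1 - a)" by (simp only: enn_powr_add)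
    then show ?thesis using a by (simp add: enn_powr_mult mult_ac)
  qed
  then have "av i (\<lambda>y. ?k y * (G y \<up> a * H y \<up> (1 - a))) x \<le> av i (\<lambda>y. ?k y * G y) x \<up> a * av i (\<lambda>y. ?k y * H y) x \<up> (1 - a)"
    unfolding av_def using a by (simp only:) (intro nn_integral_Hoelder, auto)
  also have "\<dots> \<le> mmax A B G x \<up> a * mmax A B H x \<up> (1 - a)"
    unfolding mmax_def using a by (intro mult_mono enn_powr_mono SUP_upper) auto
  finally show "av i (\<lambda>y. ?k y * (G y \<up> a * H y \<up> (1 - a))) x \<le> mmax A B G x \<up> a * mmax A B H x \<up> (1 - a)" .
qed

lemma mmax_suminf:
  fixes A B :: "'a \<Rightarrow> complex^'d^'d"
  assumes [measurable]: "B \<in> borel_measurable M" "\<And>k. f k \<in> borel_measurable M"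
  shows "mmax A B (\<lambda>y. \<Sum>k. f k y) x \<le> (\<Sum>k. mmax A B (f k) x)"
  unfolding mmax_def[of A B "\<lambda>y. \<Sum>k. f k y"]
proof (rule SUP_least)
  fix i
  have "av i (\<lambda>y. ennreal (norm (A x ** B y)) * (\<Sum>k. f k y)) x = (\<Sum>k. av i (\<lambda>y. ennreal (norm (A x ** B y)) * f k y) x)"
    unfolding av_def ennreal_suminf_cmult[symmetric] by (rule nn_integral_suminf) measurable
  also have "\<dots> \<le> (\<Sum>k. mmax A B (f k) x)"
    unfolding mmax_def by (intro suminf_le SUP_upper) auto
  finally show "av i (\<lambda>y. ennreal (norm (A x ** B y)) * (\<Sum>k. f k y)) x \<le> (\<Sum>k. mmax A B (f k) x)" .
qed

lemma mmax_cmult: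
  fixes A B :: "'a \<Rightarrow> complex^'d^'d"
  assumes [measurable]: "B \<in> borel_measurable M" "f \<in> borel_measurable M"
  shows "mmax A B (\<lambda>y. c * f y) x = c * mmax A B f x"
proof -
  have "av i (\<lambda>y. ennreal (norm (A x ** B y)) * (c * f y)) x = c * av i (\<lambda>y. ennreal (norm (A x ** B y)) * f y) x" for i
    by (subst av_cmult[symmetric]) (auto simp: mult.left_commute)
  then show ?thesis by (simp add: mmax_def SUP_mult_left_ennreal)
qed

text \<open>For \<open>q \<ge> p\<close> one interpolates between \<open>\<ell>\<^sup>p\<close>, which is the scalar bound summed up, and \<open>\<ell>\<^sup>\<infinity>\<close>, where
  positivity gives the bound for free.\<close>

theorem vector_valued_bound_ge:
  fixes p q :: real
  assumes p: "1 < p" and q: "p \<le> q"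
  shows "\<exists>C>0. \<forall>(A :: 'a \<Rightarrow> complex^'d^'d) B N F. 1 \<le> N \<longrightarrow> dyadic_Ap p N A B \<longrightarrow> (\<forall>k::nat. F k \<in> borel_measurable M) \<longrightarrow>
    (\<integral>\<^sup>+x. (\<Sum>k. mmax A B (F k) x \<up> q) \<up> (p / q) \<partial>M) \<le> ennreal (C * N powr (p / (p - 1))) * (\<integral>\<^sup>+x. (\<Sum>k. F k x \<up> q) \<up> (p / q) \<partial>M)"
proof -
  obtain C where C: "0 < C" and bd: "\<And>(A :: 'a \<Rightarrow> complex^'d^'d) B N F. 1 \<le> N \<Longrightarrow> dyadic_Ap p N A B \<Longrightarrow> F \<in> borel_measurable M \<Longrightarrow>
    (\<integral>\<^sup>+x. mmax A B F x \<up> p \<partial>M) \<le> ennreal (C * N powr (p / (p - 1))) * (\<integral>\<^sup>+x. F x \<up> p \<partial>M)"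
    using matrix_maximal_bound[OF p, where 'd = 'd] by blast
  show ?thesis
  proof (intro exI[of _ C] conjI C allI impI)
    fix A B :: "'a \<Rightarrow> complex^'d^'d" and N :: real and F :: "nat \<Rightarrow> 'a \<Rightarrow> ennreal"
    assume N: "1 \<le> N" and Ap: "dyadic_Ap p N A B" and F: "\<forall>k. F k \<in> borel_measurable M"
    have [measurable]: "F k \<in> borel_measurable M" for k using F by blast
    note AB [measurable] = dyadic_Ap_measurable[OF Ap]
    note mm [measurable] = borel_measurable_mmax[OF AB]
    let ?K = "ennreal (C * N powr (p / (p - 1)))"
    have sumbd: "(\<integral>\<^sup>+x. (\<Sum>k. mmax A B (G k) x \<up> p) \<partial>M) \<le> ?K * (\<integral>\<^sup>+x. (\<Sum>k. G k x \<up> p) \<partial>M)"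
      if [measurable]: "\<And>k. G k \<in> borel_measurable M" for G :: "nat \<Rightarrow> 'a \<Rightarrow> ennreal"
    proof -
      have "(\<integral>\<^sup>+x. (\<Sum>k. mmax A B (G k) x \<up> p) \<partial>M) = (\<Sum>k. \<integral>\<^sup>+x. mmax A B (G k) x \<up> p \<partial>M)"
        by (rule nn_integral_suminf) measurable
      also have "\<dots> \<le> (\<Sum>k. ?K * (\<integral>\<^sup>+x. G k x \<up> p \<partial>M))"
        by (intro suminf_le bd N Ap) auto
      also have "\<dots> = ?K * (\<Sum>k. \<integral>\<^sup>+x. G k x \<up> p \<partial>M)"
        by (rule ennreal_suminf_cmult)
      also have "(\<Sum>k. \<integral>\<^sup>+x. G k x \<up> p \<partial>M) = (\<integral>\<^sup>+x. (\<Sum>k. G k x \<up> p) \<partial>M)"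
        by (rule nn_integral_suminf[symmetric]) measurable
      finally show ?thesis .
    qed
    show "(\<integral>\<^sup>+x. (\<Sum>k. mmax A B (F k) x \<up> q) \<up> (p / q) \<partial>M) \<le> ?K * (\<integral>\<^sup>+x. (\<Sum>k. F k x \<up> q) \<up> (p / q) \<partial>M)"
    \<comment> \<open>If the right side is infinite there is nothing to prove; otherwise
      \<open>H\<close> below is finite almost everywhere and may be divided by.\<close>
    proof (cases "p = q \<or> (\<integral>\<^sup>+x. (\<Sum>k. F k x \<up> q) \<up> (p / q) \<partial>M) = top")
      case True
      then show ?thesis
        using sumbd[of F] p C N by (auto simp: ennreal_mult_top)
    next
      case False
      define a where "a = p / q"
      have pq: "p < q" using False q by auto
      have a: "0 < a" "a < 1" "a * q = p" "p * (1 - a) = a * (q - p)" using p pq by (auto simp: a_def field_simps)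
      define H where "H x = (\<Sum>k. F k x \<up> q) \<up> (1 / q)" for x
      have [measurable]: "H \<in> borel_measurable M" unfolding H_def by measurable
      have Hp: "H x \<up> p = (\<Sum>k. F k x \<up> q) \<up> (p / q)" for x
        unfolding H_def using p pq by (subst enn_powr_powr) auto
      have fin: "AE x in M. H x \<noteq> top"
      proof -
        have "(\<integral>\<^sup>+x. H x \<up> p \<partial>M) \<noteq> \<infinity>" using False by (simp add: Hp)
        then have "AE x in M. H x \<up> p \<noteq> \<infinity>" by (intro nn_integral_PInf_AE) auto
        then show ?thesis by simp
      qed
      \<comment> \<open>Forced by two requirements: \<open>F k\<close> is \<open>G k\<close> to the
        power \<open>a\<close> times \<open>H\<close> to the power \<open>1 - a\<close>, and the
        p-th powers of the \<open>G k\<close> sum to at most that of \<open>H\<close>. The family is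
        thereby factored into one in l^p and a common majorant.\<close>
      define G where "G k y = F k y \<up> (1 / a) / H y \<up> (1 / a - 1)" for k y
      have [measurable]: "G k \<in> borel_measurable M" for k unfolding G_def by measurable
      have F0: "F k y = 0" if "H y = 0" for k y
        using that unfolding H_def by (simp add: suminf_eq_zero_iff)
      have FG: "F k y = G k y \<up> a * H y \<up> (1 - a)" if "H y \<noteq> top" for k y
      proof (cases "H y = 0")
        case True
        then show ?thesis using F0 a by (simp add: G_def)
      next
        case False
        let ?h = "H y \<up> (1 / a - 1)"
        have h: "?h \<noteq> 0" "?h \<noteq> top" using False that by auto
        have "G k y * ?h = F k y \<up> (1 / a)"
          using h by (simp add: G_def ennreal_divide_times ennreal_divide_self less_top)
        then have "(G k y * ?h) \<up> a = F k y"
          using a by (simp add: enn_powr_powr)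
        moreover have "?h \<up> a = H y \<up> (1 - a)"
          using a by (subst enn_powr_powr) (auto simp: left_diff_distrib)
        ultimately show ?thesis using a by (simp add: enn_powr_mult)
      qed
      have GH: "(\<Sum>k. G k y \<up> p) \<le> H y \<up> p" if "H y \<noteq> top" for y
      proof (cases "H y = 0")
        case True
        then show ?thesis using F0 a by (simp add: G_def)
      next
        case False
        have h: "H y \<up> (q - p) \<noteq> 0" "H y \<up> (q - p) \<noteq> top" using False that by auto
        have "G k y \<up> p * H y \<up> (q - p) = F k y \<up> q" for k
        proof -
          have "F k y \<up> q = (G k y \<up> a * H y \<up> (1 - a)) \<up> q" using FG[OF that] by metis
          also have "\<dots> = G k y \<up> p * H y \<up> ((1 - a) * q)"
            using a p pq by (simp add: enn_powr_mult enn_powr_powr)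
          also have "(1 - a) * q = q - p" using a by (simp add: left_diff_distrib)
          finally show ?thesis by simp
        qed
        then have "(\<Sum>k. G k y \<up> p) * H y \<up> (q - p) = (\<Sum>k. F k y \<up> q)"
          by (simp flip: ennreal_suminf_multc)
        also have "\<dots> = H y \<up> q" unfolding H_def using p pq by (simp add: enn_powr_powr)
        also have "\<dots> = H y \<up> p * H y \<up> (q - p)" by (simp flip: enn_powr_add)
        finally have "(\<Sum>k. G k y \<up> p) * H y \<up> (q - p) \<le> H y \<up> p * H y \<up> (q - p)" by simp
        then show ?thesis using h ennreal_mult_right_le_cancel by blast
      qed
      \<comment> \<open>The second factor does not depend on \<open>k\<close>, so the sum over
        \<open>k\<close> involves only the \<open>G k\<close>.\<close>
      have key: "mmax A B (F k) x \<up> q \<le> mmax A B (G k) x \<up> p * mmax A B H x \<up> (q - p)" for k x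
      proof -
        have "mmax A B (F k) x \<le> mmax A B (\<lambda>y. G k y \<up> a * H y \<up> (1 - a)) x"
        proof (rule mmax_mono_AE)
          show "AE y in M. F k y \<le> G k y \<up> a * H y \<up> (1 - a)"
            using fin by eventually_elim (simp flip: FG)
        qed
        also have "\<dots> \<le> mmax A B (G k) x \<up> a * mmax A B H x \<up> (1 - a)"
          using a by (intro mmax_Hoelder) auto
        finally have "mmax A B (F k) x \<up> q \<le> (mmax A B (G k) x \<up> a * mmax A B H x \<up> (1 - a)) \<up> q"
          using p pq by (intro enn_powr_mono) auto
        also have "\<dots> = mmax A B (G k) x \<up> p * mmax A B H x \<up> ((1 - a) * q)"
          using a p pq by (simp add: enn_powr_mult enn_powr_powr)
        also have "(1 - a) * q = q - p" using a by (simp add: left_diff_distrib)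
        finally show ?thesis .
      qed
      have "(\<integral>\<^sup>+x. (\<Sum>k. mmax A B (F k) x \<up> q) \<up> a \<partial>M) \<le> (\<integral>\<^sup>+x. (\<Sum>k. mmax A B (G k) x \<up> p) \<up> a * (mmax A B H x \<up> p) \<up> (1 - a) \<partial>M)"
      proof (rule nn_integral_mono)
        fix x
        have "(\<Sum>k. mmax A B (F k) x \<up> q) \<le> (\<Sum>k. mmax A B (G k) x \<up> p * mmax A B H x \<up> (q - p))"
          by (intro suminf_le key) auto
        then have "(\<Sum>k. mmax A B (F k) x \<up> q) \<up> a \<le> ((\<Sum>k. mmax A B (G k) x \<up> p) * mmax A B H x \<up> (q - p)) \<up> a"
          using a by (intro enn_powr_mono) (auto simp: ennreal_suminf_multc)
        also have "\<dots> = (\<Sum>k. mmax A B (G k) x \<up> p) \<up> a * (mmax A B H x \<up> p) \<up> (1 - a)"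
          using a p pq by (simp add: enn_powr_mult enn_powr_powr mult.commute)
        finally show "(\<Sum>k. mmax A B (F k) x \<up> q) \<up> a \<le> (\<Sum>k. mmax A B (G k) x \<up> p) \<up> a * (mmax A B H x \<up> p) \<up> (1 - a)" .
      qed
      also have "\<dots> \<le> (\<integral>\<^sup>+x. (\<Sum>k. mmax A B (G k) x \<up> p) \<partial>M) \<up> a * (\<integral>\<^sup>+x. mmax A B H x \<up> p \<partial>M) \<up> (1 - a)"
        using a by (intro nn_integral_Hoelder) auto
      \<comment> \<open>Both factors have the same bound and their exponents add up to 1, so neither
        a constant nor a power of \<open>N\<close> is lost.\<close>
      also have "\<dots> \<le> (?K * (\<integral>\<^sup>+x. H x \<up> p \<partial>M)) \<up> a * (?K * (\<integral>\<^sup>+x. H x \<up> p \<partial>M)) \<up> (1 - a)"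
      proof (intro mult_mono enn_powr_mono)
        have "(\<integral>\<^sup>+x. (\<Sum>k. mmax A B (G k) x \<up> p) \<partial>M) \<le> ?K * (\<integral>\<^sup>+x. (\<Sum>k. G k x \<up> p) \<partial>M)"
          by (rule sumbd) measurable
        also have "\<dots> \<le> ?K * (\<integral>\<^sup>+x. H x \<up> p \<partial>M)"
        proof (intro mult_left_mono nn_integral_mono_AE)
          show "AE x in M. (\<Sum>k. G k x \<up> p) \<le> H x \<up> p"
            using fin by eventually_elim (rule GH)
        qed simp
        finally show "(\<integral>\<^sup>+x. (\<Sum>k. mmax A B (G k) x \<up> p) \<partial>M) \<le> ?K * (\<integral>\<^sup>+x. H x \<up> p \<partial>M)" .
        show "(\<integral>\<^sup>+x. mmax A B H x \<up> p \<partial>M) \<le> ?K * (\<integral>\<^sup>+x. H x \<up> p \<partial>M)"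
          by (intro bd N Ap) measurable
      qed (use a in auto)
      also have "\<dots> = ?K * (\<integral>\<^sup>+x. H x \<up> p \<partial>M)"
        by (simp flip: enn_powr_add)
      finally show ?thesis by (simp add: Hp a_def)
    qed
  qed
qed

text \<open>The majorant is the sum of 2^(-k) T^k \<psi> / c^k, where T is the maximal operator and
  \<open>c\<close> bounds its norm. Applying T shifts the series by one term, which costs the factor
  \<open>2 * c\<close>.\<close>

lemma rubio_de_francia:
  fixes A B :: "'a \<Rightarrow> complex^'d^'d"
  assumes [measurable]: "A \<in> borel_measurable M" "B \<in> borel_measurable M" "\<psi> \<in> borel_measurable M"
    and c: "0 < c" and r: "1 < r"
    and bd: "\<And>f. f \<in> borel_measurable M \<Longrightarrow> (\<integral>\<^sup>+x. mmax A B f x \<up> r \<partial>M) \<le> ennreal (c powr r) * (\<integral>\<^sup>+x. f x \<up> r \<partial>M)"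
  obtains \<phi> where "\<phi> \<in> borel_measurable M" "\<And>x. \<psi> x \<le> \<phi> x" "\<And>x. mmax A B \<phi> x \<le> ennreal (2 * c) * \<phi> x"
    "(\<integral>\<^sup>+x. \<phi> x \<up> r \<partial>M) \<le> ennreal (2 powr r) * (\<integral>\<^sup>+x. \<psi> x \<up> r \<partial>M)"
proof -
  note mm [measurable] = borel_measurable_mmax[OF assms(1,2)]
  define s where "s = rec_nat \<psi> (\<lambda>_ f x. ennreal (1 / c) * mmax A B f x)"
  have s0: "s 0 = \<psi>" and sS: "s (Suc k) = (\<lambda>x. ennreal (1 / c) * mmax A B (s k) x)" for k
    by (auto simp: s_def)
  have s [measurable]: "s k \<in> borel_measurable M" for k
    by (induction k) (auto simp: s0 sS)
  have inv: "ennreal c * (ennreal (1 / c) * t) = t" for t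
    using c ennreal_mult_left_assoc[of c "1/c" t] by simp
  have sbd: "(\<integral>\<^sup>+x. s k x \<up> r \<partial>M) \<le> (\<integral>\<^sup>+x. \<psi> x \<up> r \<partial>M)" for k
  proof (induction k)
    case (Suc k)
    have "(\<integral>\<^sup>+x. s (Suc k) x \<up> r \<partial>M) = ennreal ((1 / c) powr r) * (\<integral>\<^sup>+x. mmax A B (s k) x \<up> r \<partial>M)"
      using r c by (simp add: sS enn_powr_mult nn_integral_cmult) (simp add: enn_powr_ennreal)
    also have "\<dots> \<le> ennreal ((1 / c) powr r) * (ennreal (c powr r) * (\<integral>\<^sup>+x. s k x \<up> r \<partial>M))"
      by (intro mult_left_mono bd) auto
    also have "\<dots> = (\<integral>\<^sup>+x. s k x \<up> r \<partial>M)"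
      using c by (simp add: ennreal_mult_left_assoc flip: powr_mult)
    finally show ?case using Suc by simp
  qed (simp add: s0)
  let ?e = "\<lambda>k::nat. ennreal ((1/2) ^ k)"
  define \<phi> where "\<phi> x = (\<Sum>k. ?e k * s k x)" for x
  have [measurable]: "\<phi> \<in> borel_measurable M" unfolding \<phi>_def by measurable
  have sumbd: "(\<Sum>k\<in>I. g k) \<le> (\<Sum>k. g k)" if "finite I" for I and g :: "nat \<Rightarrow> ennreal"
    using that by (intro sum_le_suminf) auto
  have "\<psi> x \<le> \<phi> x" for x
    using sumbd[of "{0}" "\<lambda>k. ?e k * s k x"] by (simp add: \<phi>_def s0)
  moreover have "mmax A B \<phi> x \<le> ennreal (2 * c) * \<phi> x" for x
  proof -
    have "mmax A B \<phi> x \<le> (\<Sum>k. mmax A B (\<lambda>y. ?e k * s k y) x)"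
      unfolding \<phi>_def[abs_def] by (rule mmax_suminf) measurable
    also have "\<dots> = (\<Sum>k. ennreal (2 * c) * (?e (Suc k) * s (Suc k) x))"
    proof (rule suminf_cong)
      fix k
      have "mmax A B (\<lambda>y. ?e k * s k y) x = ?e k * (ennreal c * s (Suc k) x)"
        by (subst mmax_cmult) (auto simp: sS inv)
      also have "\<dots> = ennreal ((1/2) ^ k * c) * s (Suc k) x"
        using c by (intro ennreal_mult_left_assoc) auto
      also have "(1/2) ^ k * c = 2 * c * (1/2) ^ Suc k" by simp
      also have "ennreal (2 * c * (1/2) ^ Suc k) * s (Suc k) x = ennreal (2 * c) * (?e (Suc k) * s (Suc k) x)"
        using c by (intro ennreal_mult_left_assoc[symmetric]) auto
      finally show "mmax A B (\<lambda>y. ?e k * s k y) x = ennreal (2 * c) * (?e (Suc k) * s (Suc k) x)" .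
    qed
    also have "\<dots> = ennreal (2 * c) * (\<Sum>k. ?e (Suc k) * s (Suc k) x)"
      by (rule ennreal_suminf_cmult)
    also have "(\<Sum>k. ?e (Suc k) * s (Suc k) x) \<le> \<phi> x"
      unfolding \<phi>_def using suminf_offset[of "\<lambda>k. ?e k * s k x" 1] by (simp add: add_increasing)
    finally show ?thesis by (simp add: mult_left_mono)
  qed
  moreover have "(\<integral>\<^sup>+x. \<phi> x \<up> r \<partial>M) \<le> ennreal (2 powr r) * (\<integral>\<^sup>+x. \<psi> x \<up> r \<partial>M)"
  proof -
    \<comment> \<open>The weights 2^(-k-1) form a probability measure on the naturals, so Jensen's
      inequality replaces the triangle inequality for the infinite series. They are half of the
      original weights, whence \<open>2 powr r\<close>.\<close>
    let ?m = "density (count_space UNIV) (\<lambda>k. ?e (Suc k))"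
    have "(\<lambda>k. (1/2 :: real) ^ Suc k) sums 1" by (rule power_half_series)
    then have one: "(\<Sum>k. ?e (Suc k)) = 1"
      by (subst suminf_ennreal2) (auto simp: sums_iff)
    have int: "(\<integral>\<^sup>+k. g k \<partial>?m) = (\<Sum>k. ?e (Suc k) * g k)" for g
      by (simp add: nn_integral_density nn_integral_count_space_nat)
    have "emeasure ?m (space ?m) = 1"
      using int[of "\<lambda>_. 1"] one by (simp add: nn_integral_count_space_nat)
    then have J: "(\<Sum>k. ?e (Suc k) * g k) \<up> r \<le> (\<Sum>k. ?e (Suc k) * g k \<up> r)" for g
      unfolding int[symmetric] using r by (intro nn_integral_Jensen_powr) auto
    have half: "\<phi> x = 2 * (\<Sum>k. ?e (Suc k) * s k x)" for x
    proof -
      have "?e k * s k x = 2 * (?e (Suc k) * s k x)" for k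
        using ennreal_mult_left_assoc[of 2 "(1/2) ^ Suc k" "s k x"] by simp
      then show ?thesis by (simp add: \<phi>_def ennreal_suminf_cmult)
    qed
    have "(\<integral>\<^sup>+x. \<phi> x \<up> r \<partial>M) \<le> (\<integral>\<^sup>+x. ennreal (2 powr r) * (\<Sum>k. ?e (Suc k) * s k x \<up> r) \<partial>M)"
    proof (rule nn_integral_mono)
      fix x
      have "\<phi> x \<up> r = ennreal (2 powr r) * (\<Sum>k. ?e (Suc k) * s k x) \<up> r"
        unfolding half using r enn_powr_ennreal[of 2 r] by (simp add: enn_powr_mult)
      then show "\<phi> x \<up> r \<le> ennreal (2 powr r) * (\<Sum>k. ?e (Suc k) * s k x \<up> r)"
        using J[of "\<lambda>k. s k x"] by (simp add: mult_left_mono)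
    qed
    also have "\<dots> = ennreal (2 powr r) * (\<Sum>k. ?e (Suc k) * (\<integral>\<^sup>+x. s k x \<up> r \<partial>M))"
      by (simp add: nn_integral_cmult nn_integral_suminf)
    also have "\<dots> \<le> ennreal (2 powr r) * (\<Sum>k. ?e (Suc k) * (\<integral>\<^sup>+x. \<psi> x \<up> r \<partial>M))"
      by (intro mult_left_mono suminf_le sbd) auto
    also have "\<dots> = ennreal (2 powr r) * (\<integral>\<^sup>+x. \<psi> x \<up> r \<partial>M)"
      unfolding ennreal_suminf_multc one by simp
    finally show ?thesis .
  qed
  ultimately show ?thesis by (intro that) auto
qed

text \<open>If \<open>f\<close> is essentially an \<open>A\<^sub>1\<close> weight for the transposed kernel, then \<open>f\<^sup>\<theta> W\<^sup>q\<^sup>/\<^sup>p\<close> is an \<open>A\<^sub>q\<close> weight. The reducing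
  matrix of \<open>v \<mapsto> \<integral> \<bar>A v\<bar> f\<close> makes the scalar argument work.\<close>

lemma dyadic_Ap_extrapolate:
  fixes A B :: "'a \<Rightarrow> complex^'d^'d" and f :: "'a \<Rightarrow> real"
  assumes Ap: "dyadic_Ap p N A B" and pq: "1 < q" "q < p" and N: "0 \<le> N" and c: "0 < c"
    and f [measurable]: "f \<in> borel_measurable M" and fpos: "\<And>x. 0 < f x"
    and A1: "AE z in M. \<forall>j. av j (\<lambda>y. ennreal (norm (A y ** B z)) * ennreal (f y)) z \<le> ennreal (c * f z)"
  defines "\<theta> \<equiv> (p - q) / (p - 1)" and "\<gamma> \<equiv> \<lambda>x. f x powr ((p - q) / (p - 1) / q)"
  shows "dyadic_Ap q ((real CARD('d) powr 3 * real CARD('d) powr 3 * c * norm (mat 1 :: complex^'d^'d)) powr \<theta> * N powr (1 - \<theta>))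
    (\<lambda>x. \<gamma> x *\<^sub>R A x) (\<lambda>x. (1 / \<gamma> x) *\<^sub>R B x)"
  unfolding dyadic_Ap_def
proof (intro conjI allI)
  note [measurable] = dyadic_Ap_measurable[OF Ap]
  note inv = dyadic_Ap_inverse[OF Ap]
  have \<gamma> [measurable]: "\<gamma> \<in> borel_measurable M" unfolding \<gamma>_def by measurable
  have \<gamma>pos: "0 < \<gamma> x" for x using fpos[of x] by (simp add: \<gamma>_def)
  show "(\<lambda>x. \<gamma> x *\<^sub>R A x) \<in> borel_measurable M" "(\<lambda>x. (1 / \<gamma> x) *\<^sub>R B x) \<in> borel_measurable M" by measurable
  have sc: "(a *\<^sub>R X) ** (b *\<^sub>R Y) = (a * b) *\<^sub>R (X ** Y)" for a b and X Y :: "complex^'d^'d"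
    by (simp add: vec_eq_iff matrix_matrix_mult_def scaleR_sum_right mult.commute)
  show "\<gamma> x *\<^sub>R A x ** (1 / \<gamma> x) *\<^sub>R B x = mat 1" "(1 / \<gamma> x) *\<^sub>R B x ** \<gamma> x *\<^sub>R A x = mat 1" for x
    using \<gamma>pos[of x] inv by (auto simp: sc)
  \<comment> \<open>The surplus of the conjugate exponents, q' = p' + \<tau>. The part p' of the
    power of the kernel is left to the given characteristic; the part \<tau> is estimated through
    the reducing matrix.\<close>
  define \<tau> where "\<tau> = \<theta> / (q - 1)"
  have \<theta>: "0 < \<theta>" "\<theta> < 1" "(q - 1) = (1 - \<theta>) * (p - 1)" and \<tau>: "0 < \<tau>" "\<tau> * (q - 1) = \<theta>" "p / (p - 1) + \<tau> = q / (q - 1)"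
    and \<tau>2: "\<theta> / q * (q / (q - 1)) = \<tau>"
  proof -
    show "0 < \<theta>" "\<theta> < 1" using pq by (auto simp: \<theta>_def)
    then show "0 < \<tau>" "\<tau> * (q - 1) = \<theta>" "\<theta> / q * (q / (q - 1)) = \<tau>" using pq by (auto simp: \<tau>_def)
    have *: "(p - 1) * \<theta> = p - q" using pq by (simp add: \<theta>_def)
    then show "(q - 1) = (1 - \<theta>) * (p - 1)" by (simp add: left_diff_distrib mult.commute)
    have "p / (p - 1) = 1 + 1 / (p - 1)" "q / (q - 1) = 1 + 1 / (q - 1)" using pq by (auto simp: field_simps)
    moreover have "\<tau> = 1 / (q - 1) - 1 / (p - 1)"
      using pq by (simp add: \<tau>_def \<theta>_def field_simps)
    ultimately show "p / (p - 1) + \<tau> = q / (q - 1)" by simp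
  qed
  fix j x
  let ?U = "uniform_measure M (D j x)"
  define k1 where "k1 = real CARD('d) powr (2 * 1 + 1)"
  have k1: "0 < k1" by (simp add: k1_def)
  \<comment> \<open>The normalised cell measure weighted by \<open>f\<close>. The reducing matrix
    \<open>R\<close> is taken in its L^1, so \<open>k1\<close> is the constant of
    \<open>reducing_matrix\<close> for exponent 1.\<close>
  define L where "L = density ?U (\<lambda>x. ennreal (f x))"
  have Lint: "(\<integral>\<^sup>+y. g y \<partial>L) = av j (\<lambda>y. ennreal (f y) * g y) x" if "g \<in> borel_measurable M" for g
    unfolding L_def av_def using that by (subst nn_integral_density) auto
  have AE_U: "AE z in ?U. z \<in> D j x \<and> (\<forall>j. av j (\<lambda>y. ennreal (norm (A y ** B z)) * ennreal (f y)) z \<le> ennreal (c * f z))"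
    using A1 by (intro AE_uniform_measureI) auto
  have U1: "emeasure ?U (space ?U) \<noteq> 0" by (simp only: emeasure_unif) simp
  have Afin: "(\<integral>\<^sup>+y. ennreal (norm (A y)) \<up> 1 \<partial>L) < top"
  proof -
    \<comment> \<open>\<open>A1\<close> holds almost everywhere, hence at some point of the cell,
      and a single such point gives integrability.\<close>
    obtain z where z: "z \<in> D j x" "av j (\<lambda>y. ennreal (norm (A y ** B z)) * ennreal (f y)) z \<le> ennreal (c * f z)"
    proof (rule ccontr)
      assume "\<not> thesis"
      then have "AE z in ?U. False" using AE_U that by (auto elim: AE_mp)
      then show False using not_AE_False[OF U1] by blast
    qed
    have "av j (\<lambda>y. ennreal (f y) * ennreal (norm (A y))) x \<le> av j (\<lambda>y. ennreal (norm (A z)) * (ennreal (norm (A y ** B z)) * ennreal (f y))) x"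
    proof (rule av_mono)
      fix y
      have "A y = (A y ** B z) ** A z" by (simp add: inv flip: matrix_mul_assoc)
      then have "norm (A y) \<le> norm (A y ** B z) * norm (A z)"
        using norm_matrix_mult_le[of "A y ** B z" "A z"] by simp
      then have "f y * norm (A y) \<le> norm (A z) * (norm (A y ** B z) * f y)"
        using fpos[of y] by (simp add: mult.commute mult.left_commute)
      then show "ennreal (f y) * ennreal (norm (A y)) \<le> ennreal (norm (A z)) * (ennreal (norm (A y ** B z)) * ennreal (f y))"
        using fpos[of y] by (simp add: ennreal_leI flip: ennreal_mult)
    qed
    also have "\<dots> = ennreal (norm (A z)) * av j (\<lambda>y. ennreal (norm (A y ** B z)) * ennreal (f y)) z"
      using av_cong[OF z(1)] by (subst av_cmult) auto
    also have "\<dots> < top" using z(2) by (auto simp: ennreal_mult_less_top intro: le_less_trans)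
    finally show ?thesis by (simp add: Lint)
  qed
  have Apos: "(\<integral>\<^sup>+y. ennreal (norm (A y *v v)) \<up> 1 \<partial>L) \<noteq> 0" if v: "v \<noteq> 0" for v
  proof
    assume "(\<integral>\<^sup>+y. ennreal (norm (A y *v v)) \<up> 1 \<partial>L) = 0"
    then have "(\<integral>\<^sup>+y. ennreal (f y) * ennreal (norm (A y *v v)) \<partial>?U) = 0"
      by (simp add: Lint av_def)
    then have "AE y in ?U. ennreal (f y) * ennreal (norm (A y *v v)) = 0"
      by (subst (asm) nn_integral_0_iff_AE) auto
    then have "AE y in ?U. False"
      using matrix_pair_nonzero(2)[OF inv(2) v] fpos by (auto simp: ennreal_eq_0_iff not_le)
    then show False using not_AE_False[OF U1] by blast
  qed
  have AL: "A \<in> borel_measurable L" unfolding L_def by measurable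
  obtain R R' :: "complex^'d^'d" where R: "R ** R' = mat 1" "R' ** R = mat 1"
    and R1': "\<And>X :: complex^'d^'d. ennreal (norm (R ** X)) \<up> 1 \<le> ennreal k1 * (\<integral>\<^sup>+y. ennreal (norm (A y ** X)) \<up> 1 \<partial>L)"
    and R2': "\<And>X :: complex^'d^'d. (\<integral>\<^sup>+y. ennreal (norm (A y ** X)) \<up> 1 \<partial>L) \<le> ennreal k1 * ennreal (norm (R ** X)) \<up> 1"
    by (rule reducing_matrix[OF AL order_refl Afin Apos, folded k1_def]) ((assumption | rule that)+)
  have R1: "ennreal (norm (R ** X)) \<le> ennreal k1 * av j (\<lambda>y. ennreal (f y) * ennreal (norm (A y ** X))) x"
    and R2: "av j (\<lambda>y. ennreal (f y) * ennreal (norm (A y ** X))) x \<le> ennreal (k1 * norm (R ** X))" for X :: "complex^'d^'d"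
    using R1'[of X] R2'[of X] k1 by (auto simp: Lint ennreal_mult)
  define K where "K z y = norm (A z ** B y)" for z y
  let ?I = "\<lambda>z. av j (\<lambda>y. ennreal (K z y) \<up> (p / (p - 1))) x"
  have [measurable]: "K z \<in> borel_measurable M" for z unfolding K_def by measurable
  have Ke: "norm (\<gamma> z *\<^sub>R A z ** (1 / \<gamma> y) *\<^sub>R B y) = \<gamma> z / \<gamma> y * K z y" for z y
    using \<gamma>pos[of z] \<gamma>pos[of y] by (simp add: sc K_def)
  have RBpos: "0 < norm (R ** B y)" for y
  proof (rule matrix_pair_nonzero(1))
    show "(A y ** R') ** (R ** B y) = mat 1"
      using R inv by (metis matrix_mul_assoc matrix_mul_lid)
  qed
  \<comment> \<open>This is \<open>A1\<close> expressed by \<open>R\<close>: up to the factor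
    \<open>k1\<close>, |R B(z)| is bounded by the average of |A B(z)| against
    \<open>f\<close>.\<close>
  have RBf: "AE y in ?U. norm (R ** B y) \<le> k1 * c * f y"
    using AE_U
  proof eventually_elim
    case (elim z)
    have "ennreal (norm (R ** B z)) \<le> ennreal k1 * av j (\<lambda>y. ennreal (f y) * ennreal (norm (A y ** B z))) x"
      by (rule R1)
    also have "\<dots> = ennreal k1 * av j (\<lambda>y. ennreal (norm (A y ** B z)) * ennreal (f y)) z"
      using elim av_cong[of z j x] by (simp add: mult.commute)
    also have "\<dots> \<le> ennreal k1 * ennreal (c * f z)" using elim by (intro mult_left_mono) auto
    also have "\<dots> = ennreal (k1 * c * f z)" using k1 c fpos[of z] by (simp add: mult.assoc flip: ennreal_mult)
    finally show ?case using k1 c fpos[of z] by (subst (asm) ennreal_le_iff) auto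
  qed
  define t where "t z = f z * norm (A z ** R')" for z
  have t0: "0 \<le> t z" for z using fpos[of z] by (simp add: t_def)
  \<comment> \<open>In the power \<tau> the kernel is split through \<open>R\<close>. The factor |R
    B(y)| is at most a multiple of \<open>f y\<close> and cancels the \<open>f y\<close> that
    \<open>\<gamma> y\<close> puts into the denominator, so only \<open>t z\<close> remains.\<close>
  have pt: "AE y in ?U. ennreal (norm (\<gamma> z *\<^sub>R A z ** (1 / \<gamma> y) *\<^sub>R B y)) \<up> (q / (q - 1))
      \<le> ennreal ((k1 * c * t z) powr \<tau>) * ennreal (K z y) \<up> (p / (p - 1))" for z
    using RBf
  proof eventually_elim
    case (elim y)
    have "A z ** B y = (A z ** R') ** (R ** B y)"
      using R by (metis matrix_mul_assoc matrix_mul_rid)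
    then have K1: "K z y \<le> norm (A z ** R') * norm (R ** B y)"
      unfolding K_def using norm_matrix_mult_le[of "A z ** R'" "R ** B y"] by simp
    have K0: "0 \<le> K z y" by (simp add: K_def)
    have "\<gamma> z powr (q / (q - 1)) = f z powr \<tau>" "\<gamma> y powr (q / (q - 1)) = f y powr \<tau>"
      using \<tau>2 by (simp_all only: \<gamma>_def powr_powr \<theta>_def[symmetric])
    then have "(\<gamma> z / \<gamma> y * K z y) powr (q / (q - 1)) = f z powr \<tau> / f y powr \<tau> * (K z y powr \<tau> * K z y powr (p / (p - 1)))"
      using \<gamma>pos[of z] \<gamma>pos[of y] K0 \<tau>(3) by (simp add: powr_mult powr_divide add.commute flip: powr_add)
    also have "\<dots> \<le> f z powr \<tau> / f y powr \<tau> * ((norm (A z ** R') * norm (R ** B y)) powr \<tau> * K z y powr (p / (p - 1)))"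
      using K1 K0 \<tau> by (intro mult_left_mono mult_right_mono powr_mono2) auto
    also have "\<dots> \<le> f z powr \<tau> / f y powr \<tau> * ((norm (A z ** R') * (k1 * c * f y)) powr \<tau> * K z y powr (p / (p - 1)))"
      using elim \<tau> by (intro mult_left_mono mult_right_mono powr_mono2) auto
    also have "\<dots> = (k1 * c * t z) powr \<tau> * K z y powr (p / (p - 1))"
      using k1 c fpos[of z] fpos[of y] by (simp add: t_def powr_mult)
    finally show ?case
      using \<gamma>pos[of z] \<gamma>pos[of y] K0 by (simp add: Ke enn_powr_ennreal ennreal_leI flip: ennreal_mult)
  qed
  have inner: "av j (\<lambda>y. ennreal (norm (\<gamma> z *\<^sub>R A z ** (1 / \<gamma> y) *\<^sub>R B y)) \<up> (q / (q - 1))) x \<up> (q - 1)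
    \<le> ennreal ((k1 * c) powr \<theta>) * (ennreal (t z) \<up> \<theta> * (?I z \<up> (p - 1)) \<up> (1 - \<theta>))" for z
  proof -
    have "av j (\<lambda>y. ennreal (norm (\<gamma> z *\<^sub>R A z ** (1 / \<gamma> y) *\<^sub>R B y)) \<up> (q / (q - 1))) x \<le> ennreal ((k1 * c * t z) powr \<tau>) * ?I z"
      unfolding av_cmult[symmetric, OF borel_measurable_enn_powr[OF measurable_compose[OF \<open>K z \<in> _\<close> measurable_ennreal]]]
      unfolding av_def by (intro nn_integral_mono_AE pt)
    then have "av j (\<lambda>y. ennreal (norm (\<gamma> z *\<^sub>R A z ** (1 / \<gamma> y) *\<^sub>R B y)) \<up> (q / (q - 1))) x \<up> (q - 1) \<le> (ennreal ((k1 * c * t z) powr \<tau>) * ?I z) \<up> (q - 1)"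
      using pq by (intro enn_powr_mono) auto
    also have "\<dots> = ennreal ((k1 * c * t z) powr \<theta>) * ?I z \<up> (q - 1)"
      using pq \<tau> by (simp add: enn_powr_mult) (simp add: enn_powr_ennreal powr_powr)
    also have "?I z \<up> (q - 1) = (?I z \<up> (p - 1)) \<up> (1 - \<theta>)"
      using \<theta> pq by (simp add: enn_powr_powr mult.commute)
    also have "ennreal ((k1 * c * t z) powr \<theta>) = ennreal ((k1 * c) powr \<theta>) * ennreal (t z) \<up> \<theta>"
      using k1 c t0[of z] by (simp add: powr_mult enn_powr_ennreal flip: ennreal_mult)
    finally show ?thesis by (simp add: mult.assoc)
  qed
  have mI [measurable]: "?I \<in> borel_measurable M"
  proof -
    have 1: "(\<lambda>w. ennreal (K (fst w) (snd w)) \<up> (p / (p - 1)) * indicator (D j x) (snd w)) \<in> borel_measurable (M \<Otimes>\<^sub>M M)"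
      unfolding K_def by measurable
    have "?I z = (\<integral>\<^sup>+y. ennreal (K z y) \<up> (p / (p - 1)) * indicator (D j x) y \<partial>M) / ennreal (vol j)" for z
      by (subst av_eq) auto
    moreover have "(\<lambda>z. (\<integral>\<^sup>+y. ennreal (K z y) \<up> (p / (p - 1)) * indicator (D j x) y \<partial>M)) \<in> borel_measurable M"
      by (rule borel_measurable_nn_integral_kernel) (rule 1)
    ultimately show ?thesis by simp
  qed
  have [measurable]: "t \<in> borel_measurable M" unfolding t_def by measurable
  have "av j (\<lambda>z. av j (\<lambda>y. ennreal (norm (\<gamma> z *\<^sub>R A z ** (1 / \<gamma> y) *\<^sub>R B y)) \<up> (q / (q - 1))) x \<up> (q - 1)) x
    \<le> av j (\<lambda>z. ennreal ((k1 * c) powr \<theta>) * (ennreal (t z) \<up> \<theta> * (?I z \<up> (p - 1)) \<up> (1 - \<theta>))) x"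
    by (intro av_mono inner)
  also have "\<dots> = ennreal ((k1 * c) powr \<theta>) * av j (\<lambda>z. ennreal (t z) \<up> \<theta> * (?I z \<up> (p - 1)) \<up> (1 - \<theta>)) x"
    by (rule av_cmult) measurable
  \<comment> \<open>Since q - 1 = (1-\<theta>)(p-1), Hoelder's inequality separates the mean of
    \<open>t\<close>, bounded by a dimensional constant through \<open>R2\<close> for
    \<open>R'\<close>, from the original characteristic. This produces the exponents \<theta> and
    1-\<theta>.\<close>
  also have "av j (\<lambda>z. ennreal (t z) \<up> \<theta> * (?I z \<up> (p - 1)) \<up> (1 - \<theta>)) x \<le> av j (\<lambda>z. ennreal (t z)) x \<up> \<theta> * av j (\<lambda>z. ?I z \<up> (p - 1)) x \<up> (1 - \<theta>)"
    unfolding av_def[of j "\<lambda>z. ennreal (t z)"] av_def[of j "\<lambda>z. ?I z \<up> (p - 1)"] av_def[of j "\<lambda>z. ennreal (t z) \<up> \<theta> * (?I z \<up> (p - 1)) \<up> (1 - \<theta>)"]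
    using \<theta> by (intro nn_integral_Hoelder) auto
  also have "\<dots> \<le> ennreal (k1 * norm (mat 1 :: complex^'d^'d)) \<up> \<theta> * ennreal N \<up> (1 - \<theta>)"
  proof (intro mult_mono enn_powr_mono)
    show "av j (\<lambda>z. ennreal (t z)) x \<le> ennreal (k1 * norm (mat 1 :: complex^'d^'d))"
      using R2[of R'] fpos by (simp add: R t_def ennreal_mult less_imp_le)
    show "av j (\<lambda>z. ?I z \<up> (p - 1)) x \<le> ennreal N" using Ap unfolding dyadic_Ap_def K_def by blast
  qed (use \<theta> in auto)
  also have "ennreal ((k1 * c) powr \<theta>) * (ennreal (k1 * norm (mat 1 :: complex^'d^'d)) \<up> \<theta> * ennreal N \<up> (1 - \<theta>))
    = ennreal ((k1 * k1 * c * norm (mat 1 :: complex^'d^'d)) powr \<theta> * N powr (1 - \<theta>))"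
    using k1 c N by (simp add: enn_powr_ennreal powr_mult mult_ac flip: ennreal_mult)
  finally show "av j (\<lambda>z. av j (\<lambda>y. ennreal (norm (\<gamma> z *\<^sub>R A z ** (1 / \<gamma> y) *\<^sub>R B y)) \<up> (q / (q - 1))) x \<up> (q - 1)) x
    \<le> ennreal ((real CARD('d) powr 3 * real CARD('d) powr 3 * c * norm (mat 1 :: complex^'d^'d)) powr \<theta> * N powr (1 - \<theta>))"
    by (simp add: k1_def mult_left_mono)
qed

end

section \<open>Extrapolation to exponents p above q\<close>

context dyadic_filtration
begin

lemma dyadic_Ap_mono: "dyadic_Ap p N A B \<Longrightarrow> N \<le> N' \<Longrightarrow> dyadic_Ap p N' A B"
  unfolding dyadic_Ap_def by (meson ennreal_leI order.trans)

text \<open>A scalar factor in the weight conjugates the operator, so a bound for the scaled pair is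
  a bound with the scalar weight \<gamma>^q for the original one.\<close>

lemma mmax_scaled:
  fixes A B :: "'a \<Rightarrow> complex^'d^'d"
  assumes [measurable]: "B \<in> borel_measurable M" "F \<in> borel_measurable M" and \<gamma>: "\<And>x. 0 < \<gamma> x"
  shows "mmax (\<lambda>x. \<gamma> x *\<^sub>R A x) (\<lambda>x. (1 / \<gamma> x) *\<^sub>R B x) (\<lambda>y. ennreal (\<gamma> y) * F y) x = ennreal (\<gamma> x) * mmax A B F x"
proof -
  have sc: "(a *\<^sub>R X) ** (b *\<^sub>R Y) = (a * b) *\<^sub>R (X ** Y)" for a b and X Y :: "complex^'d^'d"
    by (simp add: vec_eq_iff matrix_matrix_mult_def scaleR_sum_right mult.commute)
  have "ennreal (norm (\<gamma> x *\<^sub>R A x ** (1 / \<gamma> y) *\<^sub>R B y)) * (ennreal (\<gamma> y) * F y) = ennreal (\<gamma> x) * (ennreal (norm (A x ** B y)) * F y)" for y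
  proof -
    have "norm (\<gamma> x *\<^sub>R A x ** (1 / \<gamma> y) *\<^sub>R B y) * \<gamma> y = \<gamma> x * norm (A x ** B y)"
      using \<gamma>[of x] \<gamma>[of y] by (simp add: sc)
    then show ?thesis
      using \<gamma>[of x] \<gamma>[of y] by (simp add: ennreal_mult_left_assoc)
  qed
  then have "av i (\<lambda>y. ennreal (norm (\<gamma> x *\<^sub>R A x ** (1 / \<gamma> y) *\<^sub>R B y)) * (ennreal (\<gamma> y) * F y)) x
      = ennreal (\<gamma> x) * av i (\<lambda>y. ennreal (norm (A x ** B y)) * F y) x" for i
    by (simp add: av_cmult)
  then show ?thesis by (simp add: mmax_def SUP_mult_left_ennreal)
qed

text \<open>With q-th powers under the integral the sum over \<open>k\<close> can be taken outside,
  so the outer power p/q has to be removed by duality. The dualizing function is the power p/q - 1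
  of the (truncated) left side itself, and it is majorised by the power \<theta> of a Rubio de
  Francia majorant.\<close>

theorem vector_valued_bound_lt:
  fixes p q :: real
  assumes q: "1 < q" "q < p"
  shows "\<exists>C>0. \<forall>(A :: 'a \<Rightarrow> complex^'d^'d) B N F. 1 \<le> N \<longrightarrow> dyadic_Ap p N A B \<longrightarrow> (\<forall>k::nat. F k \<in> borel_measurable M) \<longrightarrow>
    (\<integral>\<^sup>+x. (\<Sum>k. mmax A B (F k) x \<up> q) \<up> (p / q) \<partial>M) \<le> ennreal (C * N powr (p / (q - 1))) * (\<integral>\<^sup>+x. (\<Sum>k. F k x \<up> q) \<up> (p / q) \<partial>M)"
proof -
  have p: "1 < p" using q by simp
  define p' where "p' = p / (p - 1)"
  have p': "1 < p'" "p' / (p' - 1) = p" using p by (auto simp: p'_def field_simps)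
  define \<theta> where "\<theta> = (p - q) / (p - 1)"
  \<comment> \<open>p'/\<theta> is the conjugate exponent of p/q. So the power 1/\<theta> of the
    dualizing function lies in L^p', where the transposed operator is bounded.\<close>
  have \<theta>: "0 < \<theta>" "\<theta> < 1" "(p / q - 1) * (p' / \<theta>) = p / q" "p' * (1 - q / p) = \<theta>"
  proof -
    show "0 < \<theta>" "\<theta> < 1" using q by (auto simp: \<theta>_def)
    have "p' / \<theta> = p / (p - q)" using p q by (simp add: \<theta>_def p'_def)
    moreover have "p / q - 1 = (p - q) / q" "1 - q / p = (p - q) / p"
      using p q by (simp_all add: diff_divide_distrib)
    ultimately show "(p / q - 1) * (p' / \<theta>) = p / q" "p' * (1 - q / p) = \<theta>"
      using p q by (auto simp: \<theta>_def p'_def)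
  qed
  obtain C1 where C1: "0 < C1" and bd1: "\<And>(A :: 'a \<Rightarrow> complex^'d^'d) B N F. 1 \<le> N \<Longrightarrow> dyadic_Ap p' N A B \<Longrightarrow> F \<in> borel_measurable M \<Longrightarrow>
    (\<integral>\<^sup>+x. mmax A B F x \<up> p' \<partial>M) \<le> ennreal (C1 * N powr p) * (\<integral>\<^sup>+x. F x \<up> p' \<partial>M)"
    using matrix_maximal_bound[OF p'(1), where 'd = 'd] unfolding p'(2) by blast
  obtain C2 where C2: "0 < C2" and bd2: "\<And>(A :: 'a \<Rightarrow> complex^'d^'d) B N F. 1 \<le> N \<Longrightarrow> dyadic_Ap q N A B \<Longrightarrow> F \<in> borel_measurable M \<Longrightarrow>
    (\<integral>\<^sup>+x. mmax A B F x \<up> q \<partial>M) \<le> ennreal (C2 * N powr (q / (q - 1))) * (\<integral>\<^sup>+x. F x \<up> q \<partial>M)"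
    using matrix_maximal_bound[OF q(1), where 'd = 'd] by blast
  define cd where "cd = real CARD('d) powr (4 * (p / (p - 1)) + 2 + 2 * ((2 * p + 1) / (p - 1)))"
  have cd: "1 \<le> cd" unfolding cd_def using p by (intro ge_one_powr_ge_zero) auto
  \<comment> \<open>\<open>c5 * N\<close> will bound the norm of the transposed operator on L^p'.
    The maximum in \<open>c6\<close> keeps the new characteristic at least 1, as the scalar bound
    requires.\<close>
  define c5 where "c5 = (C1 * cd powr p) powr (1 / p')"
  have c5: "0 < c5" using C1 cd by (simp add: c5_def)
  define c6 where "c6 = max 1 ((real CARD('d) powr 3 * real CARD('d) powr 3 * (2 * c5) * norm (mat 1 :: complex^'d^'d)) powr \<theta>)"
  define c7 where "c7 = 2 powr p' * (2 powr p' * (1 + 1))"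
  have c7: "0 < c7" by (simp add: c7_def)
  define K where "K = C2 * c6 powr (q / (q - 1)) * c7 powr (1 - q / p)"
  have K: "0 < K" using C2 c7 by (simp add: K_def c6_def)
  show ?thesis
  proof (intro exI[of _ "K powr (p / q)"] conjI allI impI)
    show "0 < K powr (p / q)" using K by simp
    fix A B :: "'a \<Rightarrow> complex^'d^'d" and N :: real and F :: "nat \<Rightarrow> 'a \<Rightarrow> ennreal"
    assume N: "1 \<le> N" and Ap: "dyadic_Ap p N A B" and F: "\<forall>k. F k \<in> borel_measurable M"
    have [measurable]: "F k \<in> borel_measurable M" for k using F by blast
    note AB [measurable] = dyadic_Ap_measurable[OF Ap]
    note mm [measurable] = borel_measurable_mmax[OF AB]
    define S where "S x = (\<Sum>k. mmax A B (F k) x \<up> q)" for x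
    have [measurable]: "S \<in> borel_measurable M" unfolding S_def by measurable
    let ?X = "\<integral>\<^sup>+x. (\<Sum>k. F k x \<up> q) \<up> (p / q) \<partial>M"
    let ?K = "ennreal (K powr (p / q) * N powr (p / (q - 1)))"
    \<comment> \<open>The estimate is made for functions below \<open>S\<close> with finite
      integral, because it ends by dividing by a power of the left side.\<close>
    have trunc: "(\<integral>\<^sup>+x. T x \<up> (p / q) \<partial>M) \<le> ?K * ?X"
      if [measurable]: "T \<in> borel_measurable M" and TS: "\<And>x. T x \<le> S x" and Tfin: "(\<integral>\<^sup>+x. T x \<up> (p / q) \<partial>M) < top" for T
    proof (cases "(\<integral>\<^sup>+x. T x \<up> (p / q) \<partial>M) = 0")
      case False
      let ?Y = "\<integral>\<^sup>+x. T x \<up> (p / q) \<partial>M"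
      obtain h where [measurable]: "h \<in> borel_measurable M" and h: "integral\<^sup>N M h \<noteq> top" "\<And>x. 0 < h x"
        using Ex_finite_integrable_function by auto
      have Ih: "integral\<^sup>N M h \<noteq> 0"
      proof
        assume "integral\<^sup>N M h = 0"
        then have "AE x in M. h x = 0" by (subst (asm) nn_integral_0_iff_AE) auto
        then have "AE x in M. T x \<up> (p / q) = 0" by eventually_elim (metis h(2) less_irrefl)
        then have "?Y = 0" by (subst nn_integral_0_iff_AE) auto
        then show False using False by simp
      qed
      \<comment> \<open>The second summand makes \<open>\<psi>\<close> positive everywhere, so that
        its majorant can serve as a weight. It is scaled so that its p'-th power has the integral
        \<open>?Y\<close>, as that of the first has.\<close>
      define \<psi> where "\<psi> x = (T x \<up> (p / q - 1)) \<up> (1 / \<theta>) + (h x * (?Y / integral\<^sup>N M h)) \<up> (1 / p')" for x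
      have [measurable]: "\<psi> \<in> borel_measurable M" unfolding \<psi>_def by measurable
      have \<psi>pos: "0 < \<psi> x" for x
      proof -
        have "h x * (?Y / integral\<^sup>N M h) \<noteq> 0"
          using h(2)[of x] h(1) False by (auto simp: ennreal_divide_eq_0_iff)
        then show ?thesis by (simp add: \<psi>_def zero_less_iff_neq_zero)
      qed
      have \<psi>int: "(\<integral>\<^sup>+x. \<psi> x \<up> p' \<partial>M) \<le> ennreal (2 powr p' * (1 + 1)) * ?Y"
      proof -
        have "(\<integral>\<^sup>+x. \<psi> x \<up> p' \<partial>M) \<le> (\<integral>\<^sup>+x. ennreal (2 powr p') * (T x \<up> (p / q) + h x * (?Y / integral\<^sup>N M h)) \<partial>M)"
        proof (rule nn_integral_mono)
          fix x
          let ?a = "(T x \<up> (p / q - 1)) \<up> (1 / \<theta>)" and ?b = "(h x * (?Y / integral\<^sup>N M h)) \<up> (1 / p')"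
          have "(\<Sum>i\<in>{False, True}. if i then ?a else ?b) \<up> p'
            \<le> ennreal (real (card {False, True}) powr p') * (\<Sum>i\<in>{False, True}. (if i then ?a else ?b) \<up> p')"
            using p' by (intro sum_enn_powr_le) auto
          moreover have "?a \<up> p' = T x \<up> (p / q)"
            using \<theta> p' q by (simp add: enn_powr_powr mult.assoc)
          moreover have "?b \<up> p' = h x * (?Y / integral\<^sup>N M h)"
            using p' by (subst enn_powr_powr) auto
          ultimately show "\<psi> x \<up> p' \<le> ennreal (2 powr p') * (T x \<up> (p / q) + h x * (?Y / integral\<^sup>N M h))"
            by (simp add: \<psi>_def add.commute)
        qed
        also have "\<dots> = ennreal (2 powr p') * (?Y + integral\<^sup>N M h * (?Y / integral\<^sup>N M h))"
          by (simp add: nn_integral_cmult nn_integral_add nn_integral_multc)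
        also have "integral\<^sup>N M h * (?Y / integral\<^sup>N M h) = ?Y"
          using h Ih by (simp add: ennreal_times_divide ennreal_mult_divide_eq mult.commute[of "integral\<^sup>N M h"])
        also have "?Y + ?Y = ennreal (1 + 1) * ?Y" by (simp add: mult_2)
        finally show ?thesis by (simp only: ennreal_mult_left_assoc powr_ge_zero)
      qed
      define N' where "N' = cd * N powr (1 / (p - 1))"
      have N': "1 \<le> N'" unfolding N'_def using cd N p mult_mono[of 1 cd 1 "N powr (1 / (p - 1))"] by (simp add: ge_one_powr_ge_zero)
      have dual: "dyadic_Ap p' N' (\<lambda>x. transpose (B x)) (\<lambda>x. transpose (A x))"
        unfolding N'_def cd_def p'_def using Ap p N by (intro dyadic_Ap_dual) auto
      let ?c = "c5 * N"
      have c: "0 < ?c" using c5 N by simp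
      \<comment> \<open>The dual characteristic is a multiple of N^(1/(p-1)) and enters the L^p'
        bound with the power \<open>p\<close>, giving N^p'. Hence the norm of the transposed
        operator is linear in \<open>N\<close>.\<close>
      have cp: "?c powr p' = C1 * N' powr p"
      proof -
        have "?c powr p' = C1 * cd powr p * N powr p'"
          using c5 N C1 cd p' by (simp add: powr_mult c5_def powr_powr)
        also have "N powr p' = (N powr (1 / (p - 1))) powr p" by (simp add: powr_powr p'_def)
        finally show ?thesis using cd by (simp add: N'_def powr_mult)
      qed
      have bdT: "(\<integral>\<^sup>+x. mmax (\<lambda>x. transpose (B x)) (\<lambda>x. transpose (A x)) f x \<up> p' \<partial>M) \<le> ennreal (?c powr p') * (\<integral>\<^sup>+x. f x \<up> p' \<partial>M)"
        if "f \<in> borel_measurable M" for f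
        unfolding cp by (rule bd1[OF N' dual that])
      obtain \<phi> where [measurable]: "\<phi> \<in> borel_measurable M" and \<phi>: "\<And>x. \<psi> x \<le> \<phi> x"
          "\<And>x. mmax (\<lambda>x. transpose (B x)) (\<lambda>x. transpose (A x)) \<phi> x \<le> ennreal (2 * ?c) * \<phi> x"
          "(\<integral>\<^sup>+x. \<phi> x \<up> p' \<partial>M) \<le> ennreal (2 powr p') * (\<integral>\<^sup>+x. \<psi> x \<up> p' \<partial>M)"
        by (rule rubio_de_francia[OF dyadic_Ap_measurable[OF dual] \<open>\<psi> \<in> _\<close> c p'(1) bdT]) ((assumption | rule that)+)
      have "(\<integral>\<^sup>+x. \<phi> x \<up> p' \<partial>M) \<le> ennreal (2 powr p') * (ennreal (2 powr p' * (1 + 1)) * ?Y)"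
        by (rule order.trans[OF \<phi>(3) mult_left_mono[OF \<psi>int]]) simp
      also have "\<dots> = ennreal c7 * ?Y" unfolding c7_def by (rule ennreal_mult_left_assoc) auto
      finally have \<phi>int: "(\<integral>\<^sup>+x. \<phi> x \<up> p' \<partial>M) \<le> ennreal c7 * ?Y" .
      have \<phi>fin: "AE x in M. \<phi> x \<noteq> top"
      proof -
        have "(\<integral>\<^sup>+x. \<phi> x \<up> p' \<partial>M) \<noteq> \<infinity>"
          using \<phi>int Tfin c7 by (auto simp: top_unique ennreal_mult_eq_top_iff)
        then have "AE x in M. \<phi> x \<up> p' \<noteq> \<infinity>" by (intro nn_integral_PInf_AE) auto
        then show ?thesis by simp
      qed
      \<comment> \<open>\<open>\<phi>\<close> made real valued; the value 1 is used only on a null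
        set and keeps \<open>f\<close> positive.\<close>
      define f where "f x = (if \<phi> x = top then 1 else enn2real (\<phi> x))" for x
      have [measurable]: "f \<in> borel_measurable M" unfolding f_def by measurable
      have fpos: "0 < f x" for x
        using order.strict_trans2[OF \<psi>pos \<phi>(1), of x]
        by (cases "\<phi> x") (auto simp: f_def)
      have f\<phi>: "AE x in M. ennreal (f x) = \<phi> x"
        using \<phi>fin by eventually_elim (simp add: f_def less_top)
      have A1: "AE z in M. \<forall>j. av j (\<lambda>y. ennreal (norm (A y ** B z)) * ennreal (f y)) z \<le> ennreal (2 * ?c * f z)"
        using f\<phi>
      proof eventually_elim
        case (elim z)
        show ?case
        proof
          fix j
          have tr: "norm (transpose (B z) ** transpose (A y)) = norm (A y ** B z)" for y
            by (metis matrix_transpose_mul norm_transpose)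
          have "av j (\<lambda>y. ennreal (norm (A y ** B z)) * ennreal (f y)) z = av j (\<lambda>y. ennreal (norm (A y ** B z)) * \<phi> y) z"
          proof (rule av_cong_AE)
            show "AE y in M. ennreal (norm (A y ** B z)) * ennreal (f y) = ennreal (norm (A y ** B z)) * \<phi> y"
              using f\<phi> by eventually_elim simp
          qed measurable
          also have "\<dots> \<le> mmax (\<lambda>x. transpose (B x)) (\<lambda>x. transpose (A x)) \<phi> z"
            unfolding mmax_def tr by (rule SUP_upper) simp
          also have "\<dots> \<le> ennreal (2 * ?c) * \<phi> z" by (rule \<phi>)
          also have "\<dots> = ennreal (2 * ?c * f z)" using c fpos[of z] by (subst ennreal_mult) (auto simp: elim)
          finally show "av j (\<lambda>y. ennreal (norm (A y ** B z)) * ennreal (f y)) z \<le> ennreal (2 * ?c * f z)" .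
        qed
      qed
      define \<gamma> where "\<gamma> x = f x powr (\<theta> / q)" for x
      have [measurable]: "\<gamma> \<in> borel_measurable M" unfolding \<gamma>_def by measurable
      have \<gamma>pos: "0 < \<gamma> x" for x using fpos[of x] by (simp add: \<gamma>_def)
      have \<gamma>q: "ennreal (\<gamma> x) \<up> q = ennreal (f x) \<up> \<theta>" for x
        using fpos[of x] q by (simp add: \<gamma>_def enn_powr_ennreal powr_powr)
      let ?A = "\<lambda>x. \<gamma> x *\<^sub>R A x" and ?B = "\<lambda>x. (1 / \<gamma> x) *\<^sub>R B x"
      \<comment> \<open>Since the constant in \<open>A1\<close> is a multiple of \<open>N\<close>,
        its power \<theta> and N^(1-\<theta>) multiply to a multiple of \<open>N\<close>.\<close>
      have "dyadic_Ap q ((real CARD('d) powr 3 * real CARD('d) powr 3 * (2 * ?c) * norm (mat 1 :: complex^'d^'d)) powr \<theta> * N powr (1 - \<theta>)) ?A ?B"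
        unfolding \<gamma>_def \<theta>_def using N c fpos A1 by (intro dyadic_Ap_extrapolate[OF Ap q]) auto
      moreover have "(real CARD('d) powr 3 * real CARD('d) powr 3 * (2 * ?c) * norm (mat 1 :: complex^'d^'d)) powr \<theta> * N powr (1 - \<theta>) \<le> c6 * N"
      proof -
        let ?k = "real CARD('d) powr 3 * real CARD('d) powr 3 * (2 * c5) * norm (mat 1 :: complex^'d^'d)"
        have "real CARD('d) powr 3 * real CARD('d) powr 3 * (2 * ?c) * norm (mat 1 :: complex^'d^'d) = ?k * N" by (simp add: mult_ac)
        then have "(real CARD('d) powr 3 * real CARD('d) powr 3 * (2 * ?c) * norm (mat 1 :: complex^'d^'d)) powr \<theta> * N powr (1 - \<theta>)
          = ?k powr \<theta> * (N powr \<theta> * N powr (1 - \<theta>))"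
          using N c5 by (simp only: powr_mult mult.assoc)
        also have "N powr \<theta> * N powr (1 - \<theta>) = N" using N by (simp flip: powr_add)
        also have "?k powr \<theta> * N \<le> c6 * N" using N by (intro mult_right_mono) (auto simp: c6_def)
        finally show ?thesis .
      qed
      ultimately have ApV: "dyadic_Ap q (c6 * N) ?A ?B" by (rule dyadic_Ap_mono)
      have c6N: "1 \<le> c6 * N" using N mult_mono[of 1 c6 1 N] by (simp add: c6_def)
      \<comment> \<open>Of the factors of T^(p/q) = T T^(p/q-1) the first is bounded by
        \<open>S\<close>, the second by \<open>\<phi>\<close> to the power \<theta>.\<close>
      have "?Y \<le> (\<integral>\<^sup>+x. S x * ennreal (f x) \<up> \<theta> \<partial>M)"
      proof (rule nn_integral_mono_AE)
        show "AE x in M. T x \<up> (p / q) \<le> S x * ennreal (f x) \<up> \<theta>"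
          using f\<phi>
        proof eventually_elim
          case (elim x)
          have "T x \<up> (p / q - 1) = ((T x \<up> (p / q - 1)) \<up> (1 / \<theta>)) \<up> \<theta>"
            using \<theta> by (subst enn_powr_powr) auto
          also have "\<dots> \<le> \<phi> x \<up> \<theta>"
            using \<theta> \<phi>(1)[of x] unfolding \<psi>_def by (intro enn_powr_mono) (auto elim: order.trans[rotated])
          finally have "T x * T x \<up> (p / q - 1) \<le> S x * \<phi> x \<up> \<theta>"
            by (intro mult_mono TS) auto
          moreover have "T x \<up> (p / q) = T x * T x \<up> (p / q - 1)"
            using enn_powr_add[of "T x" 1 "p / q - 1"] by simp
          ultimately show ?case by (simp add: elim)
        qed
      qed
      also have "\<dots> = (\<integral>\<^sup>+x. (\<Sum>k. mmax ?A ?B (\<lambda>y. ennreal (\<gamma> y) * F k y) x \<up> q) \<partial>M)"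
      proof (rule nn_integral_cong)
        fix x
        have "mmax ?A ?B (\<lambda>y. ennreal (\<gamma> y) * F k y) x \<up> q = mmax A B (F k) x \<up> q * ennreal (f x) \<up> \<theta>" for k
          using q \<gamma>pos by (subst mmax_scaled) (auto simp: enn_powr_mult \<gamma>q mult.commute)
        then show "S x * ennreal (f x) \<up> \<theta> = (\<Sum>k. mmax ?A ?B (\<lambda>y. ennreal (\<gamma> y) * F k y) x \<up> q)"
          by (simp add: S_def ennreal_suminf_multc)
      qed
      also have "\<dots> = (\<Sum>k. \<integral>\<^sup>+x. mmax ?A ?B (\<lambda>y. ennreal (\<gamma> y) * F k y) x \<up> q \<partial>M)"
        by (intro nn_integral_suminf borel_measurable_enn_powr borel_measurable_mmax) measurable
      also have "\<dots> \<le> (\<Sum>k. ennreal (C2 * (c6 * N) powr (q / (q - 1))) * (\<integral>\<^sup>+x. (ennreal (\<gamma> x) * F k x) \<up> q \<partial>M))"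
        by (intro suminf_le bd2 c6N ApV) auto
      also have "\<dots> = ennreal (C2 * (c6 * N) powr (q / (q - 1))) * (\<Sum>k. \<integral>\<^sup>+x. (ennreal (\<gamma> x) * F k x) \<up> q \<partial>M)"
        by (rule ennreal_suminf_cmult)
      also have "(\<Sum>k. \<integral>\<^sup>+x. (ennreal (\<gamma> x) * F k x) \<up> q \<partial>M) = (\<integral>\<^sup>+x. (\<Sum>k. (ennreal (\<gamma> x) * F k x) \<up> q) \<partial>M)"
        by (rule nn_integral_suminf[symmetric]) measurable
      also have "\<dots> = (\<integral>\<^sup>+x. ((\<Sum>k. F k x \<up> q) \<up> (p / q)) \<up> (q / p) * (ennreal (f x) \<up> p') \<up> (1 - q / p) \<partial>M)"
        using q p \<theta> p' by (simp add: enn_powr_mult \<gamma>q enn_powr_powr mult.commute ennreal_suminf_multc)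
      also have "\<dots> \<le> ?X \<up> (q / p) * (\<integral>\<^sup>+x. ennreal (f x) \<up> p' \<partial>M) \<up> (1 - q / p)"
        using q p by (intro nn_integral_Hoelder) auto
      also have "(\<integral>\<^sup>+x. ennreal (f x) \<up> p' \<partial>M) = (\<integral>\<^sup>+x. \<phi> x \<up> p' \<partial>M)"
        using f\<phi> by (intro nn_integral_cong_AE) (auto elim: eventually_mono)
      also have "(\<integral>\<^sup>+x. \<phi> x \<up> p' \<partial>M) \<up> (1 - q / p) \<le> (ennreal c7 * ?Y) \<up> (1 - q / p)"
        using q p by (intro enn_powr_mono \<phi>int) auto
      also have "\<dots> = ennreal (c7 powr (1 - q / p)) * ?Y \<up> (1 - q / p)"
        using q p c7 by (simp add: enn_powr_mult) (simp add: enn_powr_ennreal)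
      finally have "?Y \<le> ennreal (C2 * (c6 * N) powr (q / (q - 1))) * (?X \<up> (q / p) * (ennreal (c7 powr (1 - q / p)) * ?Y \<up> (1 - q / p)))"
        by (simp add: mult_left_mono)
      also have "\<dots> = ennreal (C2 * (c6 * N) powr (q / (q - 1)) * c7 powr (1 - q / p)) * ?X \<up> (q / p) * ?Y \<up> (1 - q / p)"
        using C2 by (simp add: ennreal_mult mult_ac)
      also have "C2 * (c6 * N) powr (q / (q - 1)) * c7 powr (1 - q / p) = K * N powr (q / (q - 1))"
        using N by (simp add: K_def c6_def powr_mult)
      \<comment> \<open>\<open>?Y\<close> is written as a product of two of its powers, so that the
        one on the right can be cancelled.\<close>
      finally have "?Y \<up> (q / p + (1 - q / p)) \<le> ennreal (K * N powr (q / (q - 1))) * ?X \<up> (q / p) * ?Y \<up> (1 - q / p)"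
        by simp
      then have "?Y \<up> (q / p) * ?Y \<up> (1 - q / p) \<le> ennreal (K * N powr (q / (q - 1))) * ?X \<up> (q / p) * ?Y \<up> (1 - q / p)"
        by (simp only: enn_powr_add)
      then have "?Y \<up> (q / p) \<le> ennreal (K * N powr (q / (q - 1))) * ?X \<up> (q / p)"
        using False Tfin by (subst (asm) ennreal_mult_right_le_cancel) auto
      then have "(?Y \<up> (q / p)) \<up> (p / q) \<le> (ennreal (K * N powr (q / (q - 1))) * ?X \<up> (q / p)) \<up> (p / q)"
        using q p by (intro enn_powr_mono) auto
      also have "\<dots> = ennreal ((K * N powr (q / (q - 1))) powr (p / q)) * ?X"
        using q p K by (simp add: enn_powr_mult enn_powr_powr) (simp add: enn_powr_ennreal)
      also have "(K * N powr (q / (q - 1))) powr (p / q) = K powr (p / q) * N powr (p / (q - 1))"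
        using q K N by (simp add: powr_mult powr_powr)
      finally show ?thesis using q p by (simp add: enn_powr_powr)
    qed simp
    obtain Z :: "nat \<Rightarrow> 'a set" where Z: "range Z \<subseteq> sets M" "(\<Union>i. Z i) = space M" "\<And>i. emeasure M (Z i) \<noteq> \<infinity>" "incseq Z"
      by (rule sigma_finite_incseq) blast
    have Zm [measurable]: "Z i \<in> sets M" for i using Z(1) by auto
    \<comment> \<open>Bounded and supported on a set of finite measure, so that \<open>trunc\<close>
      applies; these functions increase to \<open>S\<close>.\<close>
    define T where "T m x = min (S x) (of_nat m) * indicator (Z m) x" for m x
    have [measurable]: "T m \<in> borel_measurable M" for m unfolding T_def by measurable
    have pq0: "0 < p / q" using p q by simp
    have Tle: "(\<integral>\<^sup>+x. T m x \<up> (p / q) \<partial>M) \<le> ?K * ?X" for m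
    proof (rule trunc)
      show "T m x \<le> S x" for x by (auto simp: T_def indicator_def)
      have "(\<integral>\<^sup>+x. T m x \<up> (p / q) \<partial>M) \<le> (\<integral>\<^sup>+x. of_nat m \<up> (p / q) * indicator (Z m) x \<partial>M)"
        using pq0 by (intro nn_integral_mono) (auto simp: T_def indicator_def intro!: enn_powr_mono)
      also have "\<dots> < top"
        using Z(3)[of m] by (auto simp: nn_integral_cmult_indicator ennreal_mult_less_top less_top ennreal_of_nat_eq_real_of_nat)
      finally show "(\<integral>\<^sup>+x. T m x \<up> (p / q) \<partial>M) < top" .
    qed measurable
    have inc: "T m x \<le> T m' x" if "m \<le> m'" for m m' x
      using that incseqD[OF Z(4) that] by (auto simp: T_def indicator_def min_def intro: order.trans)
    have sup: "S x = (SUP m. T m x)" for x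
    proof (rule antisym)
      show "(SUP m. T m x) \<le> S x" by (intro SUP_least) (auto simp: T_def indicator_def)
      obtain m0 where m0: "x \<in> Z m0" using Z(2) by auto
      show "S x \<le> (SUP m. T m x)"
      proof (rule dense_le)
        fix y assume y: "y < S x"
        then have "y < top" by (rule order.strict_trans2) simp
        then obtain m1 where m1: "y \<le> of_nat m1" using ennreal_Ex_less_of_nat[of y] by (auto intro: less_imp_le)
        let ?m = "max m0 m1"
        have "y \<le> of_nat ?m" by (rule order.trans[OF m1]) simp
        moreover have "x \<in> Z ?m" using m0 incseqD[OF Z(4), of m0 ?m] by auto
        ultimately have "y \<le> T ?m x" using y by (simp add: T_def)
        then show "y \<le> (SUP m. T m x)" by (rule SUP_upper2[OF UNIV_I])
      qed
    qed
    have "(\<integral>\<^sup>+x. S x \<up> (p / q) \<partial>M) = (\<integral>\<^sup>+x. (SUP m. T m x \<up> (p / q)) \<partial>M)"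
      unfolding sup by (simp add: enn_powr_SUP[OF pq0])
    also have "\<dots> = (SUP m. \<integral>\<^sup>+x. T m x \<up> (p / q) \<partial>M)"
      using pq0 by (intro nn_integral_monotone_convergence_SUP) (auto simp: mono_def le_fun_def intro!: enn_powr_mono inc)
    also have "\<dots> \<le> ?K * ?X" by (intro SUP_least Tle)
    finally show "(\<integral>\<^sup>+x. (\<Sum>k. mmax A B (F k) x \<up> q) \<up> (p / q) \<partial>M) \<le> ?K * ?X"
      by (simp add: S_def)
  qed
qed

theorem vector_valued_bound:
  fixes p q :: real
  assumes p: "1 < p" and q: "1 < q"
  shows "\<exists>C>0. \<forall>(A :: 'a \<Rightarrow> complex^'d^'d) B N F. 1 \<le> N \<longrightarrow> dyadic_Ap p N A B \<longrightarrow> (\<forall>k::nat. F k \<in> borel_measurable M) \<longrightarrow>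
    (\<integral>\<^sup>+x. (\<Sum>k. mmax A B (F k) x \<up> q) \<up> (p / q) \<partial>M)
      \<le> ennreal (C * N powr (p * max (1 / (q - 1)) (1 / (p - 1)))) * (\<integral>\<^sup>+x. (\<Sum>k. F k x \<up> q) \<up> (p / q) \<partial>M)"
proof (cases "p \<le> q")
  case True
  then have "p * max (1 / (q - 1)) (1 / (p - 1)) = p / (p - 1)"
    using p by (simp add: max_def frac_le)
  then show ?thesis using vector_valued_bound_ge[OF p True, where 'd = 'd] by simp
next
  case False
  then have "1 / (p - 1) \<le> 1 / (q - 1)" using q by (intro frac_le) auto
  then have "p * max (1 / (q - 1)) (1 / (p - 1)) = p / (q - 1)"
    by (simp add: max_absorb1)
  then show ?thesis using vector_valued_bound_lt[OF q, of p, where 'd = 'd] False by simp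
qed

end

subsection \<open>The shifted dyadic grids\<close>

definition grid_offset :: "('n \<Rightarrow> bool) \<Rightarrow> int \<Rightarrow> 'n \<Rightarrow> real" where
  "grid_offset \<epsilon> j i = (if \<epsilon> i then (if even j then 1 / 3 else - 1 / 3) else 0)"

definition grid_index :: "('n \<Rightarrow> bool) \<Rightarrow> int \<Rightarrow> real^'n \<Rightarrow> 'n \<Rightarrow> int" where
  "grid_index \<epsilon> j x i = \<lfloor>2 powi j * x $ i + grid_offset \<epsilon> j i\<rfloor>"

definition grid :: "('n \<Rightarrow> bool) \<Rightarrow> int \<Rightarrow> real^'n \<Rightarrow> (real^'n) set" where
  "grid \<epsilon> j x = {y. grid_index \<epsilon> j y = grid_index \<epsilon> j x}"

lemma powi2_pos [simp]: "0 < (2::real) powi j" by (simp add: zero_less_power_int)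

text \<open>The alternating sign makes the shifted grids nested, since \<open>2 \<cdot> 1/3 - (-1/3)\<close> is an integer.\<close>

lemma grid_index_parent:
  "grid_index \<epsilon> j x i = (grid_index \<epsilon> (j + 1) x i + (if \<epsilon> i then (if even j then 1 else -1) else 0)) div 2"
proof -
  let ?u = "2 powi j * x $ i + grid_offset \<epsilon> j i"
  define m :: int where "m = (if \<epsilon> i then (if even j then 1 else -1) else 0)"
  have "2 powi (j + 1) = 2 * (2::real) powi j" by (simp add: power_int_add)
  then have "2 powi (j + 1) * x $ i + grid_offset \<epsilon> (j + 1) i = 2 * ?u - of_int m"
    by (simp add: grid_offset_def m_def algebra_simps)
  then have "grid_index \<epsilon> (j + 1) x i + m = \<lfloor>2 * ?u\<rfloor>"
    by (simp add: grid_index_def)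
  moreover have "\<lfloor>2 * v\<rfloor> div 2 = \<lfloor>v\<rfloor>" for v :: real
    using floor_divide_real_eq_div[of 2 "2 * v"] by simp
  ultimately have "(grid_index \<epsilon> (j + 1) x i + m) div 2 = \<lfloor>?u\<rfloor>" by metis
  then show ?thesis by (simp add: grid_index_def m_def)
qed

lemma grid_nested:
  assumes "i \<le> j"
  shows "grid \<epsilon> j x \<subseteq> grid \<epsilon> i x"
  using assms
proof (induction j rule: int_ge_induct)
  case (step j)
  have "grid \<epsilon> (j + 1) x \<subseteq> grid \<epsilon> j x"
  proof
    fix y assume "y \<in> grid \<epsilon> (j + 1) x"
    then have "grid_index \<epsilon> (j + 1) y i = grid_index \<epsilon> (j + 1) x i" for i by (simp add: grid_def)
    then have "grid_index \<epsilon> j y i = grid_index \<epsilon> j x i" for i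
      unfolding grid_index_parent[of \<epsilon> j] by simp
    then show "y \<in> grid \<epsilon> j x" by (auto simp: grid_def)
  qed
  with step show ?case by blast
qed simp

lemma emeasure_cube:
  fixes a :: "real^'n"
  assumes "0 \<le> r"
  shows "emeasure lborel (cbox a (\<chi> i. a $ i + r)) = ennreal (r ^ CARD('n))"
    "emeasure lborel (box a (\<chi> i. a $ i + r)) = ennreal (r ^ CARD('n))"
proof -
  have d: "((\<chi> i. a $ i + r) - a) \<bullet> b = r" if "b \<in> Basis" for b
    using that by (auto simp: Basis_vec_def inner_axis)
  then have le: "a \<bullet> b \<le> (\<chi> i. a $ i + r) \<bullet> b" if "b \<in> Basis" for b
    using that assms by (metis diff_ge_0_iff_ge inner_diff_left)
  have "(\<Prod>b\<in>Basis. ((\<chi> i. a $ i + r) - a) \<bullet> b) = r ^ CARD('n)"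
    using d by (simp add: DIM_cart[symmetric, where 'a = real])
  then show "emeasure lborel (cbox a (\<chi> i. a $ i + r)) = ennreal (r ^ CARD('n))"
    "emeasure lborel (box a (\<chi> i. a $ i + r)) = ennreal (r ^ CARD('n))"
    using le by (simp_all add: emeasure_lborel_cbox emeasure_lborel_box)
qed

text \<open>Cells are half-open. Squeezing them between the open and the closed cube gives their
  volume, and the closed cube is the one that competes in the supremum over all cubes.\<close>

lemma grid_between_boxes:
  fixes x :: "real^'n"
  obtains a where "box a (\<chi> i. a $ i + 1 / 2 powi j) \<subseteq> grid \<epsilon> j x" "grid \<epsilon> j x \<subseteq> cbox a (\<chi> i. a $ i + 1 / 2 powi j)"
proof
  let ?a = "\<chi> i. (of_int (grid_index \<epsilon> j x i) - grid_offset \<epsilon> j i) / 2 powi j"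
  have *: "y \<in> grid \<epsilon> j x \<longleftrightarrow> (\<forall>i. ?a $ i \<le> y $ i \<and> y $ i < ?a $ i + 1 / 2 powi j)" for y
  proof -
    have "grid_index \<epsilon> j y i = grid_index \<epsilon> j x i \<longleftrightarrow> ?a $ i \<le> y $ i \<and> y $ i < ?a $ i + 1 / 2 powi j" for i
    proof -
      have "?a $ i \<le> y $ i \<longleftrightarrow> of_int (grid_index \<epsilon> j x i) \<le> 2 powi j * y $ i + grid_offset \<epsilon> j i"
        by (simp add: pos_divide_le_eq algebra_simps)
      moreover have "?a $ i + 1 / 2 powi j = (of_int (grid_index \<epsilon> j x i) - grid_offset \<epsilon> j i + 1) / 2 powi j"
        by (simp add: add_divide_distrib)
      then have "y $ i < ?a $ i + 1 / 2 powi j \<longleftrightarrow> 2 powi j * y $ i + grid_offset \<epsilon> j i < of_int (grid_index \<epsilon> j x i) + 1"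
        by (simp only: pos_less_divide_eq[OF powi2_pos]) (simp add: algebra_simps)
      ultimately show ?thesis
        unfolding grid_index_def[of \<epsilon> j y] floor_eq_iff by blast
    qed
    then show ?thesis by (simp add: grid_def fun_eq_iff)
  qed
  show "box ?a (\<chi> i. ?a $ i + 1 / 2 powi j) \<subseteq> grid \<epsilon> j x" "grid \<epsilon> j x \<subseteq> cbox ?a (\<chi> i. ?a $ i + 1 / 2 powi j)"
    unfolding subset_iff * by (auto simp: mem_box_cart intro: less_imp_le)
qed

lemma borel_measurable_vec_component [measurable]: "(\<lambda>x :: real^'n. x $ i) \<in> borel_measurable borel"
  by (intro borel_measurable_continuous_onI continuous_intros)

lemma sets_grid_pair:
  "{z. snd z \<in> grid \<epsilon> j (fst z)} \<in> sets (lborel \<Otimes>\<^sub>M (lborel :: (real^'n) measure))"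
proof -
  have "{z \<in> space (lborel \<Otimes>\<^sub>M (lborel :: (real^'n) measure)). \<forall>i. grid_index \<epsilon> j (snd z) i = grid_index \<epsilon> j (fst z) i} \<in> sets (lborel \<Otimes>\<^sub>M lborel)"
    unfolding grid_index_def by measurable
  then show ?thesis by (simp add: grid_def fun_eq_iff space_pair_measure)
qed

lemma sets_grid [measurable]: "grid \<epsilon> j x \<in> sets borel"
proof -
  have "{y \<in> space borel. \<forall>i. grid_index \<epsilon> j y i = grid_index \<epsilon> j x i} \<in> sets borel"
    unfolding grid_index_def by measurable
  then show ?thesis by (simp add: grid_def fun_eq_iff)
qed

lemma emeasure_grid: "emeasure lborel (grid \<epsilon> j (x :: real^'n)) = ennreal ((1 / 2 powi j) ^ CARD('n))"
proof -
  obtain a where a: "box a (\<chi> i. a $ i + 1 / 2 powi j) \<subseteq> grid \<epsilon> j x" "grid \<epsilon> j x \<subseteq> cbox a (\<chi> i. a $ i + 1 / 2 powi j)"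
    by (rule grid_between_boxes)
  have s: "0 \<le> 1 / (2::real) powi j" by simp
  show ?thesis
    using emeasure_mono[OF a(1), of lborel] emeasure_mono[OF a(2), of lborel]
    unfolding emeasure_cube[OF s] by (auto intro: antisym)
qed

lemma countable_range_grid: "countable (range (grid \<epsilon> j :: real^'n \<Rightarrow> _))"
proof -
  have "range (grid \<epsilon> j) \<subseteq> (\<lambda>k. {y. grid_index \<epsilon> j y = k}) ` UNIV"
    unfolding grid_def by blast
  moreover have "countable (UNIV :: ('n \<Rightarrow> int) set)" by simp
  ultimately show ?thesis by (meson countable_image countable_subset)
qed

lemma grid_small:
  fixes x :: "real^'n"
  assumes "0 < e"
  obtains m where "j \<le> m" "\<And>l. m \<le> l \<Longrightarrow> grid \<epsilon> l x \<subseteq> ball x e"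
proof -
  obtain k where k: "(1 / 2 :: real) ^ k < e / real CARD('n)"
    using real_arch_pow_inv[of "e / real CARD('n)" "1/2"] assms by auto
  define m where "m = max j (int k)"
  have "grid \<epsilon> m x \<subseteq> ball x e"
  proof
    fix y assume y: "y \<in> grid \<epsilon> m x"
    have c: "\<bar>y $ i - x $ i\<bar> < (1 / 2) ^ k" for i
    proof -
      have "\<lfloor>2 powi m * y $ i + grid_offset \<epsilon> m i\<rfloor> = \<lfloor>2 powi m * x $ i + grid_offset \<epsilon> m i\<rfloor>"
        using y by (auto simp: grid_def grid_index_def fun_eq_iff)
      then have "\<bar>2 powi m * y $ i - 2 powi m * x $ i\<bar> < 1" by linarith
      moreover have "2 powi m * y $ i - 2 powi m * x $ i = 2 powi m * (y $ i - x $ i)" by (simp add: right_diff_distrib)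
      ultimately have "2 powi m * \<bar>y $ i - x $ i\<bar> < 1" by (simp add: abs_mult)
      moreover have "2 ^ k \<le> (2::real) powi m"
        using power_int_increasing[of "int k" m "2::real"] by (simp add: m_def)
      then have "2 ^ k * \<bar>y $ i - x $ i\<bar> \<le> 2 powi m * \<bar>y $ i - x $ i\<bar>" by (rule mult_right_mono) simp
      ultimately show ?thesis by (simp add: power_divide field_simps)
    qed
    have "norm (y - x) \<le> (\<Sum>i\<in>UNIV. \<bar>(y - x) $ i\<bar>)" by (rule norm_le_l1_cart)
    also have "\<dots> \<le> (\<Sum>i\<in>(UNIV :: 'n set). (1 / 2) ^ k)"
      using c by (intro sum_mono less_imp_le) simp
    also have "\<dots> < e" using k by (simp add: field_simps)
    finally show "y \<in> ball x e" by (simp add: dist_norm norm_minus_commute)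
  qed
  then show ?thesis
    using grid_nested[of m _ \<epsilon> x] by (intro that[of m]) (auto simp: m_def intro: order.trans)
qed

lemma dyadic_partition_grid:
  "dyadic_partition (lborel :: (real^'n) measure) (grid \<epsilon>) (\<lambda>j. (1 / 2 powi j) ^ CARD('n))"
proof
  show "{z. snd z \<in> grid \<epsilon> j (fst z)} \<in> sets (lborel \<Otimes>\<^sub>M (lborel :: (real^'n) measure))" for j
    by (rule sets_grid_pair)
  show "emeasure lborel (grid \<epsilon> j (x :: real^'n)) = ennreal ((1 / 2 powi j) ^ CARD('n))" for j x
    by (rule emeasure_grid)
qed (auto simp: grid_def intro: subsetD[OF grid_nested, unfolded grid_def, simplified])

text \<open>On a set E where \<open>f\<close> is at least r2 and all later averages are at most r1 <
  r2, cover E by cells inside an open set of almost the same measure. Each cell that meets E has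
  average at most r1, so r2 |E| is at most r1 |E| up to a small error, and E is null. The argument
  covers functions with infinite values or infinite local integrals.\<close>

lemma grid_differentiation:
  fixes f :: "real^'n \<Rightarrow> ennreal"
  assumes f [measurable]: "f \<in> borel_measurable lborel"
  shows "AE x in lborel. f x \<le> (SUP i\<in>{j..}. dyadic_partition.av lborel (grid \<epsilon>) i f x)"
proof -
  interpret dyadic_partition "lborel :: (real^'n) measure" "grid \<epsilon>" "\<lambda>j. (1 / 2 powi j) ^ CARD('n)"
    by (rule dyadic_partition_grid)
  let ?s = "\<lambda>x. SUP i\<in>{j..}. av i f x"
  have [measurable]: "?s \<in> borel_measurable lborel" by measurable
  define E where "E r1 r2 Q = {x \<in> Q. ?s x \<le> ennreal r1 \<and> ennreal r2 \<le> f x}" for r1 r2 :: real and Q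
  have null: "emeasure lborel (E r1 r2 (grid \<epsilon> j x0)) = 0" if r: "0 \<le> r1" "r1 < r2" for r1 r2 x0
  proof -
    let ?E = "E r1 r2 (grid \<epsilon> j x0)"
    have Em [measurable]: "?E \<in> sets lborel"
    proof -
      have "{x \<in> space lborel. x \<in> grid \<epsilon> j x0 \<and> ?s x \<le> ennreal r1 \<and> ennreal r2 \<le> f x} \<in> sets lborel" by measurable
      then show ?thesis by (simp add: E_def)
    qed
    \<comment> \<open>Being inside one cell, the set has finite measure, which allows cancelling it
      at the end.\<close>
    have fin: "emeasure lborel ?E < top"
      using emeasure_mono[of ?E "grid \<epsilon> j x0" lborel] by (auto simp: E_def emeasure_D intro: le_less_trans)
    have eps: "ennreal r2 * emeasure lborel ?E \<le> ennreal r1 * emeasure lborel ?E + ennreal e" if e: "0 < e" for e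
    proof -
      obtain U where U: "open U" "?E \<subseteq> U" "emeasure lborel (U - ?E) < ennreal (e / (r1 + 1))"
        by (rule outer_regular_lborel[of ?E "e / (r1 + 1)"]) (use e r Em in auto)
      \<comment> \<open>Points whose cell is already contained in \<open>U\<close>; as
        \<open>U\<close> is open, these sets exhaust \<open>?E\<close>.\<close>
      define V where "V m = {x \<in> ?E. grid \<epsilon> (j + int m) x \<subseteq> U}" for m
      have Veq: "V m = ?E \<inter> (\<Union>Q\<in>{Q \<in> range (grid \<epsilon> (j + int m)). Q \<subseteq> U}. Q)" for m
        unfolding V_def using D_eq by (fastforce simp: E_def)
      have cnt: "countable {Q \<in> range (grid \<epsilon> (j + int m)). P Q}" for m P
        by (rule countable_subset[OF _ countable_range_grid]) auto
      have V [measurable]: "V m \<in> sets lborel" for m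
        unfolding Veq by (intro sets.Int sets.countable_UN' cnt) (use Em in auto)
      have le: "ennreal r2 * emeasure lborel (V m) \<le> ennreal r1 * emeasure lborel U" for m
      proof -
        let ?i = "j + int m"
        \<comment> \<open>Whole cells are taken so that averaging preserves the integral; a point of
          \<open>?E\<close> in each of them bounds its average by \<open>r1\<close>.\<close>
        define G where "G = (\<Union>Q\<in>{Q \<in> range (grid \<epsilon> ?i). Q \<subseteq> U \<and> Q \<inter> ?E \<noteq> {}}. Q)"
        have G [measurable]: "G \<in> sets lborel"
          unfolding G_def by (intro sets.countable_UN' cnt) auto
        have sat: "saturated ?i G"
          unfolding saturated_def G_def using D_eq by fastforce
        have VG: "V m \<subseteq> G"
        proof
          fix x assume "x \<in> V m"
          then have "grid \<epsilon> ?i x \<subseteq> U \<and> grid \<epsilon> ?i x \<inter> ?E \<noteq> {}" "x \<in> grid \<epsilon> ?i x"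
            using mem_D[of x ?i] unfolding V_def by blast+
          then show "x \<in> G" unfolding G_def by blast
        qed
        have GU: "G \<subseteq> U" unfolding G_def by auto
        have avG: "av ?i f x \<le> ennreal r1" if x: "x \<in> G" for x
        proof -
          obtain z y where zy: "x \<in> grid \<epsilon> ?i z" "y \<in> grid \<epsilon> ?i z" "y \<in> ?E" using x by (auto simp: G_def)
          then have "av ?i f x = av ?i f y" using av_cong by metis
          also have "\<dots> \<le> ?s y" by (intro SUP_upper) auto
          also have "\<dots> \<le> ennreal r1" using zy by (simp add: E_def)
          finally show ?thesis .
        qed
        have "ennreal r2 * emeasure lborel (V m) = (\<integral>\<^sup>+x. ennreal r2 * indicator (V m) x \<partial>lborel)"
          by (rule nn_integral_cmult_indicator[OF V, symmetric])
        also have "\<dots> \<le> (\<integral>\<^sup>+x. f x * indicator G x \<partial>lborel)"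
          using VG by (intro nn_integral_mono) (auto simp: indicator_def V_def E_def)
        also have "\<dots> = (\<integral>\<^sup>+x. av ?i f x * indicator G x \<partial>lborel)"
          by (rule nn_integral_av[symmetric]) (use sat G f in auto)
        also have "\<dots> \<le> (\<integral>\<^sup>+x. ennreal r1 * indicator G x \<partial>lborel)"
          using avG by (intro nn_integral_mono) (auto simp: indicator_def)
        also have "\<dots> = ennreal r1 * emeasure lborel G" by (rule nn_integral_cmult_indicator[OF G])
        also have "\<dots> \<le> ennreal r1 * emeasure lborel U"
          using GU U(1) by (intro mult_left_mono emeasure_mono) auto
        finally show ?thesis .
      qed
      have "(\<Union>m. V m) = ?E"
      proof
        show "?E \<subseteq> (\<Union>m. V m)"
        proof
          fix x assume x: "x \<in> ?E"
          then obtain d where d: "0 < d" "ball x d \<subseteq> U" using U by (meson open_contains_ball subsetD)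
          obtain m where m: "j \<le> m" "\<And>l. m \<le> l \<Longrightarrow> grid \<epsilon> l x \<subseteq> ball x d" by (rule grid_small[OF d(1)]) blast
          have "j + int (nat (m - j)) = m" using m(1) by simp
          then have "x \<in> V (nat (m - j))" using x m(2)[of m] d(2) unfolding V_def by auto
          then show "x \<in> (\<Union>m. V m)" by blast
        qed
      qed (auto simp: V_def)
      moreover have "incseq V"
        unfolding incseq_def V_def
      proof safe
        fix m n :: nat and x y assume "m \<le> n" "grid \<epsilon> (j + int m) x \<subseteq> U" "y \<in> grid \<epsilon> (j + int n) x"
        then show "y \<in> U" using D_nested[of "j + int m" "j + int n" x] by auto
      qed
      ultimately have "emeasure lborel ?E = (SUP m. emeasure lborel (V m))"
        using SUP_emeasure_incseq[of V lborel] V by (auto simp: image_subset_iff)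
      then have "ennreal r2 * emeasure lborel ?E = (SUP m. ennreal r2 * emeasure lborel (V m))"
        by (simp add: SUP_mult_left_ennreal)
      also have "\<dots> \<le> ennreal r1 * emeasure lborel U" by (intro SUP_least le)
      also have "emeasure lborel U = emeasure lborel ?E + emeasure lborel (U - ?E)"
        using U Em by (subst plus_emeasure) (auto intro: arg_cong[where f = "emeasure lborel"])
      also have "ennreal r1 * (emeasure lborel ?E + emeasure lborel (U - ?E)) \<le> ennreal r1 * (emeasure lborel ?E + ennreal (e / (r1 + 1)))"
        using U(3) by (intro mult_left_mono add_left_mono) auto
      also have "\<dots> \<le> ennreal r1 * emeasure lborel ?E + ennreal e"
      proof -
        have "r1 * (e / (r1 + 1)) \<le> e" using r e by (simp add: field_simps)
        then show ?thesis using r e by (simp add: distrib_left ennreal_leI flip: ennreal_mult)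
      qed
      finally show ?thesis .
    qed
    have "ennreal r2 * emeasure lborel ?E \<le> ennreal r1 * emeasure lborel ?E"
      by (rule ennreal_le_epsilon) (rule eps)
    then have "emeasure lborel ?E * ennreal r2 \<le> emeasure lborel ?E * ennreal r1" by (simp add: mult.commute)
    then show ?thesis
      using r fin by (cases "emeasure lborel ?E = 0") (auto simp: ennreal_mult_le_mult_iff ennreal_le_iff)
  qed
  \<comment> \<open>Rational levels and the countably many cells of generation \<open>j\<close>
    reduce the exceptional set to countably many null sets.\<close>
  have "{x. \<not> f x \<le> ?s x} \<subseteq> (\<Union>Q\<in>range (grid \<epsilon> j). \<Union>r1\<in>\<rat> \<inter> {0..}. \<Union>r2\<in>\<rat> \<inter> {r1<..}. E r1 r2 Q)"
  proof
    fix x assume "x \<in> {x. \<not> f x \<le> ?s x}"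
    then have lt: "?s x < f x" by (simp add: not_le)
    then obtain c where c: "?s x < c" "c < f x" using dense by blast
    obtain b where b: "?s x < b" "b < c" using dense[OF c(1)] by blast
    define r1' where "r1' = enn2real b"
    define r2' where "r2' = enn2real c"
    have cb: "c < top" "b < top" using b c by (auto intro: order.strict_trans2)
    then have r': "b = ennreal r1'" "c = ennreal r2'" "0 \<le> r1'"
      by (auto simp: r1'_def r2'_def)
    then have lt': "r1' < r2'" using b(2) by (simp add: ennreal_less_iff)
    then obtain r2 where r2: "r2 \<in> \<rat>" "r1' < r2" "r2 < r2'" using Rats_dense_in_real by blast
    then obtain r1 where r1: "r1 \<in> \<rat>" "r1' < r1" "r1 < r2" using Rats_dense_in_real by blast
    have "b \<le> ennreal r1" unfolding r' using r1 by (intro ennreal_leI) simp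
    then have "?s x \<le> ennreal r1" using b by auto
    moreover have "ennreal r2 \<le> c" unfolding r' using r2 by (intro ennreal_leI) simp
    then have "ennreal r2 \<le> f x" using c by auto
    ultimately have "x \<in> E r1 r2 (grid \<epsilon> j x)" by (simp add: E_def)
    then show "x \<in> (\<Union>Q\<in>range (grid \<epsilon> j). \<Union>r1\<in>\<rat> \<inter> {0..}. \<Union>r2\<in>\<rat> \<inter> {r1<..}. E r1 r2 Q)"
      using r1 r2 r'(3) by (intro UN_I[of "grid \<epsilon> j x"] UN_I[of r1] UN_I[of r2]) auto
  qed
  moreover have "(\<Union>Q\<in>range (grid \<epsilon> j). \<Union>r1\<in>\<rat> \<inter> {0..}. \<Union>r2\<in>\<rat> \<inter> {r1<..}. E r1 r2 Q) \<in> null_sets lborel"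
  proof (intro null_sets_UN' countable_range_grid countable_Int1 countable_rat)
    fix Q and r1 r2 :: real assume "Q \<in> range (grid \<epsilon> j)" "r1 \<in> \<rat> \<inter> {0..}" "r2 \<in> \<rat> \<inter> {r1<..}"
    then obtain x0 where Q: "Q = grid \<epsilon> j x0" and r: "0 \<le> r1" "r1 < r2" by auto
    have "{x \<in> space lborel. x \<in> grid \<epsilon> j x0 \<and> ?s x \<le> ennreal r1 \<and> ennreal r2 \<le> f x} \<in> sets lborel" by measurable
    then have "E r1 r2 Q \<in> sets lborel" by (simp add: E_def Q)
    then show "E r1 r2 Q \<in> null_sets lborel"
      using null[OF r, of x0] by (simp add: Q null_sets_def)
  qed
  ultimately show ?thesis by (intro AE_I') auto
qed

lemma dyadic_filtration_grid:
  "dyadic_filtration (lborel :: (real^'n) measure) (grid \<epsilon>) (\<lambda>j. (1 / 2 powi j) ^ CARD('n)) (2 ^ CARD('n))"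
proof -
  interpret dyadic_partition "lborel :: (real^'n) measure" "grid \<epsilon>" "\<lambda>j. (1 / 2 powi j) ^ CARD('n)"
    by (rule dyadic_partition_grid)
  show ?thesis
  proof
    show "(1 / 2 powi j) ^ CARD('n) \<le> 2 ^ CARD('n) * (1 / (2::real) powi (j + 1)) ^ CARD('n)" for j
      by (simp add: power_int_add flip: power_mult_distrib)
    show "AE x in lborel. f x \<le> (SUP i\<in>{j..}. av i f x)" if "f \<in> borel_measurable lborel" for f j
      using that by (rule grid_differentiation)
  qed
qed

text \<open>One-third trick: an interval of length at most \<open>1/3\<close> and its translate by \<open>1/3\<close> do not both contain integers.\<close>

lemma floor_one_third:
  fixes u w :: real
  assumes w: "0 \<le> w" "w \<le> 1 / 3" and ne: "\<lfloor>u\<rfloor> \<noteq> \<lfloor>u + w\<rfloor>" and o: "t = 1 / 3 \<or> t = - 1 / 3"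
  shows "\<lfloor>u + t\<rfloor> = \<lfloor>u + w + t\<rfloor>"
proof -
  define m where "m = \<lfloor>u + w\<rfloor>"
  have "\<lfloor>u\<rfloor> \<le> m" unfolding m_def using w by (intro floor_mono) simp
  then have "\<lfloor>u\<rfloor> + 1 \<le> m" using ne unfolding m_def by linarith
  then have "u < of_int m" by linarith
  moreover have "of_int m \<le> u + w" unfolding m_def by simp
  ultimately have m: "u < of_int m" "of_int m \<le> u + w" by auto
  from o show ?thesis
  proof
    assume t: "t = 1 / 3"
    have "\<lfloor>u + t\<rfloor> = m" "\<lfloor>u + w + t\<rfloor> = m" using m w t by (auto intro!: floor_unique)
    then show ?thesis by simp
  next
    assume t: "t = - 1 / 3"
    have "\<lfloor>u + t\<rfloor> = m - 1" "\<lfloor>u + w + t\<rfloor> = m - 1" using m w t by (auto intro!: floor_unique)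
    then show ?thesis by simp
  qed
qed

text \<open>The scale is chosen so that the side of the cube is between 1/6 and 1/3 of that of a
  cell. In a coordinate where the unshifted grid cuts the cube, the shift by a third avoids the cut.
  Each coordinate decides on its own, which is why a grid is needed for every subset of the
  coordinates.\<close>

lemma cube_in_grid:
  fixes a :: "real^'n"
  assumes r: "0 < r"
  obtains \<epsilon> j where "\<And>x. x \<in> cbox a (\<chi> i. a $ i + r) \<Longrightarrow> cbox a (\<chi> i. a $ i + r) \<subseteq> grid \<epsilon> j x"
    "1 / 2 powi j \<le> 6 * r"
proof -
  define j where "j = \<lfloor>log 2 (1 / (3 * r))\<rfloor>"
  have pj: "2 powr real_of_int j = 2 powi j" for j by (rule powr_real_of_int') auto
  have "2 powr real_of_int j \<le> 2 powr log 2 (1 / (3 * r))" unfolding j_def by (intro powr_mono) auto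
  then have 1: "2 powi j * r \<le> 1 / 3" using r by (simp add: pj field_simps)
  have "2 powr log 2 (1 / (3 * r)) < 2 powr real_of_int (j + 1)" unfolding j_def by (intro powr_less_mono) linarith+
  then have "1 / (3 * r) < 2 powi (j + 1)" using r unfolding pj by simp
  then have 2: "1 / 2 powi j \<le> 6 * r" using r by (simp add: power_int_add field_simps)
  define \<epsilon> where "\<epsilon> i = (\<lfloor>2 powi j * a $ i\<rfloor> \<noteq> \<lfloor>2 powi j * a $ i + 2 powi j * r\<rfloor>)" for i
  have ends: "\<lfloor>2 powi j * a $ i + grid_offset \<epsilon> j i\<rfloor> = \<lfloor>2 powi j * a $ i + 2 powi j * r + grid_offset \<epsilon> j i\<rfloor>" for i
  proof (cases "\<epsilon> i")
    case True
    then show ?thesis using 1 r by (intro floor_one_third) (auto simp: \<epsilon>_def grid_offset_def)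
  qed (auto simp: \<epsilon>_def grid_offset_def)
  have idx: "grid_index \<epsilon> j x i = \<lfloor>2 powi j * a $ i + grid_offset \<epsilon> j i\<rfloor>" if "x \<in> cbox a (\<chi> i. a $ i + r)" for x i
  proof -
    have x: "a $ i \<le> x $ i" "x $ i \<le> a $ i + r" using that by (auto simp: mem_box_cart)
    have "2 powi j * a $ i \<le> 2 powi j * x $ i" using x by (intro mult_left_mono) auto
    moreover have "2 powi j * x $ i \<le> 2 powi j * (a $ i + r)" using x by (intro mult_left_mono) auto
    ultimately have "\<lfloor>2 powi j * a $ i + grid_offset \<epsilon> j i\<rfloor> \<le> grid_index \<epsilon> j x i"
      "grid_index \<epsilon> j x i \<le> \<lfloor>2 powi j * a $ i + 2 powi j * r + grid_offset \<epsilon> j i\<rfloor>"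
      unfolding grid_index_def by (auto intro!: floor_mono simp: distrib_left)
    then show ?thesis using ends[of i] by simp
  qed
  have "cbox a (\<chi> i. a $ i + r) \<subseteq> grid \<epsilon> j x" if "x \<in> cbox a (\<chi> i. a $ i + r)" for x
    using idx[OF that] idx by (auto simp: grid_def fun_eq_iff)
  then show ?thesis using 2 by (rule that)
qed

subsection \<open>Spectral calculus\<close>

text \<open>The Hermitian product, linear in the second argument. Its real part is the built-in
  inner product, but unitary matrices of eigenvectors require the imaginary part to vanish as
  well.\<close>

definition hip :: "complex^'d \<Rightarrow> complex^'d \<Rightarrow> complex" where
  "hip u v = (\<Sum>i\<in>UNIV. cnj (u $ i) * v $ i)"

lemma Re_hip: "Re (hip u v) = u \<bullet> v"
  by (simp add: hip_def inner_vec_def inner_complex_def)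

lemma Im_hip: "Im (hip u v) = (\<i> *s u) \<bullet> v"
  by (simp add: hip_def inner_vec_def inner_complex_def algebra_simps)

lemma hip_adj: "hip u (A *v v) = hip (adj A *v u) v"
proof -
  have "hip u (A *v v) = (\<Sum>i\<in>UNIV. \<Sum>j\<in>UNIV. cnj (u $ i) * (A $ i $ j * v $ j))"
    by (simp add: hip_def matrix_vector_mult_def sum_distrib_left)
  also have "\<dots> = (\<Sum>j\<in>UNIV. \<Sum>i\<in>UNIV. cnj (u $ i) * (A $ i $ j * v $ j))"
    by (rule sum.swap)
  also have "\<dots> = hip (adj A *v u) v"
    by (simp add: hip_def matrix_vector_mult_def adj_def map_matrix_def transpose_def sum_distrib_right)
       (simp add: mult_ac)
  finally show ?thesis .
qed

lemma hip_scale: "hip (c *s u) v = cnj c * hip u v" "hip u (c *s v) = c * hip u v"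
  by (simp add: hip_def sum_distrib_left mult.assoc) (simp add: hip_def sum_distrib_left mult.left_commute)

lemma hip_scaleR: "hip u (a *\<^sub>R v) = of_real a * hip u v"
proof -
  have "(a *\<^sub>R v) $ i = of_real a * v $ i" for i
    by (simp only: vector_scaleR_component) (simp add: scaleR_conv_of_real)
  then show ?thesis by (simp add: hip_def sum_distrib_left mult.left_commute)
qed

lemma hip_add: "hip u (v + w) = hip u v + hip u w"
  by (simp add: hip_def sum.distrib distrib_left)

lemma hip_commute: "hip v u = cnj (hip u v)"
  by (simp add: hip_def mult.commute)

lemma inner_hermitian: "hermitian A \<Longrightarrow> u \<bullet> (A *v v) = (A *v u) \<bullet> v"
  using hip_adj[of u A v] by (simp add: hermitian_def flip: Re_hip)

text \<open>The first-order condition at a maximum, tested with t = a/c for a large c, where the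
  linear term dominates.\<close>

lemma linear_vanishes_if_le_quadratic:
  fixes a b :: real
  assumes "\<And>t. 2 * t * a \<le> t\<^sup>2 * b"
  shows "a = 0"
proof (rule ccontr)
  assume a: "a \<noteq> 0"
  define c where "c = \<bar>b\<bar> + 1"
  have c: "0 < c" "b \<le> c" by (auto simp: c_def)
  let ?t = "a / c"
  have "2 * ?t * a \<le> ?t\<^sup>2 * b" by (rule assms)
  also have "\<dots> \<le> ?t\<^sup>2 * c" using c by (intro mult_left_mono) auto
  also have "\<dots> = ?t * a" using c by (simp add: power2_eq_square)
  finally have "?t * a \<le> 0" by simp
  moreover have "0 < a * a" using a not_real_square_gt_zero by blast
  then have "?t * a > 0" using c by simp
  ultimately show False by simp
qed

text \<open>The quadratic form has a maximum on the unit sphere of the orthogonal complement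
  \<open>E\<close> of the given eigenvectors, and a maximiser is an eigenvector. \<open>E\<close> is
  invariant under \<open>A\<close>, so the variation in the direction of the residual stays in
  \<open>E\<close>.\<close>

lemma hermitian_eigenvector:
  fixes A :: "complex^'d^'d"
  assumes A: "hermitian A" and S: "finite S" "card S < CARD('d)"
    and eig: "\<And>i. i \<in> S \<Longrightarrow> A *v u i = of_real (l i) *s u i"
  obtains w \<mu> where "A *v w = of_real \<mu> *s w" "norm w = 1" "\<And>i. i \<in> S \<Longrightarrow> hip (u i) w = 0"
proof -
  define E where "E = {v. \<forall>i\<in>S. hip (u i) v = 0}"
  \<comment> \<open>Complex orthogonality to a vector is real orthogonality to it and to its
    multiple by the imaginary unit. \<open>?B\<close> has at most twice \<open>card S\<close>
    elements, fewer than the real dimension, so a nonzero orthogonal vector exists.\<close>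
  let ?B = "u ` S \<union> (\<lambda>i. \<i> *s u i) ` S"
  have "dim (span ?B) \<le> card ?B" using S by (simp add: dim_le_card')
  also have "\<dots> \<le> card (u ` S) + card ((\<lambda>i. \<i> *s u i) ` S)" by (rule card_Un_le)
  also have "\<dots> \<le> card S + card S" using S by (intro add_mono card_image_le)
  also have "\<dots> < DIM(complex^'d)" using S by simp
  finally have "dim ?B < DIM(complex^'d)" by (simp only: dim_span)
  then obtain x where x: "x \<noteq> 0" "\<And>y. y \<in> span ?B \<Longrightarrow> orthogonal x y"
    by (rule orthogonal_to_subspace_exists) blast
  have xE: "hip (u i) x = 0" if "i \<in> S" for i
  proof -
    have "orthogonal x (u i)" "orthogonal x (\<i> *s u i)" using that by (auto intro!: x(2) span_base)
    then show ?thesis by (simp add: complex_eq_iff Re_hip Im_hip orthogonal_def inner_commute)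
  qed
  have Esub: "a *\<^sub>R v + b *\<^sub>R w \<in> E" if "v \<in> E" "w \<in> E" for a b v w
    using that by (simp add: E_def hip_add hip_scaleR)
  have "closed E"
  proof -
    have "E = (\<Inter>i\<in>S. {v. hip (u i) v = 0})" by (auto simp: E_def)
    then show ?thesis
      unfolding hip_def by (simp only:) (intro closed_INT ballI closed_Collect_eq continuous_intros)
  qed
  then have "compact (E \<inter> sphere 0 1)" by (intro closed_Int_compact) auto
  moreover have "(1 / norm x) *\<^sub>R x \<in> E \<inter> sphere 0 1"
    using Esub[of x x "1 / norm x" 0] xE x(1) by (simp add: E_def)
  then have "E \<inter> sphere 0 1 \<noteq> {}" by blast
  moreover have "continuous_on (E \<inter> sphere 0 1) (\<lambda>v. v \<bullet> (A *v v))"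
    by (intro continuous_intros linear_continuous_on matrix_vector_mul_bounded_linear)
  ultimately have "\<exists>w\<in>E \<inter> sphere 0 1. \<forall>v\<in>E \<inter> sphere 0 1. v \<bullet> (A *v v) \<le> w \<bullet> (A *v w)"
    by (rule continuous_attains_sup)
  then obtain w where "w \<in> E \<inter> sphere 0 1" and max': "\<forall>v\<in>E \<inter> sphere 0 1. v \<bullet> (A *v v) \<le> w \<bullet> (A *v w)" by blast
  then have w: "w \<in> E" "norm w = 1" by auto
  have max: "v \<bullet> (A *v v) \<le> w \<bullet> (A *v w)" if "v \<in> E" "norm v = 1" for v
    using max' that by auto
  define \<mu> where "\<mu> = w \<bullet> (A *v w)"
  have Asc: "A *v (a *\<^sub>R v) = a *\<^sub>R (A *v v)" for a v
    by (simp add: vec_eq_iff matrix_vector_mult_def scaleR_sum_right)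
  have quad: "v \<bullet> (A *v v) \<le> \<mu> * (v \<bullet> v)" if v: "v \<in> E" for v
  proof (cases "v = 0")
    case False
    let ?c = "1 / norm v"
    have "(?c *\<^sub>R v) \<bullet> (A *v (?c *\<^sub>R v)) \<le> \<mu>"
      unfolding \<mu>_def using Esub[OF v v, of ?c 0] False by (intro max) auto
    then have "(v \<bullet> (A *v v)) / (norm v)\<^sup>2 \<le> \<mu>"
      by (simp add: Asc power2_eq_square)
    then show ?thesis using False by (simp add: field_simps dot_square_norm)
  qed (simp add: \<mu>_def)
  let ?z = "A *v w - \<mu> *\<^sub>R w"
  have "A *v w \<in> E"
    using A w(1) unfolding E_def hermitian_def
    by (auto simp: hip_adj eig hip_scale)
  then have zE: "?z \<in> E" using Esub[of "A *v w" w 1 "- \<mu>"] w by simp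
  have expand: "(u + t *\<^sub>R v) \<bullet> (a + t *\<^sub>R b) = u \<bullet> a + t * (u \<bullet> b) + t * (v \<bullet> a) + t\<^sup>2 * (v \<bullet> b)"
    for u v a b :: "complex^'d" and t
    by (simp add: inner_add_left inner_add_right power2_eq_square distrib_left)
  \<comment> \<open>Maximality on the line through \<open>w\<close> in the direction of the residual
    \<open>z\<close>. The linear coefficient is the squared norm of \<open>z\<close>, so
    \<open>z\<close> has to vanish.\<close>
  have "2 * t * (z \<bullet> z) \<le> t\<^sup>2 * (\<mu> * (z \<bullet> z) - z \<bullet> (A *v z))" if z: "z = ?z" for t z
  proof -
    have "(w + t *\<^sub>R z) \<bullet> (A *v (w + t *\<^sub>R z)) \<le> \<mu> * ((w + t *\<^sub>R z) \<bullet> (w + t *\<^sub>R z))"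
      using quad[OF Esub[OF w(1) zE, of 1 t]] z by simp
    then have "\<mu> + t * (w \<bullet> (A *v z)) + t * (z \<bullet> (A *v w)) + t\<^sup>2 * (z \<bullet> (A *v z))
      \<le> \<mu> * (w \<bullet> w + t * (w \<bullet> z) + t * (z \<bullet> w) + t\<^sup>2 * (z \<bullet> z))"
      by (simp only: matrix_vector_right_distrib Asc expand \<mu>_def)
    moreover have "w \<bullet> (A *v z) = z \<bullet> (A *v w)" using inner_hermitian[OF A, of w z] by (simp add: inner_commute)
    moreover have "w \<bullet> w = 1" "w \<bullet> z = z \<bullet> w" using w(2) by (simp_all add: dot_square_norm inner_commute)
    ultimately have 1: "\<mu> + t * (z \<bullet> (A *v w)) + t * (z \<bullet> (A *v w)) + t\<^sup>2 * (z \<bullet> (A *v z))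
      \<le> \<mu> * (1 + t * (z \<bullet> w) + t * (z \<bullet> w) + t\<^sup>2 * (z \<bullet> z))" by simp
    have "z \<bullet> z = z \<bullet> (A *v w) - \<mu> * (z \<bullet> w)"
      using arg_cong[OF z, of "\<lambda>y. z \<bullet> y"] by (simp only: inner_diff_right inner_scaleR_right)
    then have 2: "2 * t * (z \<bullet> z) = 2 * (t * (z \<bullet> (A *v w))) - 2 * (\<mu> * (t * (z \<bullet> w)))"
      by (simp only: right_diff_distrib mult_ac)
    have 3: "\<mu> * (1 + t * (z \<bullet> w) + t * (z \<bullet> w) + t\<^sup>2 * (z \<bullet> z)) = \<mu> + 2 * (\<mu> * (t * (z \<bullet> w))) + \<mu> * (t\<^sup>2 * (z \<bullet> z))"
      by (simp add: distrib_left)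
    have 4: "t\<^sup>2 * (\<mu> * (z \<bullet> z) - z \<bullet> (A *v z)) = \<mu> * (t\<^sup>2 * (z \<bullet> z)) - t\<^sup>2 * (z \<bullet> (A *v z))"
      by (simp only: right_diff_distrib mult.left_commute)
    have "m + x + x + y \<le> m + 2 * c + u \<Longrightarrow> 2 * x - 2 * c \<le> u - y" for m x y c u :: real by simp
    then show ?thesis using 1 unfolding 2 3 4 .
  qed
  from this[OF refl] have "?z \<bullet> ?z = 0" by (rule linear_vanishes_if_le_quadratic)
  then have "A *v w = \<mu> *\<^sub>R w" by simp
  also have "\<mu> *\<^sub>R w = of_real \<mu> *s w" by (simp only: vec_eq_iff vector_scaleR_component vector_smult_component) (simp add: scaleR_conv_of_real)
  finally show ?thesis using w by (intro that[of w \<mu>]) (auto simp: E_def)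
qed

lemma spectral_theorem:
  fixes A :: "complex^'d^'d"
  assumes A: "hermitian A"
  obtains U l where "unitary U" "A = U ** diag l ** adj U"
proof -
  have "\<exists>u l. \<forall>i\<in>S. A *v u i = of_real (l i) *s u i \<and> (\<forall>j\<in>S. hip (u i) (u j) = (if i = j then 1 else 0))" for S :: "'d set"
  proof (induction S rule: finite_induct[OF finite])
    case (2 k S)
    then obtain u l where eig: "\<And>i. i \<in> S \<Longrightarrow> A *v u i = of_real (l i) *s u i"
      and orth: "\<And>i j. i \<in> S \<Longrightarrow> j \<in> S \<Longrightarrow> hip (u i) (u j) = (if i = j then 1 else 0)" by blast
    have cS: "card S < CARD('d)" using 2 by (intro psubset_card_mono) auto
    obtain w \<mu> where w: "A *v w = of_real \<mu> *s w" "norm w = 1" "\<And>i. i \<in> S \<Longrightarrow> hip (u i) w = 0"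
      by (rule hermitian_eigenvector[OF A 2(1) cS, of u l]) (use eig in auto)
    have ww: "hip w w = 1"
    proof -
      have "hip w w = cnj (hip w w)" by (rule hip_commute)
      then have "Im (hip w w) = 0" by (simp add: complex_eq_iff)
      then show ?thesis using w(2) by (simp add: complex_eq_iff Re_hip dot_square_norm)
    qed
    have wu: "hip w (u i) = 0" if "i \<in> S" for i using w(3)[OF that] hip_commute[of w "u i"] by simp
    show ?case
      by (intro exI[of _ "u(k := w)"] exI[of _ "l(k := \<mu>)"]) (use 2(2) eig orth w ww wu in auto)
  qed auto
  from this[of UNIV] obtain u and l :: "'d \<Rightarrow> real" where ul: "\<forall>i :: 'd. A *v u i = of_real (l i) *s u i \<and> (\<forall>j :: 'd. hip (u i) (u j) = (if i = j then 1 else 0))"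
    by auto
  then have eig: "\<And>i. A *v u i = of_real (l i) *s u i"
    and orth: "\<And>i j. hip (u i) (u j) = (if i = j then 1 else 0)" by blast+
  define U where "U = (\<chi> i j. u j $ i)"
  have UU: "adj U ** U = mat 1"
    using orth by (simp add: vec_eq_iff matrix_matrix_mult_def adj_def map_matrix_def transpose_def U_def mat_def hip_def)
  then have UU': "U ** adj U = mat 1" using matrix_left_right_inverse by blast
  have "A ** U = U ** diag l"
  proof -
    have "(A ** U) $ i $ j = (A *v u j) $ i" for i j
      by (simp add: matrix_matrix_mult_def matrix_vector_mult_def U_def)
    moreover have "(U ** diag l) $ i $ j = u j $ i * of_real (l j)" for i j
      by (simp add: matrix_matrix_mult_def diag_def U_def if_distrib cong: if_cong)
    ultimately show ?thesis by (simp add: vec_eq_iff eig mult.commute)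
  qed
  then have "A ** (U ** adj U) = U ** diag l ** adj U" by (simp add: matrix_mul_assoc)
  then show ?thesis using UU UU' by (intro that[of U l]) (auto simp: unitary_def)
qed

lemma positive_definite_diagonalize:
  fixes A :: "complex^'d^'d"
  assumes A: "positive_definite A"
  obtains U l where "unitary U" "\<And>i. 0 < l i" "A = U ** diag l ** adj U"
proof -
  obtain U l where U: "unitary U" and AU: "A = U ** diag l ** adj U"
    using spectral_theorem A by (auto simp: positive_definite_def)
  have "0 < l i" for i
  proof -
    let ?v = "U *v axis i 1"
    have e: "adj U *v ?v = axis i 1"
      using U by (simp add: unitary_def matrix_vector_mul_assoc)
    have d: "diag l *v axis i 1 = of_real (l i) *s (axis i 1 :: complex^'d)"
      by (simp only: matrix_mult_axis) (auto simp: column_def diag_def vec_eq_iff axis_def)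
    have "A *v ?v = of_real (l i) *s ?v"
      unfolding AU by (simp add: e d vector_scalar_commute flip: matrix_vector_mul_assoc)
    also have "of_real (l i) *s ?v = l i *\<^sub>R ?v"
      by (simp only: vec_eq_iff vector_scaleR_component vector_smult_component) (simp add: scaleR_conv_of_real)
    finally have "?v \<bullet> (A *v ?v) = l i * (?v \<bullet> ?v)" by simp
    moreover have "?v \<noteq> 0"
    proof
      assume "?v = 0"
      then have "axis i 1 = (0 :: complex^'d)" using e by simp
      then show False using norm_axis_complex[of i] by (metis norm_zero zero_neq_one)
    qed
    ultimately show ?thesis
      using A by (metis inner_gt_zero_iff positive_definite_def zero_less_mult_pos2)
  qed
  then show ?thesis using U AU by (intro that)
qed

section \<open>Inverses and measurability of matrix powers\<close>

lemma diag_mult: "diag (\<lambda>i. f i * g i) = diag f ** diag g"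
proof -
  have "(diag f ** diag g) $ i $ j = (\<Sum>k\<in>UNIV. if i = k then (if k = j then complex_of_real (f i) * complex_of_real (g k) else 0) else 0)" for i j
    unfolding matrix_matrix_mult_def diag_def vec_lambda_beta by (intro sum.cong) auto
  then have "(diag f ** diag g) $ i $ j = (if i = j then complex_of_real (f i * g i) else 0)" for i j
    by simp
  then show ?thesis by (simp add: vec_eq_iff) (simp add: diag_def)
qed

lemma diag_add: "diag (\<lambda>i. f i + g i) = diag f + diag g"
  by (simp add: vec_eq_iff diag_def)

lemma diag_const: "diag (\<lambda>_. c) = c *\<^sub>R mat 1"
  by (simp only: vec_eq_iff vector_scaleR_component) (simp add: diag_def mat_def scaleR_conv_of_real)

lemma diag_cmult: "diag (\<lambda>i. c * f i) = c *\<^sub>R diag f"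
  by (simp only: vec_eq_iff vector_scaleR_component) (simp add: diag_def scaleR_conv_of_real)

lemma mat_powr_inverse:
  fixes A :: "complex^'d^'d"
  assumes "positive_definite A"
  shows "mat_powr A s ** mat_powr A (- s) = mat 1"
proof -
  obtain U l where U: "unitary U" and l: "\<And>i. 0 < l i" and A: "A = U ** diag l ** adj U"
    by (rule positive_definite_diagonalize[OF assms]) blast
  have D: "diag (\<lambda>i. l i powr s) ** diag (\<lambda>i. l i powr - s) = (mat 1 :: complex^'d^'d)"
  proof -
    have "l i powr s * l i powr - s = 1" for i using l[of i] by (simp flip: powr_add)
    then have "diag (\<lambda>i. l i powr s * l i powr - s) = (1 :: real) *\<^sub>R (mat 1 :: complex^'d^'d)"
      by (simp only: diag_const)
    then show ?thesis by (simp only: diag_mult scaleR_one)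
  qed
  have "mat_powr A s ** mat_powr A (- s) = U ** diag (\<lambda>i. l i powr s) ** (adj U ** U) ** diag (\<lambda>i. l i powr - s) ** adj U"
    by (simp add: mat_powr_eqI[OF U l A] matrix_mul_assoc)
  also have "\<dots> = U ** (diag (\<lambda>i. l i powr s) ** diag (\<lambda>i. l i powr - s)) ** adj U"
    using U by (simp add: unitary_def) (simp add: matrix_mul_assoc)
  also have "\<dots> = mat 1" using U by (simp add: D unitary_def)
  finally show ?thesis .
qed

lemma matrix_mult_scaleR: "A ** (c *\<^sub>R B) = c *\<^sub>R (A ** B)" "(c *\<^sub>R A) ** B = c *\<^sub>R (A ** B)"
  for A B :: "complex^'d^'d"
  by (simp_all add: vec_eq_iff matrix_matrix_mult_def scaleR_sum_right)

lemma matrix_mult_add: "A ** (B + C) = A ** B + A ** C" "(A + B) ** C = A ** C + B ** C"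
  for A B C :: "complex^'d^'d"
  by (simp_all add: vec_eq_iff matrix_matrix_mult_def distrib_left distrib_right sum.distrib)

text \<open>For a polynomial the spectral calculus is the polynomial of the matrix itself, hence
  continuous in the matrix and independent of the diagonalization.\<close>

lemma polynomial_matrix_calculus:
  assumes "real_polynomial_function (g :: real \<Rightarrow> real)"
  shows "\<exists>G :: complex^'d^'d \<Rightarrow> complex^'d^'d. continuous_on UNIV G \<and>
    (\<forall>U l. unitary U \<longrightarrow> G (U ** diag l ** adj U) = U ** diag (\<lambda>i. g (l i)) ** adj U)"
  using assms
proof (induction rule: real_polynomial_function.induct)
  case (linear f)
  interpret bounded_linear f by fact
  have f: "f t = f 1 * t" for t using scaleR[of t 1] by simp
  have "f 1 *\<^sub>R (U ** diag l ** adj U) = U ** diag (\<lambda>i. f (l i)) ** adj U" for U :: "complex^'d^'d" and l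
    unfolding f[of "l _"] by (simp add: diag_cmult matrix_mult_scaleR)
  then show ?case by (intro exI[of _ "\<lambda>A. f 1 *\<^sub>R A"] conjI continuous_intros) auto
next
  case (const c)
  have "c *\<^sub>R mat 1 = U ** diag (\<lambda>_. c) ** adj U" if "unitary U" for U :: "complex^'d^'d"
    using that by (simp add: diag_const matrix_mult_scaleR unitary_def)
  then show ?case by (intro exI[of _ "\<lambda>A. c *\<^sub>R mat 1"] conjI continuous_intros) auto
next
  case (add f g)
  then obtain F G :: "complex^'d^'d \<Rightarrow> complex^'d^'d" where "continuous_on UNIV F" "continuous_on UNIV G"
    and "\<And>U l. unitary U \<Longrightarrow> F (U ** diag l ** adj U) = U ** diag (\<lambda>i. f (l i)) ** adj U"
    and "\<And>U l. unitary U \<Longrightarrow> G (U ** diag l ** adj U) = U ** diag (\<lambda>i. g (l i)) ** adj U"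
    by blast
  then show ?case
    by (intro exI[of _ "\<lambda>A. F A + G A"] conjI continuous_intros) (auto simp: diag_add matrix_mult_add)
next
  case (mult f g)
  then obtain F G :: "complex^'d^'d \<Rightarrow> complex^'d^'d" where FG: "continuous_on UNIV F" "continuous_on UNIV G"
    and F: "\<And>U l. unitary U \<Longrightarrow> F (U ** diag l ** adj U) = U ** diag (\<lambda>i. f (l i)) ** adj U"
    and G: "\<And>U l. unitary U \<Longrightarrow> G (U ** diag l ** adj U) = U ** diag (\<lambda>i. g (l i)) ** adj U"
    by blast
  have "F (U ** diag l ** adj U) ** G (U ** diag l ** adj U) = U ** diag (\<lambda>i. f (l i) * g (l i)) ** adj U"
    if U: "unitary U" for U l
  proof -
    have "F (U ** diag l ** adj U) ** G (U ** diag l ** adj U)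
      = U ** diag (\<lambda>i. f (l i)) ** (adj U ** U) ** diag (\<lambda>i. g (l i)) ** adj U"
      by (simp add: F[OF U] G[OF U] matrix_mul_assoc)
    also have "\<dots> = U ** (diag (\<lambda>i. f (l i)) ** diag (\<lambda>i. g (l i))) ** adj U"
      using U by (simp add: unitary_def) (simp add: matrix_mul_assoc)
    finally show ?thesis by (simp add: diag_mult)
  qed
  moreover have "continuous_on UNIV (\<lambda>A. F A ** G A)"
    unfolding matrix_matrix_mult_def using FG by (intro continuous_intros)
  ultimately show ?case by (intro exI[of _ "\<lambda>A. F A ** G A"]) auto
qed

text \<open>Polynomials within 1/(n+1) of t^s on [1/(n+1), n+1] converge to t^s at every positive t.
  So the matrix power is a pointwise limit of continuous functions of the matrix, and its
  measurability does not require a measurable choice of eigenvectors.\<close>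

lemma mat_powr_limit:
  obtains G :: "nat \<Rightarrow> complex^'d^'d \<Rightarrow> complex^'d^'d" where
    "\<And>n. continuous_on UNIV (G n)" "\<And>A. positive_definite A \<Longrightarrow> (\<lambda>n. G n A) \<longlonglongrightarrow> mat_powr A s"
proof -
  have "\<exists>g. real_polynomial_function g \<and> (\<forall>t\<in>{1 / real (Suc n)..real (Suc n)}. \<bar>t powr s - g t\<bar> < 1 / real (Suc n))" for n
  proof -
    have "continuous_on {1 / real (Suc n)..real (Suc n)} (\<lambda>t. t powr s)"
    proof (intro continuous_intros ballI)
      fix t assume "t \<in> {1 / real (Suc n)..real (Suc n)}"
      moreover have "0 < 1 / real (Suc n)" by simp
      ultimately show "t \<noteq> 0" by (metis atLeastAtMost_iff not_less)
    qed
    then show ?thesis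
      using Stone_Weierstrass_real_polynomial_function[of "{1 / real (Suc n)..real (Suc n)}" "\<lambda>t. t powr s" "1 / real (Suc n)"]
      by (metis compact_Icc of_nat_0_less_iff zero_less_Suc zero_less_divide_1_iff)
  qed
  then obtain g where g: "\<And>n. real_polynomial_function (g n)"
    "\<And>n t. t \<in> {1 / real (Suc n)..real (Suc n)} \<Longrightarrow> \<bar>t powr s - g n t\<bar> < 1 / real (Suc n)" by metis
  obtain G :: "nat \<Rightarrow> complex^'d^'d \<Rightarrow> complex^'d^'d" where G: "\<And>n. continuous_on UNIV (G n)"
    "\<And>n U l. unitary U \<Longrightarrow> G n (U ** diag l ** adj U) = U ** diag (\<lambda>i. g n (l i)) ** adj U"
    using polynomial_matrix_calculus[OF g(1)] by metis
  have lim: "(\<lambda>n. g n t) \<longlonglongrightarrow> t powr s" if t: "0 < t" for t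
  proof -
    have inv0: "(\<lambda>n. 1 / real (Suc n)) \<longlonglongrightarrow> 0" using LIMSEQ_inverse_real_of_nat by (simp add: inverse_eq_divide)
    have "eventually (\<lambda>n. 1 / real (Suc n) < t) sequentially" using order_tendstoD(2)[OF inv0 t] .
    moreover have "eventually (\<lambda>n. t \<le> real (Suc n)) sequentially"
      by (rule eventually_sequentiallyI[of "nat \<lceil>t\<rceil>"]) linarith
    ultimately have "eventually (\<lambda>n. norm (g n t - t powr s) \<le> 1 / real (Suc n)) sequentially"
      by eventually_elim (use g(2) in \<open>force simp: abs_minus_commute intro: less_imp_le\<close>)
    then have "(\<lambda>n. g n t - t powr s) \<longlonglongrightarrow> 0" by (rule Lim_null_comparison[OF _ inv0])
    then show ?thesis by (simp add: LIM_zero_iff)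
  qed
  have "(\<lambda>n. G n A) \<longlonglongrightarrow> mat_powr A s" if A: "positive_definite A" for A
  proof -
    obtain U l where U: "unitary U" and l: "\<And>i. 0 < l i" and AU: "A = U ** diag l ** adj U"
      by (rule positive_definite_diagonalize[OF A]) blast
    have "(\<lambda>n. diag (\<lambda>i. g n (l i)) :: complex^'d^'d) \<longlonglongrightarrow> diag (\<lambda>i. l i powr s)"
      unfolding diag_def by (intro vec_tendstoI) (auto intro!: tendsto_intros lim l)
    then have "(\<lambda>n. U ** diag (\<lambda>i. g n (l i)) ** adj U) \<longlonglongrightarrow> U ** diag (\<lambda>i. l i powr s) ** adj U"
      unfolding matrix_matrix_mult_def by (intro tendsto_intros)
    then show ?thesis by (simp add: mat_powr_eqI[OF U l AU]) (simp add: AU G(2)[OF U])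
  qed
  with G(1) show ?thesis by (rule that)
qed

section \<open>Measurable and Borel representatives\<close>

lemma locally_integrable_measurable:
  fixes f :: "real^'n \<Rightarrow> 'b::euclidean_space"
  assumes "locally_integrable f"
  shows "f \<in> borel_measurable lebesgue"
proof (rule borel_measurable_LIMSEQ_metric)
  show "(\<lambda>x. indicator (cball 0 (real n)) x *\<^sub>R f x) \<in> borel_measurable lebesgue" for n
  proof -
    have "set_integrable lebesgue (cball 0 (real n)) f"
      using assms by (simp add: locally_integrable_def)
    then show ?thesis unfolding set_integrable_def by (rule borel_measurable_integrable)
  qed
  show "(\<lambda>n. indicator (cball 0 (real n)) x *\<^sub>R f x) \<longlonglongrightarrow> f x" for x
  proof (rule tendsto_eventually, rule eventually_sequentiallyI)
    fix n assume "nat \<lceil>norm x\<rceil> \<le> n"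
    then have "norm x \<le> real n" by linarith
    then show "indicator (cball 0 (real n)) x *\<^sub>R f x = f x" by simp
  qed
qed

lemma mat_powr_measurable:
  fixes W :: "real^'n \<Rightarrow> complex^'d^'d"
  assumes "matrix_weight W"
  obtains A where "A \<in> borel_measurable lebesgue" "AE x in lebesgue. A x = mat_powr (W x) s"
proof -
  obtain G :: "nat \<Rightarrow> complex^'d^'d \<Rightarrow> complex^'d^'d" where
    G: "\<And>n. continuous_on UNIV (G n)" "\<And>A. positive_definite A \<Longrightarrow> (\<lambda>n. G n A) \<longlonglongrightarrow> mat_powr A s"
    by (rule mat_powr_limit) blast
  have W: "W \<in> borel_measurable lebesgue" "AE x in lebesgue. positive_definite (W x)"
    using assms by (auto simp: matrix_weight_def intro: locally_integrable_measurable)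
  obtain Z where Z: "{x \<in> space lebesgue. \<not> positive_definite (W x)} \<subseteq> Z" "emeasure lebesgue Z = 0" "Z \<in> sets lebesgue"
    using AE_E[OF W(2)] by blast
  \<comment> \<open>The matrix power is unspecified unless the matrix is positive definite, hence
    the value 0 on a measurable null set that contains the exceptional points.\<close>
  let ?A = "\<lambda>x. if x \<in> Z then 0 else mat_powr (W x) s"
  have "?A \<in> borel_measurable lebesgue"
  proof (rule borel_measurable_LIMSEQ_metric)
    show "(\<lambda>x. if x \<in> Z then 0 else G n (W x)) \<in> borel_measurable lebesgue" for n
      using Z(3) by (intro measurable_If_set borel_measurable_const
        measurable_compose[OF W(1) borel_measurable_continuous_onI[OF G(1)]]) auto
    show "(\<lambda>n. if x \<in> Z then 0 else G n (W x)) \<longlonglongrightarrow> ?A x" for x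
      using Z(1) G(2)[of "W x"] by auto
  qed
  moreover have "AE x in lebesgue. ?A x = mat_powr (W x) s"
    using Z by (intro AE_I'[of Z]) (auto simp: null_sets_def)
  ultimately show ?thesis by (rule that)
qed

lemma lebesgue_measurable_borel_version:
  fixes f :: "real^'n \<Rightarrow> 'b::euclidean_space"
  assumes f: "f \<in> borel_measurable lebesgue"
  obtains g where "g \<in> borel_measurable borel" "AE x in lborel. f x = g x"
proof -
  have "\<exists>g\<in>borel_measurable lborel. AE x in lborel. f x \<bullet> b = g x" for b
    by (rule completion_ex_borel_measurable_real[OF borel_measurable_inner[OF f borel_measurable_const]])
  then obtain g where g: "\<And>b. g b \<in> borel_measurable lborel" "\<And>b. AE x in lborel. f x \<bullet> b = g b x" by metis
  have "AE x in lborel. \<forall>b\<in>Basis. f x \<bullet> b = g b x"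
    using g(2) by (intro AE_finite_allI) auto
  then have "AE x in lborel. f x = (\<Sum>b\<in>Basis. g b x *\<^sub>R b)"
    by eventually_elim (metis (no_types, lifting) euclidean_representation sum.cong)
  moreover have "(\<lambda>x. \<Sum>b\<in>Basis. g b x *\<^sub>R b) \<in> borel_measurable borel"
    using g(1) by measurable
  ultimately show ?thesis by (intro that)
qed

lemma norm_le_op_norm:
  fixes A :: "complex^'d^'d"
  shows "norm A \<le> real CARD('d) * op_norm A"
proof -
  have "norm (A *v axis i 1) \<le> op_norm A" for i
    using onorm[OF matrix_vector_mul_bounded_linear, of A "axis i 1"] by (simp add: op_norm_def norm_axis_complex)
  then have "(\<Sum>i\<in>UNIV. norm (A *v axis i 1)) \<le> (\<Sum>i\<in>(UNIV :: 'd set). op_norm A)" by (intro sum_mono)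
  then show ?thesis using norm_matrix_le_sum_columns[of A] by simp
qed

subsection \<open>Comparison with the dyadic operators\<close>

text \<open>The dyadic theory asks for Borel functions and for inverses at every point. On the null
  set where the Borel representatives are not inverse to each other, both are replaced by the
  identity.\<close>

lemma borel_weight_version:
  fixes W :: "real^'n \<Rightarrow> complex^'d^'d"
  assumes W: "matrix_weight W"
  obtains A B :: "real^'n \<Rightarrow> complex^'d^'d" where
    "A \<in> borel_measurable borel" "B \<in> borel_measurable borel"
    "\<And>x. A x ** B x = mat 1" "\<And>x. B x ** A x = mat 1"
    "AE x in lborel. A x = mat_powr (W x) s" "AE x in lborel. B x = mat_powr (W x) (- s)"
proof -
  obtain A1 where A1: "A1 \<in> borel_measurable lebesgue" "AE x in lebesgue. A1 x = mat_powr (W x) s"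
    by (rule mat_powr_measurable[OF W])
  obtain B1 where B1: "B1 \<in> borel_measurable lebesgue" "AE x in lebesgue. B1 x = mat_powr (W x) (- s)"
    by (rule mat_powr_measurable[OF W])
  obtain A0 where A0 [measurable]: "A0 \<in> borel_measurable borel" and A01: "AE x in lborel. A1 x = A0 x"
    by (rule lebesgue_measurable_borel_version[OF A1(1)])
  obtain B0 where B0 [measurable]: "B0 \<in> borel_measurable borel" and B01: "AE x in lborel. B1 x = B0 x"
    by (rule lebesgue_measurable_borel_version[OF B1(1)])
  have pd: "AE x in lborel. positive_definite (W x)"
    using W by (simp add: matrix_weight_def AE_completion_iff)
  define I where "I x \<longleftrightarrow> A0 x ** B0 x = mat 1 \<and> B0 x ** A0 x = mat 1" for x
  have [measurable]: "Measurable.pred borel I" unfolding I_def by measurable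
  have "AE x in lborel. A0 x = mat_powr (W x) s \<and> B0 x = mat_powr (W x) (- s) \<and> I x"
    using A01 B01 A1(2)[unfolded AE_completion_iff] B1(2)[unfolded AE_completion_iff] pd
  proof eventually_elim
    case (elim x)
    then show ?case
      using mat_powr_inverse[of "W x" s] mat_powr_inverse[of "W x" "- s"] by (simp add: I_def)
  qed
  then have "AE x in lborel. (if I x then A0 x else mat 1) = mat_powr (W x) s"
    "AE x in lborel. (if I x then B0 x else mat 1) = mat_powr (W x) (- s)"
    by (eventually_elim, simp)+
  moreover have "(\<lambda>x. if I x then A0 x else mat 1) \<in> borel_measurable borel"
    "(\<lambda>x. if I x then B0 x else mat 1) \<in> borel_measurable borel" by measurable
  moreover have "(if I x then A0 x else mat 1) ** (if I x then B0 x else mat 1) = mat 1"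
    "(if I x then B0 x else mat 1) ** (if I x then A0 x else mat 1) = mat 1" for x
    by (auto simp: I_def)
  ultimately show ?thesis by (intro that)
qed

lemma average_eq_lborel:
  "Q \<in> sets borel \<Longrightarrow> average Q h = (\<integral>\<^sup>+y. h y * indicator Q y \<partial>lborel) / emeasure lborel Q"
  by (simp add: average_def nn_integral_completion)

text \<open>The closed cube around a cell has the same measure. Two functions \<open>g\<close> and
  \<open>h\<close> appear because the Borel representative is compared with the integrand of the
  definition only almost everywhere.\<close>

lemma grid_average_le:
  fixes x :: "real^'n"
  obtains Q where "Q \<in> cubes"
    "\<And>g h. g \<in> borel_measurable borel \<Longrightarrow> AE y in lborel. g y \<le> h y \<Longrightarrow>
      dyadic_partition.av lborel (grid \<epsilon>) j g x \<le> average Q h"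
proof -
  interpret dyadic_partition "lborel :: (real^'n) measure" "grid \<epsilon>" "\<lambda>j. (1 / 2 powi j) ^ CARD('n)"
    by (rule dyadic_partition_grid)
  obtain a where a: "grid \<epsilon> j x \<subseteq> cbox a (\<chi> i. a $ i + 1 / 2 powi j)"
    by (rule grid_between_boxes)
  let ?Q = "cbox a (\<chi> i. a $ i + 1 / 2 powi j)"
  show ?thesis
  proof (rule that[of ?Q])
    show "?Q \<in> cubes" unfolding cubes_def by (rule CollectI) (metis powi2_pos zero_less_divide_1_iff)
    fix g h :: "real^'n \<Rightarrow> ennreal" assume g: "g \<in> borel_measurable borel" and gh: "AE y in lborel. g y \<le> h y"
    have "(\<integral>\<^sup>+y. g y * indicator (grid \<epsilon> j x) y \<partial>lborel) \<le> (\<integral>\<^sup>+y. h y * indicator ?Q y \<partial>lborel)"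
    proof (rule nn_integral_mono_AE)
      show "AE y in lborel. g y * indicator (grid \<epsilon> j x) y \<le> h y * indicator ?Q y"
        using gh by eventually_elim (use a in \<open>auto simp: indicator_def\<close>)
    qed
    then show "av j g x \<le> average ?Q h"
      using g by (simp add: av_eq average_eq_lborel emeasure_cube divide_right_mono_ennreal)
  qed
qed

text \<open>The factor d^p, with d the dimension, compares the Frobenius norm with the operator
  norm: d^p' in the inner integral, raised to the power p - 1.\<close>

lemma dyadic_Ap_if_Ap_const:
  fixes W :: "real^'n \<Rightarrow> complex^'d^'d"
  assumes p: "1 < p" and AB [measurable]: "A \<in> borel_measurable borel" "B \<in> borel_measurable borel"
    and inv: "\<And>x. A x ** B x = mat 1" "\<And>x. B x ** A x = mat 1"
    and ver: "AE x in lborel. A x = mat_powr (W x) (1 / p)" "AE x in lborel. B x = mat_powr (W x) (- (1 / p))"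
    and X: "Ap_const p W \<le> ennreal X" "0 \<le> X"
  shows "dyadic_filtration.dyadic_Ap lborel (grid \<epsilon>) p (real CARD('d) powr p * X) A B"
proof -
  interpret dyadic_filtration "lborel :: (real^'n) measure" "grid \<epsilon>" "\<lambda>j. (1 / 2 powi j) ^ CARD('n)" "2 ^ CARD('n)"
    by (rule dyadic_filtration_grid)
  let ?p' = "p / (p - 1)" and ?d = "real CARD('d)"
  have d: "0 < ?d" by simp
  have "av j (\<lambda>z. av j (\<lambda>y. ennreal (norm (A z ** B y)) \<up> ?p') x \<up> (p - 1)) x \<le> ennreal (?d powr p * X)" for j x
  proof -
    let ?I = "\<lambda>z. av j (\<lambda>y. ennreal (norm (A z ** B y)) \<up> ?p') x"
    have [measurable]: "?I \<in> borel_measurable borel"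
    proof -
      have 1: "(\<lambda>w. ennreal (norm (A (fst w) ** B (snd w))) \<up> ?p' * indicator (grid \<epsilon> j x) (snd w)) \<in> borel_measurable (lborel \<Otimes>\<^sub>M lborel)"
        by measurable
      have "?I z = (\<integral>\<^sup>+y. ennreal (norm (A z ** B y)) \<up> ?p' * indicator (grid \<epsilon> j x) y \<partial>lborel) / ennreal ((1 / 2 powi j) ^ CARD('n))" for z
        by (subst av_eq) auto
      moreover have "(\<lambda>z. (\<integral>\<^sup>+y. ennreal (norm (A z ** B y)) \<up> ?p' * indicator (grid \<epsilon> j x) y \<partial>lborel)) \<in> borel_measurable lborel"
        by (rule borel_measurable_nn_integral_kernel) (rule 1)
      ultimately show ?thesis by simp
    qed
    obtain Q where Q: "Q \<in> cubes" and av: "\<And>g h. g \<in> borel_measurable borel \<Longrightarrow> AE y in lborel. g y \<le> h y \<Longrightarrow> av j g x \<le> average Q h"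
      by (rule grid_average_le) blast
    let ?h = "\<lambda>z. average Q (\<lambda>y. ennreal (op_norm (mat_powr (W z) (1 / p) ** mat_powr (W y) (- 1 / p)) powr ?p'))"
    have "AE z in lborel. ennreal ((1 / ?d) powr p) * ?I z \<up> (p - 1) \<le> enn_powr (?h z) (p / ?p')"
      using ver(1)
    proof eventually_elim
      case (elim z)
      have "ennreal ((1 / ?d) powr ?p') * ?I z = av j (\<lambda>y. ennreal ((1 / ?d) powr ?p') * ennreal (norm (A z ** B y)) \<up> ?p') x"
        by (rule av_cmult[symmetric]) simp
      also have "\<dots> \<le> ?h z"
      proof (rule av)
        show "AE y in lborel. ennreal ((1 / ?d) powr ?p') * ennreal (norm (A z ** B y)) \<up> ?p'
          \<le> ennreal (op_norm (mat_powr (W z) (1 / p) ** mat_powr (W y) (- 1 / p)) powr ?p')"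
          using ver(2)
        proof eventually_elim
          case (elim y)
          let ?M = "A z ** B y"
          have "norm ?M / ?d \<le> op_norm ?M" using norm_le_op_norm[of ?M] d by (simp add: field_simps)
          then have "(norm ?M / ?d) powr ?p' \<le> op_norm ?M powr ?p'" using p by (intro powr_mono2) auto
          then have "(1 / ?d) powr ?p' * norm ?M powr ?p' \<le> op_norm ?M powr ?p'" by (simp flip: powr_mult)
          then have "ennreal ((1 / ?d) powr ?p') * ennreal (norm ?M) \<up> ?p' \<le> ennreal (op_norm ?M powr ?p')"
            by (simp add: enn_powr_ennreal ennreal_leI flip: ennreal_mult)
          then show ?case using elim \<open>A z = _\<close> by simp
        qed
      qed measurable
      finally have "(ennreal ((1 / ?d) powr ?p') * ?I z) \<up> (p - 1) \<le> ?h z \<up> (p - 1)"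
        using p by (intro enn_powr_mono) auto
      moreover have "p / ?p' = p - 1" "?p' * (p - 1) = p" using p by auto
      ultimately show ?case using p by (simp add: enn_powr_mult) (simp add: enn_powr_ennreal powr_powr)
    qed
    then have "av j (\<lambda>z. ennreal ((1 / ?d) powr p) * ?I z \<up> (p - 1)) x \<le> average Q (\<lambda>z. enn_powr (?h z) (p / ?p'))"
      by (intro av) auto
    also have "\<dots> \<le> Ap_const p W" unfolding Ap_const_def Let_def by (rule SUP_upper[OF Q])
    also have "\<dots> \<le> ennreal X" by (rule X)
    finally have "ennreal ((1 / ?d) powr p) * av j (\<lambda>z. ?I z \<up> (p - 1)) x \<le> ennreal X"
      by (subst (asm) av_cmult) auto
    then have "ennreal (?d powr p) * (ennreal ((1 / ?d) powr p) * av j (\<lambda>z. ?I z \<up> (p - 1)) x) \<le> ennreal (?d powr p) * ennreal X"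
      by (rule mult_left_mono) simp
    moreover have "ennreal (?d powr p) * (ennreal ((1 / ?d) powr p) * t) = t" for t
      using d by (simp add: ennreal_mult_left_assoc flip: powr_mult)
    ultimately show ?thesis using X by (simp add: ennreal_mult)
  qed
  then show ?thesis using AB inv unfolding dyadic_Ap_def by simp
qed

text \<open>Inserting \<open>B y ** A y\<close> bounds |A(x) f(y)| by the kernel times |A(y) f(y)|.
  The cube is enlarged to a cell of at most 6^n times its volume in one of the grids; summing over
  all grids makes the bound independent of which one.\<close>

lemma CG_maximal_le_grids:
  fixes W :: "real^'n \<Rightarrow> complex^'d^'d" and A B :: "real^'n \<Rightarrow> complex^'d^'d"
  assumes AB [measurable]: "A \<in> borel_measurable borel" "B \<in> borel_measurable borel"
    and inv: "\<And>x. B x ** A x = mat 1"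
    and x: "A x = mat_powr (W x) (1 / p)"
    and g [measurable]: "g \<in> borel_measurable borel" and fg: "AE y in lborel. f y = g y"
  shows "CG_maximal p W f x
    \<le> ennreal (6 ^ CARD('n)) * (\<Sum>\<epsilon>\<in>UNIV. dyadic_filtration.mmax lborel (grid \<epsilon>) A B (\<lambda>y. ennreal (norm (A y *v g y))) x)"
  unfolding CG_maximal_def
proof (rule SUP_least)
  fix Q :: "(real^'n) set" assume "Q \<in> cubes"
  then obtain a r where Q: "Q = cbox a (\<chi> i. a $ i + r)" and r: "0 < r" by (auto simp: cubes_def)
  let ?F = "\<lambda>y. ennreal (norm (A y *v g y))"
  let ?m = "\<lambda>\<epsilon>. dyadic_filtration.mmax lborel (grid \<epsilon>) A B ?F x"
  show "average Q (\<lambda>y. ennreal (norm (mat_powr (W x) (1 / p) *v f y))) * indicator Q x \<le> ennreal (6 ^ CARD('n)) * (\<Sum>\<epsilon>\<in>UNIV. ?m \<epsilon>)"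
  proof (cases "x \<in> Q")
    case True
    obtain \<epsilon> j where sub: "\<And>x. x \<in> Q \<Longrightarrow> Q \<subseteq> grid \<epsilon> j x" and size: "1 / 2 powi j \<le> 6 * r"
      unfolding Q by (rule cube_in_grid[OF r]) blast
    interpret dyadic_filtration "lborel :: (real^'n) measure" "grid \<epsilon>" "\<lambda>j. (1 / 2 powi j) ^ CARD('n)" "2 ^ CARD('n)"
      by (rule dyadic_filtration_grid)
    let ?k = "\<lambda>y. ennreal (norm (A x ** B y)) * ?F y"
    have "(\<integral>\<^sup>+y. ennreal (norm (A x *v f y)) * indicator Q y \<partial>lborel) \<le> (\<integral>\<^sup>+y. ?k y * indicator (grid \<epsilon> j x) y \<partial>lborel)"
    proof (rule nn_integral_mono_AE)
      show "AE y in lborel. ennreal (norm (A x *v f y)) * indicator Q y \<le> ?k y * indicator (grid \<epsilon> j x) y"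
        using fg
      proof eventually_elim
        case (elim y)
        have "A x *v g y = (A x ** B y) *v (A y *v g y)"
          by (simp add: matrix_vector_mul_assoc inv flip: matrix_mul_assoc)
        then have "norm (A x *v g y) \<le> norm (A x ** B y) * norm (A y *v g y)"
          using norm_matrix_vector_le[of "A x ** B y" "A y *v g y"] by simp
        then have "ennreal (norm (A x *v f y)) \<le> ?k y" by (simp add: elim ennreal_leI flip: ennreal_mult)
        then show ?case using sub[OF True] by (auto simp: indicator_def)
      qed
    qed
    also have "\<dots> = ennreal ((1 / 2 powi j) ^ CARD('n)) * av j ?k x"
      by (rule nn_integral_D_eq) measurable
    also have "\<dots> \<le> ennreal ((6 * r) ^ CARD('n)) * ?m \<epsilon>"
      unfolding mmax_def using size by (intro mult_mono ennreal_leI power_mono SUP_upper) auto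
    also have "\<dots> = ennreal (r ^ CARD('n)) * (ennreal (6 ^ CARD('n)) * ?m \<epsilon>)"
      using r by (subst ennreal_mult_left_assoc) (auto simp: power_mult_distrib mult.commute)
    finally have le: "(\<integral>\<^sup>+y. ennreal (norm (A x *v f y)) * indicator Q y \<partial>lborel) \<le> ennreal (r ^ CARD('n)) * (ennreal (6 ^ CARD('n)) * ?m \<epsilon>)" .
    have "average Q (\<lambda>y. ennreal (norm (A x *v f y))) \<le> ennreal (r ^ CARD('n)) * (ennreal (6 ^ CARD('n)) * ?m \<epsilon>) / ennreal (r ^ CARD('n))"
      using r unfolding Q by (subst average_eq_lborel) (auto simp: emeasure_cube intro!: divide_right_mono_ennreal le[unfolded Q])
    also have "\<dots> = ennreal (6 ^ CARD('n)) * ?m \<epsilon>"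
      using r by (subst mult.commute) (simp add: ennreal_mult_divide_eq)
    also have "\<dots> \<le> ennreal (6 ^ CARD('n)) * (\<Sum>\<epsilon>\<in>UNIV. ?m \<epsilon>)"
      by (intro mult_left_mono member_le_sum) auto
    finally show ?thesis using True by (simp add: x)
  qed simp
qed

theorem theorem1:
  fixes p q :: real
  assumes "1 < p" and "1 < q"
  shows "\<exists>C::real. 0 < C \<and>
    (\<forall>(W :: real^'n \<Rightarrow> complex^'d^'d) (f :: nat \<Rightarrow> real^'n \<Rightarrow> complex^'d).
       matrix_Ap p W \<longrightarrow> (\<forall>k. locally_integrable (f k)) \<longrightarrow>
       Lp_norm p (\<lambda>x. lq_norm q (\<lambda>k. CG_maximal p W (f k) x))
         \<le> ennreal C * enn_powr (Ap_const p W) (max (1 / (q - 1)) (1 / (p - 1)))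
           * Lp_norm p (\<lambda>x. lq_norm q (\<lambda>k. ennreal (norm (mat_powr (W x) (1 / p) *v f k x)))))"
proof -
  note p = \<open>1 < p\<close> and q = \<open>1 < q\<close>
  define \<alpha> where "\<alpha> = max (1 / (q - 1)) (1 / (p - 1))"
  have \<alpha>: "0 < \<alpha>" using q by (simp add: \<alpha>_def less_max_iff_disj)
  let ?mm = "\<lambda>\<epsilon> :: 'n \<Rightarrow> bool. dyadic_filtration.mmax lborel (grid \<epsilon>)"
  let ?Ap = "\<lambda>\<epsilon> :: 'n \<Rightarrow> bool. dyadic_filtration.dyadic_Ap lborel (grid \<epsilon>) p"
  have "\<exists>C>0. \<forall>(A :: real^'n \<Rightarrow> complex^'d^'d) B N F. 1 \<le> N \<longrightarrow> ?Ap \<epsilon> N A B \<longrightarrow> (\<forall>k::nat. F k \<in> borel_measurable lborel) \<longrightarrow>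
    (\<integral>\<^sup>+x. (\<Sum>k. ?mm \<epsilon> A B (F k) x \<up> q) \<up> (p / q) \<partial>lborel)
      \<le> ennreal (C * N powr (p * \<alpha>)) * (\<integral>\<^sup>+x. (\<Sum>k. F k x \<up> q) \<up> (p / q) \<partial>lborel)" for \<epsilon>
    unfolding \<alpha>_def by (rule dyadic_filtration.vector_valued_bound[OF dyadic_filtration_grid p q])
  then obtain C0 where C0: "\<And>\<epsilon>. 0 < C0 \<epsilon>" and bd: "\<And>\<epsilon> (A :: real^'n \<Rightarrow> complex^'d^'d) B N F. 1 \<le> N \<Longrightarrow> ?Ap \<epsilon> N A B \<Longrightarrow> (\<And>k::nat. F k \<in> borel_measurable lborel) \<Longrightarrow>
    (\<integral>\<^sup>+x. (\<Sum>k. ?mm \<epsilon> A B (F k) x \<up> q) \<up> (p / q) \<partial>lborel)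
      \<le> ennreal (C0 \<epsilon> * N powr (p * \<alpha>)) * (\<integral>\<^sup>+x. (\<Sum>k. F k x \<up> q) \<up> (p / q) \<partial>lborel)"
    by metis
  \<comment> \<open>Every grid has its own constant. There are finitely many, and all are fixed
    before the weight is chosen.\<close>
  define C1 where "C1 = (\<Sum>\<epsilon>\<in>UNIV. C0 \<epsilon>)"
  have C1: "0 < C1" unfolding C1_def using C0 by (intro sum_pos) auto
  define E where "E = real (card (UNIV :: ('n \<Rightarrow> bool) set))"
  have E: "0 < E" unfolding E_def by (simp add: finite_UNIV_card_ge_0)
  \<comment> \<open>6^n comes from enlarging cubes; the number \<open>E\<close> of grids enters once
    for the q-th power of the sum over grids and once for the power p/q.\<close>
  define c where "c = ((6 ^ CARD('n) :: real) powr q * E powr q) powr (p / q) * E powr (p / q)"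
  have c: "0 < c" using E by (simp add: c_def)
  define d where "d = real CARD('d) powr p"
  have d: "0 < d" by (simp add: d_def)
  show ?thesis
  proof (intro exI[of _ "(c * C1) powr (1 / p) * d powr \<alpha>"] conjI allI impI)
    show "0 < (c * C1) powr (1 / p) * d powr \<alpha>" using c C1 d by simp
    fix W :: "real^'n \<Rightarrow> complex^'d^'d" and f :: "nat \<Rightarrow> real^'n \<Rightarrow> complex^'d"
    assume W: "matrix_Ap p W" and f: "\<forall>k. locally_integrable (f k)"
    then have wt: "matrix_weight W" and fin: "Ap_const p W < top" by (auto simp: matrix_Ap_def)
    define X where "X = enn2real (Ap_const p W)"
    have X: "Ap_const p W = ennreal X" "0 \<le> X" using fin by (auto simp: X_def)
    obtain A B :: "real^'n \<Rightarrow> complex^'d^'d" where AB [measurable]: "A \<in> borel_measurable borel" "B \<in> borel_measurable borel"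
      and inv: "\<And>x. A x ** B x = mat 1" "\<And>x. B x ** A x = mat 1"
      and ver: "AE x in lborel. A x = mat_powr (W x) (1 / p)" "AE x in lborel. B x = mat_powr (W x) (- (1 / p))"
      by (rule borel_weight_version[OF wt, of "1 / p"]) ((assumption | rule that)+)
    have "\<exists>g. g \<in> borel_measurable borel \<and> (AE x in lborel. f k x = g x)" for k
      using lebesgue_measurable_borel_version[OF locally_integrable_measurable[of "f k"]] f by metis
    then obtain g where g [measurable]: "\<And>k. g k \<in> borel_measurable borel" and fg: "\<And>k. AE x in lborel. f k x = g k x"
      by metis
    define F where "F k y = ennreal (norm (A y *v g k y))" for k y
    have F [measurable]: "F k \<in> borel_measurable lborel" for k unfolding F_def by measurable
    have Ap: "?Ap \<epsilon> (d * X) A B" for \<epsilon>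
      unfolding d_def using X by (intro dyadic_Ap_if_Ap_const[OF p AB inv ver]) auto
    \<comment> \<open>The bounds \<open>bd\<close> suppose a characteristic of at least 1; a single
      cell of a single grid suffices to verify it.\<close>
    have N: "1 \<le> d * X"
    proof -
      define \<epsilon> where "\<epsilon> = (\<lambda>_ :: 'n. False)"
      interpret dyadic_filtration "lborel :: (real^'n) measure" "grid \<epsilon>" "\<lambda>j. (1 / 2 powi j) ^ CARD('n)" "2 ^ CARD('n)"
        by (rule dyadic_filtration_grid)
      have "1 \<le> av 0 (\<lambda>z. av 0 (\<lambda>y. ennreal (norm (A z ** B y)) \<up> (p / (p - 1))) 0 \<up> (p - 1)) 0"
        unfolding av_def by (rule kernel_ge_1[OF _ _ inv p emeasure_unif sigma_finite_unif]) measurable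
      also have "\<dots> \<le> ennreal (d * X)" using Ap[of \<epsilon>] unfolding dyadic_Ap_def by blast
      finally show ?thesis using X d by simp
    qed
    have mmm [measurable]: "?mm \<epsilon> A B (F k) \<in> borel_measurable lborel" for \<epsilon> k
      by (intro dyadic_filtration.borel_measurable_mmax[OF dyadic_filtration_grid]) measurable
    let ?S = "\<lambda>\<epsilon> x. (\<Sum>k. ?mm \<epsilon> A B (F k) x \<up> q) \<up> (p / q)"
    let ?Y = "\<integral>\<^sup>+x. (\<Sum>k. F k x \<up> q) \<up> (p / q) \<partial>lborel"
    \<comment> \<open>The inner root and the outer power combine to p/q, and integrals over the
      completion agree with those over \<open>lborel\<close>.\<close>
    have Lp: "Lp_norm p (\<lambda>x. lq_norm q (h x)) = (\<integral>\<^sup>+x. (\<Sum>k. h x k \<up> q) \<up> (p / q) \<partial>lborel) \<up> (1 / p)" for h :: "real^'n \<Rightarrow> nat \<Rightarrow> ennreal"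
      using p q by (simp add: Lp_norm_def lq_norm_def nn_integral_completion enn_powr_powr)
    have pt: "AE x in lborel. (\<Sum>k. CG_maximal p W (f k) x \<up> q) \<up> (p / q) \<le> ennreal c * (\<Sum>\<epsilon>\<in>UNIV. ?S \<epsilon> x)"
      using ver(1)
    proof eventually_elim
      case (elim x)
      let ?u = "(6 ^ CARD('n) :: real)"
      have "CG_maximal p W (f k) x \<up> q \<le> ennreal (?u powr q * E powr q) * (\<Sum>\<epsilon>\<in>UNIV. ?mm \<epsilon> A B (F k) x \<up> q)" for k
      proof -
        have "CG_maximal p W (f k) x \<up> q \<le> (ennreal ?u * (\<Sum>\<epsilon>\<in>UNIV. ?mm \<epsilon> A B (F k) x)) \<up> q"
          unfolding F_def using q by (intro enn_powr_mono CG_maximal_le_grids AB inv elim g fg) auto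
        also have "\<dots> = ennreal (?u powr q) * (\<Sum>\<epsilon>\<in>UNIV. ?mm \<epsilon> A B (F k) x) \<up> q"
          using q by (subst enn_powr_mult) (auto simp: enn_powr_ennreal)
        also have "\<dots> \<le> ennreal (?u powr q) * (ennreal (E powr q) * (\<Sum>\<epsilon>\<in>UNIV. ?mm \<epsilon> A B (F k) x \<up> q))"
          unfolding E_def using q by (intro mult_left_mono sum_enn_powr_le) auto
        also have "\<dots> = ennreal (?u powr q * E powr q) * (\<Sum>\<epsilon>\<in>UNIV. ?mm \<epsilon> A B (F k) x \<up> q)"
          by (rule ennreal_mult_left_assoc) auto
        finally show ?thesis .
      qed
      then have "(\<Sum>k. CG_maximal p W (f k) x \<up> q) \<le> (\<Sum>k. ennreal (?u powr q * E powr q) * (\<Sum>\<epsilon>\<in>UNIV. ?mm \<epsilon> A B (F k) x \<up> q))"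
        by (intro suminf_le) auto
      also have "\<dots> = ennreal (?u powr q * E powr q) * (\<Sum>\<epsilon>\<in>UNIV. \<Sum>k. ?mm \<epsilon> A B (F k) x \<up> q)"
        by (simp add: ennreal_suminf_cmult suminf_sum)
      finally have "(\<Sum>k. CG_maximal p W (f k) x \<up> q) \<up> (p / q) \<le> (ennreal (?u powr q * E powr q) * (\<Sum>\<epsilon>\<in>UNIV. \<Sum>k. ?mm \<epsilon> A B (F k) x \<up> q)) \<up> (p / q)"
        using p q by (intro enn_powr_mono) auto
      also have "\<dots> = ennreal ((?u powr q * E powr q) powr (p / q)) * (\<Sum>\<epsilon>\<in>UNIV. \<Sum>k. ?mm \<epsilon> A B (F k) x \<up> q) \<up> (p / q)"
        using p q by (subst enn_powr_mult) (auto simp: enn_powr_ennreal)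
      also have "\<dots> \<le> ennreal ((?u powr q * E powr q) powr (p / q)) * (ennreal (E powr (p / q)) * (\<Sum>\<epsilon>\<in>UNIV. ?S \<epsilon> x))"
        unfolding E_def using p q by (intro mult_left_mono sum_enn_powr_le) auto
      also have "\<dots> = ennreal c * (\<Sum>\<epsilon>\<in>UNIV. ?S \<epsilon> x)"
        unfolding c_def by (rule ennreal_mult_left_assoc) auto
      finally show ?case .
    qed
    have "(\<integral>\<^sup>+x. (\<Sum>k. CG_maximal p W (f k) x \<up> q) \<up> (p / q) \<partial>lborel) \<le> (\<integral>\<^sup>+x. ennreal c * (\<Sum>\<epsilon>\<in>UNIV. ?S \<epsilon> x) \<partial>lborel)"
      by (rule nn_integral_mono_AE[OF pt])
    also have "\<dots> = ennreal c * (\<Sum>\<epsilon>\<in>UNIV. \<integral>\<^sup>+x. ?S \<epsilon> x \<partial>lborel)"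
      by (subst nn_integral_cmult) (auto simp: nn_integral_sum)
    also have "\<dots> \<le> ennreal c * (\<Sum>\<epsilon>\<in>UNIV. ennreal (C0 \<epsilon> * (d * X) powr (p * \<alpha>)) * ?Y)"
      by (intro mult_left_mono sum_mono bd N Ap F) auto
    also have "(\<Sum>\<epsilon>\<in>UNIV. ennreal (C0 \<epsilon> * (d * X) powr (p * \<alpha>)) * ?Y) = ennreal (C1 * (d * X) powr (p * \<alpha>)) * ?Y"
    proof -
      let ?t = "(d * X) powr (p * \<alpha>)"
      have "(\<Sum>\<epsilon>\<in>UNIV. ennreal (C0 \<epsilon> * ?t) * ?Y) = (\<Sum>\<epsilon>\<in>UNIV. ennreal (C0 \<epsilon> * ?t)) * ?Y"
        by (rule sum_distrib_right[symmetric])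
      also have "(\<Sum>\<epsilon>\<in>UNIV. ennreal (C0 \<epsilon> * ?t)) = ennreal (\<Sum>\<epsilon>\<in>UNIV. C0 \<epsilon> * ?t)"
        by (rule sum_ennreal) (simp add: C0 less_imp_le)
      also have "(\<Sum>\<epsilon>\<in>UNIV. C0 \<epsilon> * ?t) = C1 * ?t" by (simp add: C1_def sum_distrib_right)
      finally show ?thesis .
    qed
    also have "ennreal c * (ennreal (C1 * (d * X) powr (p * \<alpha>)) * ?Y) = ennreal (c * (C1 * (d * X) powr (p * \<alpha>))) * ?Y"
      using c C1 by (intro ennreal_mult_left_assoc) auto
    finally have "(\<integral>\<^sup>+x. (\<Sum>k. CG_maximal p W (f k) x \<up> q) \<up> (p / q) \<partial>lborel) \<up> (1 / p) \<le> (ennreal (c * (C1 * (d * X) powr (p * \<alpha>))) * ?Y) \<up> (1 / p)"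
      using p by (intro enn_powr_mono) auto
    also have "\<dots> = ennreal ((c * (C1 * (d * X) powr (p * \<alpha>))) powr (1 / p)) * ?Y \<up> (1 / p)"
      using p c C1 by (subst enn_powr_mult) (auto simp: enn_powr_ennreal)
    \<comment> \<open>The p-th root turns the power \<open>p * \<alpha>\<close> into
      \<open>\<alpha>\<close>; the factor \<open>d\<close> from the change of matrix norm joins the
      constant.\<close>
    also have "(c * (C1 * (d * X) powr (p * \<alpha>))) powr (1 / p) = (c * C1) powr (1 / p) * d powr \<alpha> * X powr \<alpha>"
      using p c C1 d X by (simp add: powr_mult powr_powr)
    also have "ennreal ((c * C1) powr (1 / p) * d powr \<alpha> * X powr \<alpha>) = ennreal ((c * C1) powr (1 / p) * d powr \<alpha>) * Ap_const p W \<up> \<alpha>"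
      using X by (simp add: enn_powr_ennreal flip: ennreal_mult)
    also have "?Y = (\<integral>\<^sup>+x. (\<Sum>k. ennreal (norm (mat_powr (W x) (1 / p) *v f k x)) \<up> q) \<up> (p / q) \<partial>lborel)"
    proof (rule nn_integral_cong_AE)
      have "AE x in lborel. \<forall>k. f k x = g k x" using fg by (simp add: AE_all_countable)
      then show "AE x in lborel. (\<Sum>k. F k x \<up> q) \<up> (p / q) = (\<Sum>k. ennreal (norm (mat_powr (W x) (1 / p) *v f k x)) \<up> q) \<up> (p / q)"
        using ver(1) by eventually_elim (simp add: F_def)
    qed
    finally show "Lp_norm p (\<lambda>x. lq_norm q (\<lambda>k. CG_maximal p W (f k) x))
         \<le> ennreal ((c * C1) powr (1 / p) * d powr \<alpha>) * Ap_const p W \<up> max (1 / (q - 1)) (1 / (p - 1))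
           * Lp_norm p (\<lambda>x. lq_norm q (\<lambda>k. ennreal (norm (mat_powr (W x) (1 / p) *v f k x))))"
      unfolding Lp \<alpha>_def .
  qed
qed

end
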